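(* Let $m\ge 1$ and $n_1,\dots,n_m\ge 1$ be integers. Suppose that $1<p<q<\infty$, and that $0<\beta_i<n_i$ and $\frac1q=\frac1p-\frac{\beta_i}{n_i}$ for every $1\le i\le m$. If $f\in L^p(\mathbb{R}^{n_1}\times\cdots\times\mathbb{R}^{n_m})$, then $$\|\mathscr{H}_{\beta_1,\dots,\beta_m}(f)\|_{L^q(\mathbb{R}^{n_1}\times\cdots\times\mathbb{R}^{n_m})}\le C\,\|f\|_{L^p(\mathbb{R}^{n_1}\times\cdots\times\mathbb{R}^{n_m})}.$$ Moreover, $$\|\mathscr{H}_{\beta_1,\dots,\beta_m}\|_{L^p(\mathbb{R}^{n_1}\times\cdots\times\mathbb{R}^{n_m})\to L^q(\mathbb{R}^{n_1}\times\cdots\times\mathbb{R}^{n_m})}=C,$$ where $$C=\prod_{i=1}^{m}\left(\frac{p'}{q}\right)^{1/q}\left(\frac{n_i}{q\beta_i}\cdot B\left(\frac{n_i}{q\beta_i},\frac{n_i}{q'\beta_i}\right)\right)^{-\beta_i/n_i}.$$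
   Context: For $0\le\beta_i<n_i$ ($1\le i\le m$) and $f$ a non-negative measurable function on $\mathbb{R}^{n_1}\times\cdots\times\mathbb{R}^{n_m}$ (or, by the same formula, a general function $f$ in the given Lebesgue space), the fractional Hardy type operator is $$\mathscr{H}_{\beta_1,\dots,\beta_m}(f)(x)=\prod_{i=1}^m\frac{1}{|B(0,|x_i|)|^{1-\frac{\beta_i}{n_i}}}\int_{|y_1|<|x_1|}\cdots\int_{|y_m|<|x_m|}f(y_1,\dots,y_m)\,dy_1\cdots dy_m,$$ for $x=(x_1,\dots,x_m)\in\mathbb{R}^{n_1}\times\cdots\times\mathbb{R}^{n_m}$ with $\prod_{i=1}^m|x_i|\ne0$. Here $|x_i|$ is the Euclidean norm of $x_i\in\mathbb{R}^{n_i}$, $B(0,|x_i|)$ is the open ball in $\mathbb{R}^{n_i}$ centred at the origin with radius $|x_i|$, and $|B(0,|x_i|)|$ is its Lebesgue measure. $L^p$ and $L^q$ are taken with respect to Lebesgue measure. The operator norm is $\sup_{f\neq 0}\|\mathscr{H}_{\beta_1,\dots,\beta_m}(f)\|_{L^q}/\|f\|_{L^p}$. For $1<r<\infty$, $r'$ is the conjugate exponent, $1/r+1/r'=1$. $B(z,w)=\int_0^1t^{z-1}(1-t)^{w-1}\,dt$ is the Beta function. *)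

theory Defs
  imports "HOL-Analysis.Analysis"
begin

text \<open>
  The dimensions \<open>n\<^sub>1, \<dots>, n\<^sub>m\<close> vary with the index, so a vector of \<open>\<real>\<^sup>d\<close> is a function
  \<open>nat \<Rightarrow> real\<close> restricted to the index set \<open>{1..d}\<close>, and a point of
  \<open>\<real>\<^bsup>n\<^sub>1\<^esup> \<times> \<dots> \<times> \<real>\<^bsup>n\<^sub>m\<^esup>\<close> is a family of such vectors indexed by \<open>{1..m}\<close>.
\<close>

definition Rn_measure :: "nat \<Rightarrow> (nat \<Rightarrow> real) measure" where
  "Rn_measure d = (\<Pi>\<^sub>M j\<in>{1..d}. lborel)"

definition Rn_norm :: "nat \<Rightarrow> (nat \<Rightarrow> real) \<Rightarrow> real" where
  "Rn_norm d v = L2_set v {1..d}"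

definition Rn_ball :: "nat \<Rightarrow> real \<Rightarrow> (nat \<Rightarrow> real) set" where
  "Rn_ball d r = {v \<in> space (Rn_measure d). Rn_norm d v < r}"

text \<open>The completion yields Lebesgue (rather than merely Borel) measurability.\<close>

definition Rprod_measure :: "nat \<Rightarrow> (nat \<Rightarrow> nat) \<Rightarrow> (nat \<Rightarrow> nat \<Rightarrow> real) measure" where
  "Rprod_measure m n = completion (\<Pi>\<^sub>M i\<in>{1..m}. Rn_measure (n i))"

text \<open>The \<open>L\<^sup>p\<close> norm takes the value \<open>\<infinity>\<close> when the integral diverges.\<close>

definition Lp_norm :: "'a measure \<Rightarrow> real \<Rightarrow> ('a \<Rightarrow> 'b::real_normed_vector) \<Rightarrow> ennreal" where
  "Lp_norm M p f =
    (let I = (\<integral>\<^sup>+x. ennreal (norm (f x) powr p) \<partial>M)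
     in if I = \<infinity> then \<infinity> else ennreal (enn2real I powr (1 / p)))"

definition Lp_space :: "'a measure \<Rightarrow> real \<Rightarrow> ('a \<Rightarrow> 'b::real_normed_vector) set" where
  "Lp_space M p = {f \<in> borel_measurable M. Lp_norm M p f < \<infinity>}"

definition Lp_Lq_opnorm ::
    "'a measure \<Rightarrow> real \<Rightarrow> real \<Rightarrow> (('a \<Rightarrow> 'b::real_normed_vector) \<Rightarrow> 'a \<Rightarrow> 'b) \<Rightarrow> ennreal" where
  "Lp_Lq_opnorm M p q T =
    (SUP f\<in>{f \<in> Lp_space M p. \<not> (AE x in M. f x = 0)}. Lp_norm M q (T f) / Lp_norm M p f)"

text \<open>
  Points with some \<open>\<bar>x\<^sub>i\<bar> = 0\<close> form a null set; there the value is \<open>0\<close> because \<open>0 powr a = 0\<close>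
  and \<open>1 / 0 = 0\<close>.
\<close>

definition hardy_frac ::
    "nat \<Rightarrow> (nat \<Rightarrow> nat) \<Rightarrow> (nat \<Rightarrow> real) \<Rightarrow>
     ((nat \<Rightarrow> nat \<Rightarrow> real) \<Rightarrow> 'b::{banach, second_countable_topology}) \<Rightarrow>
     (nat \<Rightarrow> nat \<Rightarrow> real) \<Rightarrow> 'b" where
  "hardy_frac m n \<beta> f x =
    (\<Prod>i=1..m. 1 / measure (Rn_measure (n i)) (Rn_ball (n i) (Rn_norm (n i) (x i)))
                   powr (1 - \<beta> i / real (n i))) *\<^sub>R
    (LINT y:{y \<in> space (Rprod_measure m n). \<forall>i\<in>{1..m}. Rn_norm (n i) (y i) < Rn_norm (n i) (x i)}
       |Rprod_measure m n. f y)"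

end

theory Submission
  imports Defs
begin

text \<open>
  The map \<open>x \<mapsto> |B(0,|x|)|\<close> pushes Lebesgue measure on \<open>\<real>\<^sup>d\<close> forward to Lebesgue measure on the
  half-line, so each factor of the operator is a one-dimensional Hardy operator with
  \<open>\<beta>\<^sub>i / n\<^sub>i = 1/p - 1/q\<close>, and the one-factor bound is Bliss's inequality
  \<open>\<integral> F\<^sup>q s\<^bsup>r-q\<^esup> ds \<le> K (\<integral> f\<^sup>p ds)\<^bsup>q/p\<^esup>\<close>, where \<open>F(s) = \<integral>\<^sub>0\<^sup>s f\<close> and \<open>r = q/p - 1\<close>.
  It is proved by mass transport: \<open>S\<close> carries the mass \<open>F\<^sup>q s\<^bsup>r-q\<^esup> ds\<close> to the same expression for the
  extremal function, and integrating the derivative of \<open>F\<^bsup>q-r\<^esup> s\<^bsup>\<alpha>\<^esup> S\<^bsup>-\<kappa>\<^esup>\<close>, with the weighted AM-GM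
  inequality for \<open>s S'/S\<close> and Young's inequality for \<open>f\<close>, compares the two energies sharply.
  As \<open>p \<le> q\<close>, Minkowski's integral inequality lets the one-factor bounds be applied one variable
  at a time, and the product of the one-dimensional extremals attains the resulting constant.
\<close>

section \<open>The extremal profile\<close>

text \<open>No constant is lost because the target of the transport is an actual extremal: when
  \<open>F\<close> is \<open>extremal_prim\<close>, the transport is the identity,
  \<open>s S'/S = 1\<close>, and Young's inequality and AM-GM are both equalities. Multiplying
  \<open>f\<close> by a constant adjusts the total mass, so it may be assumed equal to
  \<open>moment_lim\<close>; the claim is then that the energy is at least \<open>mass_lim\<close>.
  The obstacle is regularity: the argument differentiates \<open>F\<close> and needs control of
  \<open>F\<close> and \<open>S\<close> near \<open>0\<close>, which membership in a Lebesgue space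
  does not give. It is therefore run for continuous \<open>f\<close> bounded below by a positive
  constant. A general \<open>f\<close> enters only through the integrals of \<open>f\<close> and
  \<open>f powr p\<close> over the sets \<open>\<tau> < s\<close>, whose increments are tied
  together by Hoelder's inequality; functions that are not radial are thus covered directly. The
  factors of \<open>C\<close> have two origins: the substitution
  \<open>u = t powr r / (1 + t powr r)\<close> makes \<open>mass_lim\<close> a Beta integral, and
  integration by parts gives \<open>moment_lim = mass_lim / (q - r - 1)\<close>, where
  \<open>1 / (q - r - 1) = p' / q\<close>.\<close>

lemma at_right_lower_bound:
  fixes f :: "real \<Rightarrow> real"
  assumes deriv: "\<And>x. 0 < x \<Longrightarrow> x < b \<Longrightarrow> \<exists>d. DERIV f x :> d \<and> d \<ge> 0"
    and lim: "(f \<longlongrightarrow> L) (at_right 0)" and x: "0 < x" "x < b"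
  shows "L \<le> f x"
proof (rule tendsto_upperbound[OF lim])
  have "f u \<le> f x" if "0 < u" "u < x" for u
    using that x by (intro DERIV_nonneg_imp_nondecreasing[of u x f] deriv) auto
  then show "\<forall>\<^sub>F u in at_right 0. f u \<le> f x"
    unfolding eventually_at_right_field using x(1) by blast
qed simp

lemma eventually_nonneg_at_right_0: "\<forall>\<^sub>F x in at_right 0. 0 \<le> (x :: real)"
  by (rule eventually_mono[OF eventually_at_right_less]) auto

locale hardy_exponents =
  fixes p q :: real
  assumes p_gt_1: "1 < p" and p_less_q: "p < q"
begin

definition r :: real where "r = q / p - 1"

lemma r_pos: "r > 0"
  using p_gt_1 p_less_q by (simp add: r_def field_simps)

lemma q_minus_r: "q - r > 1"
proof -
  have "q - r - 1 = (p - 1) * (r + 1)"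
    using p_gt_1 by (simp add: r_def field_simps)
  moreover have "\<dots> > 0" using p_gt_1 r_pos by simp
  ultimately show ?thesis by simp
qed

lemma q_gt_1: "q > 1" using p_gt_1 p_less_q by simp

text \<open>
  With \<open>c = 1 + t\<^sup>r\<close>, the extremal of Bliss's inequality is \<open>c\<^bsup>-1/r-1\<^esup>\<close>, with
  primitive \<open>t c\<^bsup>-1/r\<^esup>\<close>; \<open>profile t\<close> is the \<open>p\<close>-th power of the former, and
  \<open>t\<^sup>r profile t\<close> is \<open>t\<^bsup>r-q\<^esup>\<close> times the \<open>q\<close>-th power of the latter.
\<close>

definition profile :: "real \<Rightarrow> real" where
  "profile t = (1 + t powr r) powr (- (q / r))"

text \<open>The integral of \<open>profile\<close> over \<open>(0, x)\<close>, written as an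
  incomplete Beta integral by the substitution \<open>u = t powr r / (1 + t powr r)\<close>, so that
  its limit at infinity is a complete Beta integral.\<close>

definition mass :: "real \<Rightarrow> real" where
  "mass x = integral {0..x powr r / (1 + x powr r)}
           (\<lambda>t. t powr (1 / r - 1) * (1 - t) powr ((q - 1) / r - 1)) / r"

text \<open>The integral of \<open>t powr r * profile t\<close> over \<open>(0, x)\<close>, in the
  closed form given by integration by parts: the subtracted product has derivative
  \<open>profile x - (q - r - 1) * x powr r * profile x\<close>.\<close>

definition moment :: "real \<Rightarrow> real" where
  "moment x = (mass x - x * (1 + x powr r) powr (- ((q - r) / r))) / (q - r - 1)"

definition mass_lim :: real where "mass_lim = Beta (1 / r) ((q - 1) / r) / r"

definition moment_lim :: real where "moment_lim = mass_lim / (q - r - 1)"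

lemma profile_pos: "profile t > 0"
proof -
  have "1 + t powr r > 0" by (intro add_pos_nonneg) auto
  then show ?thesis by (simp add: profile_def)
qed

lemma profile_le_1: "profile t \<le> 1"
proof -
  have "(1 + t powr r) powr (- (q / r)) \<le> (1 + t powr r) powr 0"
    using r_pos q_gt_1 by (intro powr_mono) auto
  also have "\<dots> = 1" using add_pos_nonneg[OF zero_less_one powr_ge_zero, of t r] by simp
  finally show ?thesis by (simp add: profile_def)
qed

lemma mass_lim_pos: "mass_lim > 0"
proof -
  have "1 / r > 0" "(q - 1) / r > 0"
    using r_pos q_gt_1 by auto
  then have "Gamma (1 / r) > 0" "Gamma ((q - 1) / r) > 0" "Gamma (1 / r + (q - 1) / r) > 0"
    by (auto intro!: Gamma_real_pos add_pos_pos simp del: zero_less_divide_iff)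
  then have "Beta (1 / r) ((q - 1) / r) > 0"
    unfolding Beta_def by (intro divide_pos_pos mult_pos_pos)
  then show ?thesis using r_pos by (simp add: mass_lim_def)
qed

lemma moment_lim_pos: "moment_lim > 0"
  using mass_lim_pos q_minus_r by (simp add: moment_lim_def)

lemma DERIV_mass:
  assumes x: "x > 0"
  shows "DERIV mass x :> profile x"
proof -
  let ?b = "\<lambda>t. t powr (1 / r - 1) * (1 - t) powr ((q - 1) / r - 1)"
  let ?c = "1 + x powr r"
  have c: "?c > 0" using x by (intro add_pos_pos) auto
  define y where "y = x powr r / ?c"
  have y: "0 < y" "y < 1" using x c by (simp_all add: y_def)
  have int: "?b integrable_on {0..1}"
    using has_integral_Beta_real[of "1/r" "(q-1)/r"] r_pos q_gt_1 by (auto simp: integrable_on_def)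
  \<comment> \<open>The Beta integrand may be unbounded near the ends, so only its integrability on
    \<open>{0..1}\<close> and its continuity at the interior point \<open>y\<close> can be
    used.\<close>
  have "((\<lambda>u. integral {0..u} ?b) has_vector_derivative ?b y) (at y within ({0..1} - {0,1}))"
  proof (intro integral_has_vector_derivative_continuous_at int)
    have "isCont ?b y" using y by (intro continuous_intros) auto
    then show "continuous (at y within {0..1} - {0, 1}) ?b"
      by (rule continuous_at_imp_continuous_at_within)
  qed (use y in auto)
  moreover have "{0..1} - {0,1} = {0<..<1::real}" by auto
  ultimately have D: "DERIV (\<lambda>u. integral {0..u} ?b) y :> ?b y"
    using y by (simp add: at_within_open[of y "{0<..<1}"] has_real_derivative_iff_has_vector_derivative)
  have "((\<lambda>x. x powr r / (1 + x powr r)) has_real_derivative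
      (r * x powr (r - 1) * ?c - x powr r * (r * x powr (r - 1))) / (?c * ?c)) (at x)"
    using x c by (auto intro!: derivative_eq_intros)
  also have "(r * x powr (r - 1) * ?c - x powr r * (r * x powr (r - 1))) / (?c * ?c)
      = r * x powr (r - 1) / ?c^2"
    by (simp add: power2_eq_square ring_distribs)
  finally have g: "((\<lambda>x. x powr r / (1 + x powr r)) has_real_derivative (r * x powr (r - 1) / ?c^2)) (at x)" .
  have "DERIV (\<lambda>x. integral {0..x powr r / (1 + x powr r)} ?b) x :> ?b y * (r * x powr (r - 1) / ?c^2)"
    using DERIV_chain2[where f="\<lambda>u. integral {0..u} ?b" and g="\<lambda>x. x powr r / (1 + x powr r)" and s=UNIV, OF _ g] D
    by (simp add: y_def)
  from DERIV_cdivide[OF this, of r]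
  have "DERIV mass x :> ?b y * (r * x powr (r - 1) / ?c^2) / r"
    unfolding mass_def[abs_def] .
  moreover have "?b y * (r * x powr (r - 1) / ?c^2) / r = profile x"
  proof -
    have 1: "1 - y = ?c powr (-1)"
      using c by (simp add: y_def powr_minus diff_divide_eq_iff inverse_eq_divide)
    have 2: "y = x powr r * ?c powr (-1)" using c by (simp add: y_def powr_minus inverse_eq_divide)
    have 3: "1 / ?c^2 = ?c powr (-2)"
      using c by (simp add: powr_minus inverse_eq_divide flip: powr_numeral)
    have 4: "?b y * (r * x powr (r - 1) / ?c^2) / r = ?b y * x powr (r - 1) * (1 / ?c^2)"
      using r_pos by simp
    have 5: "?b y = x powr (r * (1 / r - 1)) * ?c powr (-(1 / r - 1)) * ?c powr (-((q - 1) / r - 1))"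
      unfolding 1 unfolding 2 by (simp only: powr_mult powr_ge_zero powr_powr mult_minus1 mult.assoc)
    have "?b y * (r * x powr (r - 1) / ?c^2) / r
        = x powr (r * (1 / r - 1)) * x powr (r - 1) *
          (?c powr (-(1 / r - 1)) * ?c powr (-((q - 1) / r - 1)) * ?c powr (-2))"
      by (rule trans[OF 4]) (simp only: 3 5 mult_ac)
    also have "\<dots> = x powr (r * (1 / r - 1) + (r - 1)) *
        ?c powr (-(1 / r - 1) + -((q - 1) / r - 1) + -2)"
      by (simp only: powr_add)
    also have "r * (1 / r - 1) + (r - 1) = 0" using r_pos by (simp add: right_diff_distrib)
    also have "-(1 / r - 1) + -((q - 1) / r - 1) + -2 = -(q / r)"
      using r_pos by (simp add: diff_divide_distrib)
    finally show ?thesis using x by (simp add: profile_def)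
  qed
  ultimately show ?thesis by simp
qed

lemma DERIV_moment:
  assumes x: "x > 0"
  shows "DERIV moment x :> x powr r * profile x"
proof -
  let ?c = "1 + x powr r"
  have c: "?c > 0" using x by (simp add: add_pos_pos)
  define e where "e = - ((q - r) / r)"
  have e: "e - 1 = - (q / r)" "e * r = - (q - r)" using r_pos by (auto simp: e_def field_simps)
  have "?c powr e = ?c powr (e - 1) * ?c"
    using c by (simp add: powr_diff)
  then have 1: "?c powr e = profile x * ?c" by (simp add: profile_def e)
  have 2: "x * x powr (r - 1) = x powr r" using x by (simp add: powr_mult_base)
  have "DERIV (\<lambda>x. x * (1 + x powr r) powr e) x :> ?c powr e + x * (e * ?c powr (e - 1) * (r * x powr (r - 1)))"
    using x c by (auto intro!: derivative_eq_intros)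
  also have "?c powr e + x * (e * ?c powr (e - 1) * (r * x powr (r - 1)))
     = profile x * ?c + (e * r) * profile x * (x * x powr (r - 1))"
    unfolding 1 by (simp add: profile_def e)
  also have "\<dots> = profile x * ?c - (q - r) * profile x * x powr r"
    unfolding 2 e by (simp add: algebra_simps)
  finally have "DERIV moment x :> (profile x - (profile x * ?c - (q - r) * profile x * x powr r)) / (q - r - 1)"
    unfolding moment_def[abs_def] e_def by (intro DERIV_cdivide DERIV_diff DERIV_mass x)
  also have "(profile x - (profile x * ?c - (q - r) * profile x * x powr r)) / (q - r - 1) = x powr r * profile x"
    using q_minus_r by (simp add: field_simps)
  finally show ?thesis .
qed

lemma mass_0: "(mass \<longlongrightarrow> 0) (at_right 0)"
proof -
  let ?b = "\<lambda>t. t powr (1 / r - 1) * (1 - t) powr ((q - 1) / r - 1)"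
  have int: "?b integrable_on {0..1}"
    using has_integral_Beta_real[of "1/r" "(q-1)/r"] r_pos q_gt_1 by (auto simp: integrable_on_def)
  have "continuous_on {0..1} (\<lambda>x. integral {0..x} ?b)"
    by (rule indefinite_integral_continuous_1[OF int])
  then have "((\<lambda>x. integral {0..x} ?b) \<longlongrightarrow> integral {0..0} ?b) (at 0 within {0..1})"
    unfolding continuous_on_def by (rule bspec) simp
  moreover have "filterlim (\<lambda>x. x powr r / (1 + x powr r)) (at 0 within {0..1}) (at_right 0)"
    unfolding filterlim_at
  proof
    show "\<forall>\<^sub>F x in at_right 0. x powr r / (1 + x powr r) \<in> {0..1} \<and> x powr r / (1 + x powr r) \<noteq> 0"
      by (rule eventually_mono[OF eventually_at_right_less]) (auto simp: pos_divide_le_eq add_pos_pos add_pos_nonneg add_nonneg_eq_0_iff)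
    have "((\<lambda>x. x powr r / (1 + x powr r)) \<longlongrightarrow> 0 powr r / (1 + 0 powr r)) (at_right 0)"
      using r_pos by (intro tendsto_intros) (auto simp: eventually_nonneg_at_right_0)
    then show "((\<lambda>x. x powr r / (1 + x powr r)) \<longlongrightarrow> 0) (at_right 0)" by simp
  qed
  ultimately have "((\<lambda>x. integral {0..x powr r / (1 + x powr r)} ?b) \<longlongrightarrow> integral {0..0} ?b) (at_right 0)"
    by (rule filterlim_compose)
  then show ?thesis unfolding mass_def using tendsto_divide[OF _ tendsto_const[of r]] r_pos by fastforce
qed

lemma mass_top: "(mass \<longlongrightarrow> mass_lim) at_top"
proof -
  let ?b = "\<lambda>t. t powr (1 / r - 1) * (1 - t) powr ((q - 1) / r - 1)"
  have B: "(?b has_integral Beta (1/r) ((q-1)/r)) {0..1}"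
    using has_integral_Beta_real[of "1/r" "(q-1)/r"] r_pos q_gt_1 by auto
  have "continuous_on {0..1} (\<lambda>x. integral {0..x} ?b)"
    using B by (intro indefinite_integral_continuous_1) (auto simp: integrable_on_def)
  then have "((\<lambda>x. integral {0..x} ?b) \<longlongrightarrow> integral {0..1} ?b) (at 1 within {0..1})"
    unfolding continuous_on_def by (rule bspec) simp
  moreover have "filterlim (\<lambda>x. x powr r / (1 + x powr r)) (at 1 within {0..1}) at_top"
    unfolding filterlim_at
  proof
    show "\<forall>\<^sub>F x in at_top. x powr r / (1 + x powr r) \<in> {0..1} \<and> x powr r / (1 + x powr r) \<noteq> 1"
      by (auto simp: eventually_at_top_linorder divide_simps add_pos_pos add_pos_nonneg intro!: exI[of _ 1])
    have "((\<lambda>x. 1 / (1 + x powr (- r))) \<longlongrightarrow> 1 / (1 + 0)) at_top"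
      using r_pos by (intro tendsto_intros tendsto_neg_powr filterlim_ident) auto
    moreover have "\<forall>\<^sub>F x in at_top. 1 / (1 + x powr (- r)) = x powr r / (1 + x powr r)"
      unfolding eventually_at_top_linorder
      by (intro exI[of _ 1]) (auto simp: powr_minus divide_simps add_pos_pos)
    ultimately show "((\<lambda>x. x powr r / (1 + x powr r)) \<longlongrightarrow> 1) at_top"
      by (simp add: tendsto_cong)
  qed
  ultimately have "((\<lambda>x. integral {0..x powr r / (1 + x powr r)} ?b) \<longlongrightarrow> integral {0..1} ?b) at_top"
    by (rule filterlim_compose)
  then show ?thesis unfolding mass_def mass_lim_def using B r_pos
    by (auto intro!: tendsto_divide simp: integral_unique)
qed

lemma moment_0: "(moment \<longlongrightarrow> 0) (at_right 0)"
proof -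
  have "(moment \<longlongrightarrow> (0 - 0 * (1 + 0 powr r) powr (- ((q - r) / r))) / (q - r - 1)) (at_right 0)"
    unfolding moment_def[abs_def] using r_pos q_minus_r
    by (intro tendsto_intros mass_0) (auto simp: eventually_nonneg_at_right_0)
  then show ?thesis by simp
qed

lemma moment_top: "(moment \<longlongrightarrow> moment_lim) at_top"
proof -
  \<comment> \<open>The boundary term of the integration by parts decays like
    \<open>x powr (1 - (q - r))\<close>, and \<open>q - r > 1\<close>.\<close>
  have "((\<lambda>x. x * (1 + x powr r) powr (- ((q - r) / r))) \<longlongrightarrow> 0) at_top"
  proof (rule tendsto_sandwich[where f="\<lambda>_. 0" and h="\<lambda>x. x powr (1 - (q - r))"])
    show "((\<lambda>x. x powr (1 - (q - r))) \<longlongrightarrow> 0) at_top"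
      using q_minus_r by (intro tendsto_neg_powr filterlim_ident) auto
    have "x * (1 + x powr r) powr (- ((q - r) / r)) \<le> x powr (1 - (q - r))" if x: "x \<ge> 1" for x :: real
    proof -
      have "(1 + x powr r) powr (- ((q - r) / r)) \<le> (x powr r) powr (- ((q - r) / r))"
        using x r_pos q_minus_r by (intro powr_mono2') auto
      also have "\<dots> = x powr (-(q - r))" using r_pos by (simp add: powr_powr)
      finally have "x * (1 + x powr r) powr (- ((q - r) / r)) \<le> x * x powr (-(q - r))"
        using x by (intro mult_left_mono) auto
      also have "\<dots> = x powr (1 - (q - r))" using x by (subst powr_mult_base) (auto simp: algebra_simps)
      finally show ?thesis .
    qed
    then show "\<forall>\<^sub>F x in at_top. x * (1 + x powr r) powr (- ((q - r) / r)) \<le> x powr (1 - (q - r))"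
      unfolding eventually_at_top_linorder by blast
    show "\<forall>\<^sub>F x in at_top. 0 \<le> x * (1 + x powr r) powr (- ((q - r) / r))"
      unfolding eventually_at_top_linorder by (auto intro!: exI[of _ 0])
  qed simp
  then have "(moment \<longlongrightarrow> (mass_lim - 0) / (q - r - 1)) at_top"
    unfolding moment_def[abs_def] using q_minus_r by (intro tendsto_intros mass_top) auto
  then show ?thesis by (simp add: moment_lim_def)
qed

text \<open>Comes from \<open>profile \<le> 1\<close>. It later bounds the transport
  \<open>S\<close> below by a multiple of \<open>s\<close>, which makes the boundary term at
  \<open>0\<close> vanish.\<close>

lemma moment_le: "x > 0 \<Longrightarrow> moment x \<le> x powr (r + 1) / (r + 1)"
proof -
  assume x: "x > 0"
  have "0 \<le> x powr (r + 1) / (r + 1) - moment x"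
  proof (rule at_right_lower_bound[where b="x+1" and x=x])
    fix y :: real assume y: "y > 0"
    have "y powr r * profile y \<le> y powr r * 1"
      by (intro mult_left_mono profile_le_1) auto
    moreover have "DERIV (\<lambda>x. x powr (r + 1) / (r + 1) - moment x) y :> y powr r - y powr r * profile y"
      using y r_pos by (auto intro!: derivative_eq_intros DERIV_moment)
    ultimately show "\<exists>d. DERIV (\<lambda>x. x powr (r + 1) / (r + 1) - moment x) y :> d \<and> d \<ge> 0" by auto
  next
    have "((\<lambda>x. x powr (r + 1) / (r + 1) - moment x) \<longlongrightarrow> 0 powr (r + 1) / (r + 1) - 0) (at_right 0)"
      using r_pos by (intro tendsto_intros moment_0) (auto simp: eventually_nonneg_at_right_0)
    then show "((\<lambda>x. x powr (r + 1) / (r + 1) - moment x) \<longlongrightarrow> 0) (at_right 0)" by simp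
  qed (use x in auto)
  then show ?thesis by simp
qed

lemma moment_strict_mono: "0 < x \<Longrightarrow> x < y \<Longrightarrow> moment x < moment y"
  by (rule DERIV_pos_imp_increasing, assumption, rule exI, rule conjI[OF DERIV_moment])
    (auto simp: profile_pos)

lemma moment_pos: "x > 0 \<Longrightarrow> moment x > 0"
proof -
  assume x: "x > 0"
  have "0 \<le> moment (x/2)"
    using x by (intro at_right_lower_bound[where b=x] moment_0)
      (auto intro!: exI DERIV_moment mult_nonneg_nonneg less_imp_le[OF profile_pos])
  also have "\<dots> < moment x" using x by (intro moment_strict_mono) auto
  finally show ?thesis .
qed

lemma moment_less: "x > 0 \<Longrightarrow> moment x < moment_lim"
proof -
  assume x: "x > 0"
  then have "moment x < moment (x + 1)" by (intro moment_strict_mono) auto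
  also have "moment (x + 1) \<le> moment_lim"
  proof (rule tendsto_lowerbound[OF moment_top])
    show "\<forall>\<^sub>F y in at_top. moment (x + 1) \<le> moment y"
      unfolding eventually_at_top_linorder using x moment_strict_mono[of "x + 1"]
      by (intro exI[of _ "x+1"]) (auto simp: le_less)
  qed simp
  finally show ?thesis .
qed

lemma moment_isCont: "x > 0 \<Longrightarrow> isCont moment x"
  using DERIV_moment DERIV_isCont by blast

lemma moment_surj:
  assumes "0 < y" "y < moment_lim"
  shows "\<exists>x>0. moment x = y"
proof -
  have "\<forall>\<^sub>F x in at_right 0. moment x < y" using moment_0 assms by (auto dest: order_tendstoD)
  then obtain b where b: "b > 0" "\<And>x. 0 < x \<Longrightarrow> x < b \<Longrightarrow> moment x < y"
    by (auto simp: eventually_at_right_field)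
  have "\<forall>\<^sub>F x in at_top. moment x > y" using moment_top assms by (auto dest: order_tendstoD)
  then obtain c where c: "\<And>x. x \<ge> c \<Longrightarrow> moment x > y" by (auto simp: eventually_at_top_linorder)
  have "\<exists>x. b/2 \<le> x \<and> x \<le> max b c \<and> moment x = y"
    using b(1) b(2)[of "b/2"] c[of "max b c"] by (intro IVT) (auto intro!: moment_isCont)
  then obtain x where "b / 2 \<le> x" "moment x = y" by blast
  with b(1) show ?thesis by (intro exI[of _ x]) auto
qed

section \<open>The inverse of \<open>moment\<close>, from which the transport is built\<close>

definition moment_inv :: "real \<Rightarrow> real" where "moment_inv = the_inv_into {0<..} moment"

lemma moment_inj: "inj_on moment {0<..}"
  by (rule inj_onI) (metis moment_strict_mono greaterThan_iff linorder_neq_iff order_less_irrefl)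

lemma moment_inv_moment: "x > 0 \<Longrightarrow> moment_inv (moment x) = x"
  unfolding moment_inv_def by (rule the_inv_into_f_f[OF moment_inj]) auto

lemma moment_inv:
  assumes "0 < y" "y < moment_lim"
  shows "moment_inv y > 0" "moment (moment_inv y) = y"
  using moment_surj[OF assms] by (metis moment_inv_moment)+

lemma DERIV_moment_inv:
  assumes y: "0 < y" "y < moment_lim"
  shows "DERIV moment_inv y :> inverse (moment_inv y powr r * profile (moment_inv y))"
proof (rule DERIV_inverse_function[where a=0 and b=moment_lim and f=moment])
  let ?x = "moment_inv y"
  have x: "?x > 0" "moment ?x = y" using moment_inv y by auto
  show "DERIV moment ?x :> ?x powr r * profile ?x" by (rule DERIV_moment) fact
  show "?x powr r * profile ?x \<noteq> 0" using x profile_pos[of ?x] by simp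
  have "isCont moment_inv (moment ?x)"
  proof (rule isCont_inverse_function[where d="?x/2" and f=moment and x="?x" and g=moment_inv])
    have "z > 0" if "\<bar>z - ?x\<bar> \<le> ?x / 2" for z using that x by linarith
    then show "moment_inv (moment z) = z" "isCont moment z" if "\<bar>z - ?x\<bar> \<le> ?x / 2" for z
      using that by (auto intro!: moment_inv_moment moment_isCont)
  qed (use x in auto)
  then show "isCont moment_inv y" using x by simp
qed (use y moment_inv in auto)

end

section \<open>Transport to the extremal\<close>

context hardy_exponents
begin

text \<open>The exponent of \<open>S\<close> is forced twice:
  \<open>\<kappa> * (p / (p - 1)) = r\<close> matches Young's inequality to the transport equation,
  and \<open>\<kappa> = (q - r - 1) * (r / q)\<close> matches the coefficient of
  \<open>s S'/S\<close> in AM-GM.\<close>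

definition \<kappa> :: real where "\<kappa> = r * (p - 1) / p"

lemma \<kappa>_pos: "\<kappa> > 0"
  using p_gt_1 r_pos by (simp add: \<kappa>_def)

lemma \<kappa>_q: "\<kappa> * (q / r) = q - r - 1"
proof -
  have "\<kappa> * (q / r) = q * (p - 1) / p"
    using r_pos by (simp add: \<kappa>_def)
  also have "\<dots> = q - r - 1"
    using p_gt_1 by (simp add: r_def field_simps)
  finally show ?thesis .
qed

text \<open>The exponent \<open>\<alpha>\<close> makes \<open>F\<^bsup>q-r\<^esup> s\<^bsup>\<alpha>\<^esup> S\<^bsup>-\<kappa>\<^esup>\<close> linear in \<open>s\<close> when \<open>F\<close> and \<open>S\<close> are.\<close>

definition \<alpha> :: real where "\<alpha> = - (q - r - 1) + \<kappa>"

text \<open>Everything is a product of powers, so both claims are linear identities between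
  logarithms modulo the logarithm of the transport equation \<open>eq\<close>. The first evaluates
  the power that Young's inequality produces; the second rewrites the geometric mean to which AM-GM
  is applied.\<close>

lemma transport_identities:
  fixes F s S S' :: real
  assumes pos: "F > 0" "s > 0" "S > 0" "S' > 0"
    and eq: "F powr q * s powr (r - q) = S powr r * profile S * S'"
  shows "(F powr (q - r - 1) * s powr \<alpha> * S powr - \<kappa>) powr (p / (p - 1)) = profile S * S'"
    and "F powr (q - r) * s powr (\<alpha> - 1) * S powr - \<kappa> * (s * S' / S) powr (r / q)
         = (1 + S powr r) * profile S * S'"
proof -
  define l where "l = ln (1 + S powr r)"
  have c: "1 + S powr r > 0" by (intro add_pos_nonneg) auto
  have lp: "ln (profile S) = - (q / r) * l"
    using c by (simp add: profile_def l_def ln_powr)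
  have "ln (F powr q * s powr (r - q)) = ln (S powr r * profile S * S')"
    by (simp only: eq)
  then have L: "q * ln F + (r - q) * ln s = r * ln S - (q / r) * l + ln S'"
    using pos profile_pos[of S] by (simp add: ln_mult ln_powr lp)
  have kp: "\<kappa> * (p / (p - 1)) = r" using p_gt_1 by (simp add: \<kappa>_def)
  have qrp: "(q - r - 1) * (p / (p - 1)) = q"
  proof -
    have "q - r - 1 = q * (p - 1) / p" using p_gt_1 by (simp add: r_def field_simps)
    then show ?thesis using p_gt_1 by simp
  qed
  have ap: "\<alpha> * (p / (p - 1)) = r - q"
    unfolding \<alpha>_def by (simp only: distrib_right mult_minus_left kp qrp)
  let ?y = "F powr (q - r - 1) * s powr \<alpha> * S powr - \<kappa>"
  have "ln ?y = (q - r - 1) * ln F + \<alpha> * ln s - \<kappa> * ln S"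
    using pos by (simp add: ln_mult ln_powr)
  then have "ln (?y powr (p / (p - 1))) = (p / (p - 1)) * ((q - r - 1) * ln F + \<alpha> * ln s - \<kappa> * ln S)"
    using pos by (simp add: ln_powr)
  also have "\<dots> = ((q - r - 1) * (p / (p - 1))) * ln F + (\<alpha> * (p / (p - 1))) * ln s - (\<kappa> * (p / (p - 1))) * ln S"
    by (simp only: ring_distribs mult_ac)
  also have "\<dots> = q * ln F + (r - q) * ln s - r * ln S"
    unfolding ap kp qrp by simp
  also have "\<dots> = ln (profile S * S')"
    using L pos profile_pos[of S] by (simp add: ln_mult lp)
  finally show "?y powr (p / (p - 1)) = profile S * S'"
    using pos profile_pos[of S] by (subst (asm) ln_inj_iff) auto
  let ?z = "F powr (q - r) * s powr (\<alpha> - 1) * S powr - \<kappa> * (s * S' / S) powr (r / q)"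
  \<comment> \<open>The AM-GM weight. Since \<open>q * t = r\<close>, eliminating \<open>F\<close>
    leaves the factor \<open>1 - t\<close>, and \<open>q / r * t = 1\<close> yields exactly one
    extra factor \<open>1 + S powr r\<close>; the powers of \<open>s\<close> and \<open>S\<close>
    cancel.\<close>
  define t where "t = r / q"
  have t1: "q * t = r" "q / r * t = 1" using q_gt_1 r_pos by (simp_all add: t_def)
  have t2: "r * t = r - \<kappa> - t"
  proof -
    have pne: "p \<noteq> 0" "q \<noteq> 0" using p_gt_1 q_gt_1 by auto
    have "r * t = r * (r / q)" by (simp add: t_def)
    also have "r / q = 1 / p - 1 / q" using pne by (simp add: r_def field_simps)
    also have "r * \<dots> = r - \<kappa> - t" using pne by (simp add: t_def \<kappa>_def field_simps)
    finally show ?thesis .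
  qed
  have "ln ?z = (q - r) * ln F + (\<alpha> - 1) * ln s - \<kappa> * ln S + t * (ln s + ln S' - ln S)"
    using pos by (simp add: ln_mult ln_powr ln_div t_def)
  also have "(q - r) * ln F = (1 - t) * (q * ln F)"
    by (simp add: algebra_simps flip: t1(1))
  also have "q * ln F = r * ln S - (q / r) * l + ln S' - (r - q) * ln s" using L by simp
  also have "(1 - t) * \<dots> + (\<alpha> - 1) * ln s - \<kappa> * ln S + t * (ln s + ln S' - ln S)
     = (r - r * t - \<kappa> - t) * ln S + ((q / r) * t - q / r) * l + ln S'
       + (q - r - (q * t - r * t) + \<alpha> - 1 + t) * ln s"
    by (simp only: ring_distribs mult_ac diff_conv_add_uminus mult_minus_left mult_minus_right minus_add_distrib minus_minus mult_1_left mult_1_right add_ac)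
  also have "q - r - (q * t - r * t) + \<alpha> - 1 + t = 0"
    unfolding t1 t2 \<alpha>_def by simp
  also have "(r - r * t - \<kappa> - t) = 0" unfolding t2 by simp
  also have "0 * ln S + ((q / r) * t - q / r) * l + ln S' + 0 * ln s = ln ((1 + S powr r) * profile S * S')"
  proof -
    have "ln ((1 + S powr r) * profile S * S') = l + ln (profile S) + ln S'"
      using pos c profile_pos[of S] by (simp add: ln_mult l_def)
    then show ?thesis unfolding t1 lp by (simp add: ring_distribs)
  qed
  finally show "?z = (1 + S powr r) * profile S * S'"
    using pos c profile_pos[of S] by (subst (asm) ln_inj_iff) auto
qed

text \<open>The pointwise form of the comparison: it says that the function \<open>R\<close> of the
  transport argument has nonnegative derivative. Young's inequality absorbs the term containing
  \<open>f\<close>. AM-GM with weight \<open>r / q\<close> absorbs the rest, because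
  \<open>(q - r - 1) * (r / q) = \<kappa>\<close> reproduces the factor
  \<open>\<alpha> - \<kappa> * z\<close> that comes from differentiating the powers of
  \<open>s\<close> and \<open>S\<close>.\<close>

lemma transport_inequality:
  fixes F f s S S' :: real
  assumes pos: "F > 0" "s > 0" "S > 0" "S' > 0" and f: "f \<ge> 0"
    and eq: "F powr q * s powr (r - q) = S powr r * profile S * S'"
  shows "(q - r - 1) * ((1 + S powr r) * profile S * S')
      + (q - r) * F powr (q - r - 1) * f * s powr \<alpha> * S powr - \<kappa>
      + F powr (q - r) * s powr (\<alpha> - 1) * S powr - \<kappa> * (\<alpha> - \<kappa> * (s * S' / S))
    \<le> (q - r) * (f powr p / p + profile S * S' * ((p - 1) / p))"
proof -
  define y where "y = F powr (q - r - 1) * s powr \<alpha> * S powr - \<kappa>"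
  define z where "z = s * S' / S"
  define A where "A = F powr (q - r) * s powr (\<alpha> - 1) * S powr - \<kappa>"
  have "f * y \<le> f powr p / p + y powr (p / (p - 1)) / (p / (p - 1))"
    using p_gt_1 f by (intro Youngs_inequality) (auto simp: y_def divide_simps)
  also have "y powr (p / (p - 1)) = profile S * S'"
    unfolding y_def by (rule transport_identities(1)[OF pos eq])
  finally have 1: "f * y \<le> f powr p / p + profile S * S' * ((p - 1) / p)" by simp
  have z: "z > 0" using pos by (simp add: z_def)
  have "z powr (r / q) * 1 powr (1 - r / q) \<le> r / q * z + (1 - r / q) * 1"
    using z r_pos q_minus_r q_gt_1 by (intro Youngs_inequality_0) (auto simp: divide_simps)
  then have "A * z powr (r / q) \<le> A * (r / q * z + (1 - r / q))"
    by (intro mult_left_mono) (auto simp: A_def)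
  also have "A * z powr (r / q) = (1 + S powr r) * profile S * S'"
    unfolding A_def z_def by (rule transport_identities(2)[OF pos eq])
  finally have "(q - r - 1) * ((1 + S powr r) * profile S * S')
      \<le> (q - r - 1) * (A * (r / q * z + (1 - r / q)))"
    using q_minus_r by (intro mult_left_mono) auto
  also have "\<dots> = A * (((q - r - 1) * (r / q)) * z + (q - r - 1) - (q - r - 1) * (r / q))"
    by (simp only: ring_distribs mult_ac diff_conv_add_uminus mult_minus_left mult_minus_right mult_1_left mult_1_right add_ac)
  also have "(q - r - 1) * (r / q) = \<kappa>"
    using r_pos q_gt_1 by (simp flip: \<kappa>_q)
  also have "\<kappa> * z + (q - r - 1) - \<kappa> = - (\<alpha> - \<kappa> * z)"
    by (simp add: \<alpha>_def)
  finally have 2: "(q - r - 1) * ((1 + S powr r) * profile S * S') + A * (\<alpha> - \<kappa> * z) \<le> 0"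
    by (simp only: mult_minus_right)
  have "(q - r) * (f * y) \<le> (q - r) * (f powr p / p + profile S * S' * ((p - 1) / p))"
    using 1 q_minus_r by (intro mult_left_mono) auto
  then show ?thesis
    using 2 by (simp add: A_def z_def y_def mult_ac)
qed

text \<open>
  Bliss's inequality under the normalization \<open>Q b = moment_lim\<close>. The transport \<open>S\<close> is
  defined by \<open>moment (S s) = Q s\<close>, and the function \<open>R\<close> below is nondecreasing and vanishes at \<open>0\<close>.
\<close>

lemma bliss_normalized:
  fixes F f Q E :: "real \<Rightarrow> real"
  assumes b: "b > 0"
    and dF: "\<And>s. 0 < s \<Longrightarrow> s < b \<Longrightarrow> DERIV F s :> f s"
    and f: "\<And>s. 0 < s \<Longrightarrow> s < b \<Longrightarrow> 0 \<le> f s"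
    and F: "\<And>s. 0 < s \<Longrightarrow> s < b \<Longrightarrow> 0 < F s" "\<And>s. 0 < s \<Longrightarrow> s < b \<Longrightarrow> F s \<le> B * s"
    and dQ: "\<And>s. 0 < s \<Longrightarrow> s < b \<Longrightarrow> DERIV Q s :> F s powr q * s powr (r - q)"
    and Q: "continuous_on {0..b} Q" "Q 0 = 0" "Q b = moment_lim"
    and c: "c > 0" "\<And>s. 0 < s \<Longrightarrow> s < b \<Longrightarrow> c * s powr (r + 1) \<le> Q s"
    and dE: "\<And>s. 0 < s \<Longrightarrow> s < b \<Longrightarrow> DERIV E s :> f s powr p"
    and E: "(E \<longlongrightarrow> 0) (at_right 0)" "\<And>s. 0 < s \<Longrightarrow> s < b \<Longrightarrow> E s \<le> e"
  shows "mass_lim \<le> e"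
proof -
  have Q_mono: "Q s < Q t" if "0 \<le> s" "s < t" "t \<le> b" for s t
  proof (rule DERIV_pos_imp_increasing_open[OF that(2)])
    show "\<exists>y. DERIV Q x :> y \<and> 0 < y" if "s < x" "x < t" for x
      using that \<open>0 \<le> s\<close> \<open>t \<le> b\<close> F(1)[of x] dQ[of x]
      by (intro exI[of _ "F x powr q * x powr (r - q)"]) auto
    show "continuous_on {s..t} Q" by (rule continuous_on_subset[OF Q(1)]) (use that in auto)
  qed
  have Q_bounds: "0 < Q s" "Q s < moment_lim" if "0 < s" "s < b" for s
    using Q_mono[of 0 s] Q_mono[of s b] that Q by auto
  define S where "S s = moment_inv (Q s)" for s
  have S: "S s > 0" "moment (S s) = Q s" if "0 < s" "s < b" for s
    using moment_inv[OF Q_bounds[OF that]] by (auto simp: S_def)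
  define S' where "S' s = F s powr q * s powr (r - q) / (S s powr r * profile (S s))" for s
  have dS: "DERIV S s :> S' s" if s: "0 < s" "s < b" for s
    using DERIV_chain2[where f=moment_inv and g=Q and s=UNIV, OF DERIV_moment_inv dQ[OF s], OF Q_bounds[OF s]]
    by (simp add: S_def[abs_def] S'_def divide_inverse mult_ac)
  have S'_pos: "S' s > 0" if s: "0 < s" "s < b" for s
    using F(1)[OF s] s S(1)[OF s] profile_pos[of "S s"] by (simp add: S'_def)
  have S'_eq: "F s powr q * s powr (r - q) = S s powr r * profile (S s) * S' s" if s: "0 < s" "s < b" for s
    using S(1)[OF s] profile_pos[of "S s"] by (simp add: S'_def)
  define H where "H s = F s powr (q - r) * s powr \<alpha> * S s powr - \<kappa>" for s
  define R where "R s = (q - r) * (E s / p + mass (S s) * ((p - 1) / p))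
     - (q - r - 1) * (mass (S s) + moment (S s)) - H s" for s
  have dH: "DERIV H s :> (q - r) * F s powr (q - r - 1) * f s * s powr \<alpha> * S s powr - \<kappa>
      + F s powr (q - r) * s powr (\<alpha> - 1) * S s powr - \<kappa> * (\<alpha> - \<kappa> * (s * S' s / S s))"
    if s: "0 < s" "s < b" for s
  proof -
    have "DERIV H s :> ((q - r) * F s powr (q - r - 1) * f s * s powr \<alpha> +
        (\<alpha> * s powr (\<alpha> - 1)) * F s powr (q - r)) * S s powr - \<kappa> +
        (- \<kappa> * S s powr (- \<kappa> - 1) * S' s) * (F s powr (q - r) * s powr \<alpha>)"
      unfolding H_def[abs_def] using s S(1)[OF s] F(1)[OF s]
      by (intro DERIV_mult DERIV_fun_powr dF dS) (auto intro!: derivative_eq_intros dF dS)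
    moreover have "s powr \<alpha> = s powr (\<alpha> - 1) * s" using s by (simp add: powr_diff)
    moreover have "S s powr (- \<kappa> - 1) = S s powr - \<kappa> / S s" using S(1)[OF s] by (simp add: powr_diff)
    ultimately show ?thesis by (simp add: algebra_simps)
  qed
  have dJS: "DERIV (\<lambda>s. mass (S s)) s :> profile (S s) * S' s" if s: "0 < s" "s < b" for s
    using DERIV_chain2[where f=mass and g=S and s=UNIV, OF DERIV_mass dS[OF s], OF S(1)[OF s]] by simp
  have dPS: "DERIV (\<lambda>s. moment (S s)) s :> S s powr r * profile (S s) * S' s" if s: "0 < s" "s < b" for s
    using DERIV_chain2[where f=moment and g=S and s=UNIV, OF DERIV_moment dS[OF s], OF S(1)[OF s]] by simp
  have R_deriv: "\<exists>d. DERIV R s :> d \<and> d \<ge> 0" if s: "0 < s" "s < b" for s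
  proof -
    let ?d = "(q - r) * (f s powr p / p + profile (S s) * S' s * ((p - 1) / p))
     - (q - r - 1) * (profile (S s) * S' s + S s powr r * profile (S s) * S' s) -
     ((q - r) * F s powr (q - r - 1) * f s * s powr \<alpha> * S s powr - \<kappa>
      + F s powr (q - r) * s powr (\<alpha> - 1) * S s powr - \<kappa> * (\<alpha> - \<kappa> * (s * S' s / S s)))"
    have "DERIV R s :> ?d"
      unfolding R_def[abs_def]
      by (intro DERIV_diff DERIV_cmult DERIV_add DERIV_cdivide DERIV_cmult_right dE dJS dPS dH s)
    moreover have "?d \<ge> 0"
      using transport_inequality[OF F(1)[OF s] s(1) S(1)[OF s] S'_pos[OF s] f[OF s] S'_eq[OF s]]
      by (simp add: ring_distribs)
    ultimately show ?thesis by blast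
  qed
  have lim_Q: "(Q \<longlongrightarrow> 0) (at_right 0)"
  proof -
    have "(Q \<longlongrightarrow> Q 0) (at 0 within {0..b})"
      using Q(1) b unfolding continuous_on_def by (rule_tac bspec) auto
    then show ?thesis using b Q(2) by (simp add: at_within_Icc_at_right)
  qed
  have ev: "\<forall>\<^sub>F s in at_right 0. 0 < s \<and> s < b"
    using b unfolding eventually_at_right_field by auto
  have lim_S: "filterlim S (at_right 0) (at_right 0)"
    unfolding filterlim_at
  proof
    show "\<forall>\<^sub>F s in at_right 0. S s \<in> {0<..} \<and> S s \<noteq> 0"
      using ev by eventually_elim (use S(1) in force)
    show "(S \<longlongrightarrow> 0) (at_right 0)"
    proof (rule order_tendstoI)
      fix x :: real assume x: "x > 0"
      have "\<forall>\<^sub>F s in at_right 0. Q s < moment x" using lim_Q moment_pos[OF x] by (auto dest: order_tendstoD)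
      then show "\<forall>\<^sub>F s in at_right 0. S s < x"
        using ev
      proof eventually_elim
        case (elim s)
        then show ?case using S[of s] moment_strict_mono[OF x, of "S s"] by (cases "S s" x rule: linorder_cases) auto
      qed
    next
      fix x :: real assume x: "x < 0"
      show "\<forall>\<^sub>F s in at_right 0. x < S s"
        using ev by eventually_elim (use S(1) x in force)
    qed
  qed
  \<comment> \<open>Obtained by solving \<open>c * s powr (r + 1) \<le> Q s = moment (S s) \<le> S s
    powr (r + 1) / (r + 1)\<close> for \<open>S s\<close>.\<close>
  define c' where "c' = (c * (r + 1)) powr (1 / (r + 1))"
  have c': "c' > 0" using c(1) r_pos by (simp add: c'_def)
  have S_lower: "c' * s \<le> S s" if s: "0 < s" "s < b" for s
  proof -
    have "c * s powr (r + 1) \<le> S s powr (r + 1) / (r + 1)"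
      using c(2)[OF s] S[OF s] moment_le[of "S s"] by simp
    then have "(c * (r + 1)) * s powr (r + 1) \<le> S s powr (r + 1)"
      using r_pos by (simp add: field_simps)
    then have "((c * (r + 1)) * s powr (r + 1)) powr (1 / (r + 1)) \<le> (S s powr (r + 1)) powr (1 / (r + 1))"
      using c(1) r_pos by (intro powr_mono2) auto
    then show ?thesis using s S(1)[OF s] r_pos c(1) by (simp add: powr_mult powr_powr c'_def)
  qed
  have B: "B > 0"
  proof -
    have "0 < B * (b / 2)" using F[of "b/2"] b by simp
    then show ?thesis using b by (simp add: zero_less_mult_iff)
  qed
  \<comment> \<open>\<open>F\<close> lies below and \<open>S\<close> above a multiple of
    \<open>s\<close>, the power of \<open>S\<close> is negative, and the exponents
    \<open>q - r\<close>, \<open>\<alpha>\<close> and \<open>- \<kappa>\<close> add up to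
    \<open>1\<close>; so \<open>H\<close> is of order \<open>s\<close> at \<open>0\<close>.\<close>
  have H_le: "H s \<le> B powr (q - r) * c' powr - \<kappa> * s" if s: "0 < s" "s < b" for s
  proof -
    have "H s \<le> (B * s) powr (q - r) * s powr \<alpha> * (c' * s) powr - \<kappa>"
    proof -
      have 1: "F s powr (q - r) \<le> (B * s) powr (q - r)"
        using F[OF s] q_minus_r by (intro powr_mono2) auto
      have 2: "S s powr - \<kappa> \<le> (c' * s) powr - \<kappa>"
        using S_lower[OF s] c' \<kappa>_pos s by (intro powr_mono2') auto
      show ?thesis
        unfolding H_def by (intro mult_mono 1 2 order_refl mult_nonneg_nonneg powr_ge_zero)
    qed
    also have "\<dots> = B powr (q - r) * c' powr - \<kappa> * (s powr (q - r) * s powr \<alpha> * s powr - \<kappa>)"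
      using B c' s by (simp add: powr_mult)
    also have "s powr (q - r) * s powr \<alpha> * s powr - \<kappa> = s powr (q - r + \<alpha> + - \<kappa>)"
      by (simp only: powr_add)
    also have "q - r + \<alpha> + - \<kappa> = 1" by (simp add: \<alpha>_def)
    finally show ?thesis using s by simp
  qed
  have lim_H: "(H \<longlongrightarrow> 0) (at_right 0)"
  proof (rule tendsto_sandwich[where f="\<lambda>_. 0" and h="\<lambda>s. B powr (q - r) * c' powr - \<kappa> * s"])
    show "\<forall>\<^sub>F s in at_right 0. H s \<le> B powr (q - r) * c' powr - \<kappa> * s"
      using ev by eventually_elim (use H_le in auto)
    show "\<forall>\<^sub>F s in at_right 0. 0 \<le> H s" by (simp add: H_def)
    have "((\<lambda>s. B powr (q - r) * c' powr - \<kappa> * s) \<longlongrightarrow> B powr (q - r) * c' powr - \<kappa> * 0) (at_right 0)"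
      by (intro tendsto_intros)
    then show "((\<lambda>s. B powr (q - r) * c' powr - \<kappa> * s) \<longlongrightarrow> 0) (at_right 0)" by simp
  qed simp
  have "(R \<longlongrightarrow> (q - r) * (0 / p + 0 * ((p - 1) / p)) - (q - r - 1) * (0 + 0) - 0) (at_right 0)"
    unfolding R_def[abs_def] using p_gt_1
    by (intro tendsto_intros E(1) lim_H filterlim_compose[OF mass_0 lim_S] filterlim_compose[OF moment_0 lim_S]) auto
  then have lim_R: "(R \<longlongrightarrow> 0) (at_right 0)" by simp
  have R_nonneg: "R s \<ge> 0" if "0 < s" "s < b" for s
    by (rule at_right_lower_bound[OF R_deriv lim_R that])
  \<comment> \<open>By the intermediate value theorem \<open>S\<close> takes every positive value
    \<open>x\<close>, so the bound at \<open>s\<close> can be read in the variable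
    \<open>x = S s\<close>, where \<open>H \<ge> 0\<close> is dropped; afterwards \<open>x\<close>
    tends to infinity.\<close>
  have bound: "(q - r - 1) * (mass x + moment x) \<le> (q - r) * (e / p + mass x * ((p - 1) / p))" if x: "x > 0" for x
  proof -
    have "\<exists>s. 0 \<le> s \<and> s \<le> b \<and> Q s = moment x"
      using Q b moment_pos[OF x] moment_less[OF x] by (intro IVT') auto
    then obtain s where s: "0 \<le> s" "s \<le> b" "Q s = moment x" by auto
    have sb: "0 < s" "s < b"
      using s Q moment_pos[OF x] moment_less[OF x] by (auto simp: le_less)
    have Sx: "S s = x" using s x by (simp add: S_def moment_inv_moment)
    have "0 \<le> R s + H s" using R_nonneg[OF sb] by (simp add: H_def)
    then have "(q - r - 1) * (mass x + moment x) \<le> (q - r) * (E s / p + mass x * ((p - 1) / p))"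
      by (simp add: R_def Sx)
    also have "\<dots> \<le> (q - r) * (e / p + mass x * ((p - 1) / p))"
      using E(2)[OF sb] p_gt_1 q_minus_r by (intro mult_left_mono add_right_mono divide_right_mono) auto
    finally show ?thesis .
  qed
  have "(q - r - 1) * (mass_lim + moment_lim) \<le> (q - r) * (e / p + mass_lim * ((p - 1) / p))"
  proof (rule tendsto_le)
    show "((\<lambda>x. (q - r - 1) * (mass x + moment x)) \<longlongrightarrow> (q - r - 1) * (mass_lim + moment_lim)) at_top"
      by (intro tendsto_intros mass_top moment_top)
    show "((\<lambda>x. (q - r) * (e / p + mass x * ((p - 1) / p))) \<longlongrightarrow> (q - r) * (e / p + mass_lim * ((p - 1) / p))) at_top"
      by (intro tendsto_intros mass_top)
    show "\<forall>\<^sub>F x in at_top. (q - r - 1) * (mass x + moment x) \<le> (q - r) * (e / p + mass x * ((p - 1) / p))"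
      using eventually_gt_at_top[of 0] by eventually_elim (use bound in auto)
  qed simp
  \<comment> \<open>Here \<open>moment_lim = mass_lim / (q - r - 1)\<close> makes both sides
    multiples of \<open>q - r\<close>, and what remains compares \<open>mass_lim\<close> with
    \<open>e\<close> alone.\<close>
  also have "(q - r - 1) * (mass_lim + moment_lim) = (q - r) * mass_lim"
    using q_minus_r by (simp add: moment_lim_def field_simps)
  finally have "mass_lim \<le> e / p + mass_lim * ((p - 1) / p)"
    using q_minus_r by simp
  then show ?thesis using p_gt_1 by (simp add: field_simps)
qed

end

section \<open>Bliss's inequality on the half-line\<close>

lemma indefinite_integral:
  fixes g :: "real \<Rightarrow> real"
  assumes g: "continuous_on {0..b} g" and b: "b > 0"
  shows indefinite_integral_DERIV: "\<And>s. 0 < s \<Longrightarrow> s < b \<Longrightarrow> DERIV (\<lambda>s. integral {0..s} g) s :> g s"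
    and indefinite_integral_cont: "continuous_on {0..b} (\<lambda>s. integral {0..s} g)"
    and indefinite_integral_lim: "((\<lambda>s. integral {0..s} g) \<longlongrightarrow> 0) (at_right 0)"
proof -
  show "DERIV (\<lambda>s. integral {0..s} g) s :> g s" if s: "0 < s" "s < b" for s
  proof -
    have "((\<lambda>s. integral {0..s} g) has_real_derivative g s) (at s within {0..b})"
      by (rule integral_has_real_derivative[OF g]) (use s in auto)
    moreover have "at s within {0..b} = at s"
      using s by (intro at_within_interior) auto
    ultimately show ?thesis by simp
  qed
  show c: "continuous_on {0..b} (\<lambda>s. integral {0..s} g)"
    by (intro indefinite_integral_continuous_1 integrable_continuous_real g)
  then have "((\<lambda>s. integral {0..s} g) \<longlongrightarrow> integral {0..0} g) (at 0 within {0..b})"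
    unfolding continuous_on_def using b by (rule_tac bspec) auto
  then show "((\<lambda>s. integral {0..s} g) \<longlongrightarrow> 0) (at_right 0)"
    using b by (simp add: at_within_Icc_at_right)
qed

text \<open>The integral of a difference quotient telescopes: after a shift of the variable only the
  windows of length \<open>h\<close> at the two ends remain.\<close>

lemma integral_increments:
  fixes F :: "real \<Rightarrow> real"
  assumes F: "continuous_on {0..s + h} F" and "h > 0" "s \<ge> 0"
  shows "integral {0..s} (\<lambda>u. (F (u + h) - F u) / h) = (integral {s..s + h} F - integral {0..h} F) / h"
proof -
  have sub: "F integrable_on {x..y}" if "0 \<le> x" "y \<le> s + h" for x y
    using that by (intro integrable_continuous_real continuous_on_subset[OF F]) auto
  have "(F has_integral integral {h..s + h} F) {0 + h..s + h}"
    using sub[of h "s+h"] assms by (simp add: integrable_integral)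
  then have "((\<lambda>u. F (u + h)) has_integral integral {h..s + h} F) {0..s}"
    by (subst (asm) has_integral_shift_Icc_real[symmetric]) (simp add: o_def add.commute)
  moreover have "(F has_integral integral {0..s} F) {0..s}"
    using sub[of 0 s] assms by (simp add: integrable_integral)
  ultimately have "((\<lambda>u. (F (u + h) - F u) / h) has_integral (integral {h..s + h} F - integral {0..s} F) / h) {0..s}"
    by (intro has_integral_divide has_integral_diff)
  then have 1: "integral {0..s} (\<lambda>u. (F (u + h) - F u) / h) = (integral {h..s + h} F - integral {0..s} F) / h"
    by (rule integral_unique)
  moreover have "integral {0..h} F + integral {h..s + h} F = integral {0..s + h} F"
    using assms by (intro Henstock_Kurzweil_Integration.integral_combine sub) auto
  moreover have "integral {0..s} F + integral {s..s + h} F = integral {0..s + h} F"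
    using assms by (intro Henstock_Kurzweil_Integration.integral_combine sub) auto
  ultimately have "integral {h..s + h} F - integral {0..s} F = integral {s..s + h} F - integral {0..h} F"
    by linarith
  with 1 show ?thesis by (simp only:)
qed

lemma integral_interval_bounds:
  fixes F :: "real \<Rightarrow> real"
  assumes F: "continuous_on {s..s + h} F" and h: "h > 0"
    and mono: "\<And>u. s \<le> u \<Longrightarrow> u \<le> s + h \<Longrightarrow> F s \<le> F u \<and> F u \<le> F (s + h)"
  shows "h * F s \<le> integral {s..s + h} F" "integral {s..s + h} F \<le> h * F (s + h)"
proof -
  have i: "F integrable_on {s..s + h}" by (rule integrable_continuous_real[OF F])
  have "integral {s..s + h} (\<lambda>_. F s) \<le> integral {s..s + h} F"
    by (rule integral_le) (use i mono in auto)
  then show "h * F s \<le> integral {s..s + h} F" using h by simp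
  have "integral {s..s + h} F \<le> integral {s..s + h} (\<lambda>_. F (s + h))"
    by (rule integral_le) (use i mono in auto)
  then show "integral {s..s + h} F \<le> h * F (s + h)" using h by simp
qed

section \<open>Bliss's inequality for continuous densities and for Lipschitz data\<close>

context hardy_exponents
begin

text \<open>The value of the quotient at the extremal, whose weighted mass is
  \<open>moment_lim\<close> and whose energy is \<open>mass_lim\<close>.\<close>

definition bliss_const :: real where
  "bliss_const = moment_lim * mass_lim powr (- (q / p))"

lemma bliss_const_pos: "bliss_const > 0"
  using moment_lim_pos mass_lim_pos by (simp add: bliss_const_def)

text \<open>The weight \<open>s powr (r - q)\<close> is singular at \<open>0\<close>, but
  \<open>F s \<le> B * s\<close> bounds the product by \<open>B powr q * s powr r\<close>. The limit
  \<open>0\<close> agrees with the value at \<open>0\<close> because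
  \<open>0 powr a = 0\<close>.\<close>

lemma continuous_on_weighted_power:
  assumes F: "continuous_on {0..b} F" and b: "b > 0"
    and bounds: "\<And>s. 0 \<le> s \<Longrightarrow> s \<le> b \<Longrightarrow> 0 \<le> F s \<and> F s \<le> B * s"
  shows "continuous_on {0..b} (\<lambda>s. F s powr q * s powr (r - q))"
  unfolding continuous_on_def
proof
  let ?g = "\<lambda>s. F s powr q * s powr (r - q)"
  fix s assume s: "s \<in> {0..b}"
  have lim: "(F \<longlongrightarrow> F s) (at s within {0..b})" using F s by (simp add: continuous_on_def)
  have ev: "\<forall>\<^sub>F u in at s within {0..b}. 0 \<le> F u"
    using bounds by (auto simp: eventually_at_filter)
  show "(?g \<longlongrightarrow> ?g s) (at s within {0..b})"
  proof (cases "s = 0")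
    case False
    then show ?thesis using s q_gt_1 ev
      by (intro tendsto_mult tendsto_powr' lim tendsto_ident_at tendsto_const) auto
  next
    case True
    have le: "?g u \<le> B powr q * u powr r" if u: "0 \<le> u" "u \<le> b" for u
    proof -
      have "?g u \<le> (B * u) powr q * u powr (r - q)"
        using bounds[OF u] q_gt_1 by (intro mult_right_mono powr_mono2) auto
      also have "\<dots> = B powr q * (u powr q * u powr (r - q))" by (simp add: powr_mult)
      also have "u powr q * u powr (r - q) = u powr r" by (simp flip: powr_add)
      finally show ?thesis .
    qed
    have ev0: "\<forall>\<^sub>F u in at 0 within {0..b}. 0 \<le> u" by (auto simp: eventually_at_filter)
    have "((\<lambda>u. B powr q * u powr r) \<longlongrightarrow> B powr q * 0 powr r) (at 0 within {0..b})"
      using r_pos by (intro tendsto_mult tendsto_powr' tendsto_ident_at tendsto_const) (use ev0 in auto)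
    then have h: "((\<lambda>u. B powr q * u powr r) \<longlongrightarrow> 0) (at 0 within {0..b})" by simp
    have "(?g \<longlongrightarrow> 0) (at 0 within {0..b})"
    proof (rule tendsto_sandwich[OF _ _ tendsto_const h])
      show "\<forall>\<^sub>F u in at 0 within {0..b}. 0 \<le> ?g u" by simp
      show "\<forall>\<^sub>F u in at 0 within {0..b}. ?g u \<le> B powr q * u powr r"
        using le by (auto simp: eventually_at_filter)
    qed
    then show ?thesis using True by simp
  qed
qed

text \<open>On a compact interval \<open>f\<close> also has an upper bound, so \<open>F\<close> lies
  between two positive multiples of \<open>s\<close>. This is the regularity at \<open>0\<close>
  that the transport needs; scaling then provides the normalization.\<close>

lemma bliss_continuous:
  fixes f :: "real \<Rightarrow> real"
  defines "F \<equiv> \<lambda>s. integral {0..s} f"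
  assumes b: "b > 0" and f: "continuous_on {0..b} f"
    and d: "\<delta> > 0" "\<And>s. 0 \<le> s \<Longrightarrow> s \<le> b \<Longrightarrow> \<delta> \<le> f s"
  shows "integral {0..b} (\<lambda>s. F s powr q * s powr (r - q))
    \<le> bliss_const * integral {0..b} (\<lambda>s. f s powr p) powr (q / p)"
proof -
  have fi: "f integrable_on {0..s}" if "s \<le> b" for s
    using that by (intro integrable_continuous_real continuous_on_subset[OF f]) auto
  have f0: "0 \<le> f s" if "0 \<le> s" "s \<le> b" for s using d that by force
  obtain B where B: "\<And>s. 0 \<le> s \<Longrightarrow> s \<le> b \<Longrightarrow> f s \<le> B"
  proof -
    have "bounded (f ` {0..b})" by (intro compact_imp_bounded compact_continuous_image f) auto
    then obtain B where "\<forall>x\<in>f ` {0..b}. norm x \<le> B" by (auto simp: bounded_iff)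
    then show ?thesis using that[of B] by (auto simp: abs_le_iff)
  qed
  have F_bounds: "\<delta> * s \<le> F s" "F s \<le> B * s" if s: "0 \<le> s" "s \<le> b" for s
  proof -
    have "integral {0..s} (\<lambda>_. \<delta>) \<le> F s"
      unfolding F_def using d s by (intro integral_le fi) auto
    then show "\<delta> * s \<le> F s" using s by (simp add: mult.commute)
    have "F s \<le> integral {0..s} (\<lambda>_. B)"
      unfolding F_def using B s by (intro integral_le fi) auto
    then show "F s \<le> B * s" using s by (simp add: mult.commute)
  qed
  have F_pos: "0 < F s" if "0 < s" "s \<le> b" for s
    using F_bounds(1)[of s] that d(1) mult_pos_pos[of \<delta> s] by linarith
  have F_nonneg: "0 \<le> F s" if "0 \<le> s" "s \<le> b" for s
    using F_bounds(1)[of s] that d(1) mult_nonneg_nonneg[of \<delta> s] by linarith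
  define g where "g s = F s powr q * s powr (r - q)" for s
  have Fc: "continuous_on {0..b} F" unfolding F_def by (rule indefinite_integral_cont[OF f b])
  have gc: "continuous_on {0..b} g"
    unfolding g_def[abs_def] by (rule continuous_on_weighted_power[OF Fc b]) (use F_nonneg F_bounds in auto)
  have fp: "continuous_on {0..b} (\<lambda>s. f s powr p)"
    using f0 p_gt_1 by (intro continuous_on_powr' f continuous_on_const) auto
  define Q where "Q s = integral {0..s} g" for s
  define E where "E s = integral {0..s} (\<lambda>s. f s powr p)" for s
  note dQ = indefinite_integral_DERIV[OF gc b, folded Q_def]
  note dE = indefinite_integral_DERIV[OF fp b, folded E_def]
  note dF = indefinite_integral_DERIV[OF f b, folded F_def]
  \<comment> \<open>\<open>F u \<ge> \<delta> * u\<close> bounds the density of \<open>Q\<close>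
    below by \<open>\<delta> powr q * u powr r\<close>; this is what keeps \<open>S\<close> away
    from \<open>0\<close>.\<close>
  have Q_lower: "\<delta> powr q / (r + 1) * s powr (r + 1) \<le> Q s" if s: "0 < s" "s < b" for s
  proof -
    have "0 \<le> Q s - \<delta> powr q / (r + 1) * s powr (r + 1)"
    proof (rule at_right_lower_bound[OF _ _ s])
      fix u assume u: "0 < u" "u < b"
      have "DERIV (\<lambda>s. Q s - \<delta> powr q / (r + 1) * s powr (r + 1)) u :> g u - \<delta> powr q * u powr r"
        using u r_pos by (auto intro!: derivative_eq_intros dQ)
      moreover have "\<delta> powr q * u powr r \<le> g u"
      proof -
        have "\<delta> powr q * u powr r = \<delta> powr q * (u powr q * u powr (r - q))"
          by (simp flip: powr_add)
        also have "\<dots> = (\<delta> * u) powr q * u powr (r - q)" by (simp add: powr_mult)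
        also have "\<dots> \<le> g u"
          unfolding g_def using F_bounds(1)[of u] u d(1) q_gt_1 by (intro mult_right_mono powr_mono2) auto
        finally show ?thesis .
      qed
      ultimately show "\<exists>d. DERIV (\<lambda>s. Q s - \<delta> powr q / (r + 1) * s powr (r + 1)) u :> d \<and> d \<ge> 0"
        by (intro exI[of _ "g u - \<delta> powr q * u powr r"]) auto
    next
      have "((\<lambda>s. Q s - \<delta> powr q / (r + 1) * s powr (r + 1)) \<longlongrightarrow>
         0 - \<delta> powr q / (r + 1) * 0 powr (r + 1)) (at_right 0)"
        unfolding Q_def using r_pos
        by (intro tendsto_diff tendsto_mult tendsto_const tendsto_powr' tendsto_ident_at indefinite_integral_lim[OF gc b])
          (auto simp: eventually_nonneg_at_right_0)
      then show "((\<lambda>s. Q s - \<delta> powr q / (r + 1) * s powr (r + 1)) \<longlongrightarrow> 0) (at_right 0)" by simp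
    qed
    then show ?thesis by simp
  qed
  have Qc: "continuous_on {0..b} Q" unfolding Q_def by (rule indefinite_integral_cont[OF gc b])
  have g_nonneg: "0 \<le> g s" for s by (simp add: g_def)
  have gi: "g integrable_on {0..s}" if "s \<le> b" for s
    using that by (intro integrable_continuous_real continuous_on_subset[OF gc]) auto
  have Qb: "Q b > 0"
  proof -
    have "0 < \<delta> powr q / (r + 1) * (b/2) powr (r + 1)" using d(1) r_pos b by simp
    also have "\<dots> \<le> Q (b/2)" using b by (intro Q_lower) auto
    also have "\<dots> \<le> Q b" unfolding Q_def using b g_nonneg by (intro integral_subset_le gi) auto
    finally show ?thesis .
  qed
  \<comment> \<open>Multiplying \<open>f\<close> by \<open>l\<close> scales the mass by
    \<open>l powr q\<close> and the energy by \<open>l powr p\<close>. This \<open>l\<close> makes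
    the mass equal to \<open>moment_lim\<close>; undoing the scaling in
    \<open>mass_lim \<le> l powr p * E b\<close> produces the power \<open>q / p\<close>.\<close>
  define l where "l = (moment_lim / Q b) powr (1 / q)"
  have l: "l > 0" using Qb moment_lim_pos by (simp add: l_def)
  have lq: "l powr q = moment_lim / Q b" using q_gt_1 Qb moment_lim_pos by (simp add: l_def powr_powr)
  have lp: "l powr p = (moment_lim / Q b) powr (p / q)" by (simp add: l_def powr_powr)
  have E_mono: "E s \<le> E b" if "0 < s" "s < b" for s
    unfolding E_def using that
    by (intro integral_subset_le integrable_continuous_real continuous_on_subset[OF fp]) auto
  have "mass_lim \<le> l powr p * E b"
  proof (rule bliss_normalized[where b=b and F="\<lambda>s. l * F s" and f="\<lambda>s. l * f s" and B="l * B"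
      and Q="\<lambda>s. l powr q * Q s" and E="\<lambda>s. l powr p * E s" and c="l powr q * (\<delta> powr q / (r + 1))"])
    fix s assume s: "0 < s" "s < b"
    show "DERIV (\<lambda>s. l * F s) s :> l * f s" by (intro DERIV_cmult dF s)
    show "0 \<le> l * f s" using l f0[of s] s by simp
    show "0 < l * F s" using l F_pos[of s] s by simp
    show "l * F s \<le> l * B * s" using l F_bounds(2)[of s] s by simp
    show "DERIV (\<lambda>s. l powr q * Q s) s :> (l * F s) powr q * s powr (r - q)"
      using DERIV_cmult[OF dQ[OF s], of "l powr q"] by (simp add: g_def powr_mult mult_ac)
    show "l powr q * (\<delta> powr q / (r + 1)) * s powr (r + 1) \<le> l powr q * Q s"
      using Q_lower[OF s] by (metis mult.assoc mult_left_mono powr_ge_zero)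
    show "DERIV (\<lambda>s. l powr p * E s) s :> (l * f s) powr p"
      using DERIV_cmult[OF dE[OF s], of "l powr p"] by (simp add: powr_mult)
    show "l powr p * E s \<le> l powr p * E b" using E_mono[OF s] by (intro mult_left_mono) auto
  next
    show "continuous_on {0..b} (\<lambda>s. l powr q * Q s)" by (intro continuous_intros Qc)
    show "l powr q * Q 0 = 0" by (simp add: Q_def)
    show "l powr q * Q b = moment_lim" using Qb by (simp add: lq)
    show "0 < l powr q * (\<delta> powr q / (r + 1))" using l d(1) r_pos by simp
    show "((\<lambda>s. l powr p * E s) \<longlongrightarrow> 0) (at_right 0)"
      using tendsto_mult[OF tendsto_const[of "l powr p"] indefinite_integral_lim[OF fp b]] by (simp add: E_def)
  qed (rule b)
  also have "l powr p = moment_lim powr (p / q) / Q b powr (p / q)" unfolding lp by (simp add: powr_divide)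
  finally have "Q b powr (p / q) \<le> moment_lim powr (p / q) * mass_lim powr (- 1) * E b"
    using Qb mass_lim_pos by (simp add: powr_minus field_simps)
  then have "(Q b powr (p / q)) powr (q / p) \<le> (moment_lim powr (p / q) * mass_lim powr (- 1) * E b) powr (q / p)"
    using p_gt_1 q_gt_1 by (intro powr_mono2) auto
  then have "Q b \<le> moment_lim * mass_lim powr (- (q / p)) * E b powr (q / p)"
    using p_gt_1 q_gt_1 Qb moment_lim_pos by (simp only: powr_mult powr_powr) simp
  then show ?thesis by (simp add: Q_def g_def[abs_def] E_def bliss_const_def)
qed

text \<open>
  Only increments of \<open>F\<close> and of its energy \<open>E\<close> enter: the Steklov average
  \<open>(F(s + h) - F(s)) / h\<close> is continuous, so no derivative of \<open>F\<close> is needed.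
\<close>

lemma bliss_increments:
  fixes F E :: "real \<Rightarrow> real"
  assumes b: "b > 0" and d: "\<delta> > 0"
    and F0: "F 0 = 0" and E0: "E 0 = 0"
    and F: "\<And>s t. 0 \<le> s \<Longrightarrow> s \<le> t \<Longrightarrow> \<delta> * (t - s) \<le> F t - F s"
      "\<And>s t. 0 \<le> s \<Longrightarrow> s \<le> t \<Longrightarrow> F t - F s \<le> B * (t - s)"
    and E: "\<And>s t. 0 \<le> s \<Longrightarrow> s \<le> t \<Longrightarrow> E s \<le> E t"
      "\<And>s t. 0 \<le> s \<Longrightarrow> s \<le> t \<Longrightarrow> E t - E s \<le> D * (t - s)"
    and FE: "\<And>s t. 0 \<le> s \<Longrightarrow> s \<le> t \<Longrightarrow> (F t - F s) powr p \<le> (E t - E s) * (t - s) powr (p - 1)"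
  shows "(\<integral>\<^sup>+s. ennreal (F s powr q * s powr (r - q)) * indicator {0..b} s \<partial>lborel)
     \<le> ennreal (bliss_const * E b powr (q / p))"
proof -
  have cont: "continuous_on {0..} G" if "\<And>s t. 0 \<le> s \<Longrightarrow> s \<le> t \<Longrightarrow> G s \<le> G t"
      and G: "\<And>s t. 0 \<le> s \<Longrightarrow> s \<le> t \<Longrightarrow> G t - G s \<le> L * (t - s)" for G :: "real \<Rightarrow> real" and L
  proof -
    have lip: "\<bar>G t - G s\<bar> \<le> \<bar>L\<bar> * \<bar>t - s\<bar>" if "0 \<le> s" "s \<le> t" for s t
    proof -
      have "L * (t - s) \<le> \<bar>L\<bar> * \<bar>t - s\<bar>" using that by (intro mult_mono) auto
      then show ?thesis using \<open>\<And>s t. 0 \<le> s \<Longrightarrow> s \<le> t \<Longrightarrow> G s \<le> G t\<close>[OF that] G[OF that] by simp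
    qed
    have "dist (G s) (G t) \<le> \<bar>L\<bar> * dist s t" if "s \<in> {0..}" "t \<in> {0..}" for s t
      using that lip[of s t] lip[of t s]
      by (cases s t rule: le_cases) (auto simp: dist_real_def abs_minus_commute)
    then have "\<bar>L\<bar>-lipschitz_on {0..} G" by (intro lipschitz_onI) auto
    then show ?thesis by (rule lipschitz_on_continuous_on)
  qed
  have F_mono: "F s \<le> F t" if "0 \<le> s" "s \<le> t" for s t
    using F(1)[OF that] d that mult_nonneg_nonneg[of \<delta> "t - s"] by linarith
  have Fc: "continuous_on {0..} F" by (rule cont[OF F_mono F(2)])
  have Ec: "continuous_on {0..} E" by (rule cont[OF E])
  have F_nonneg: "0 \<le> F s" if "0 \<le> s" for s using F_mono[of 0 s] that F0 by simp
  have E_nonneg: "0 \<le> E s" if "0 \<le> s" for s using E(1)[of 0 s] that E0 by simp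
  have B: "0 \<le> B" using F(2)[of 0 1] F_mono[of 0 1] by simp
  have D: "0 \<le> D" using E(2)[of 0 1] E(1)[of 0 1] by simp
  \<comment> \<open>The continuous case is applied to the Steklov average \<open>f\<close>. Its
    primitive \<open>G\<close> is at least \<open>F s - B * h\<close> and its energy at most
    \<open>E b + D * h\<close>, so both losses are of order \<open>h\<close>. The
    \<open>max 0\<close> guards against negative \<open>F s - B * h\<close>.\<close>
  have step: "(\<integral>\<^sup>+s. ennreal (max 0 (F s - B * h) powr q * s powr (r - q)) * indicator {0..b} s \<partial>lborel)
     \<le> ennreal (bliss_const * (E b + D * h) powr (q / p))" if h: "h > 0" for h
  proof -
    define f where "f s = (F (s + h) - F s) / h" for s
    have fc: "continuous_on {0..b} f"
      unfolding f_def[abs_def] using h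
      by (intro continuous_intros continuous_on_subset[OF Fc] continuous_on_compose2[OF Fc]) auto
    have fd: "\<delta> \<le> f s" if "0 \<le> s" for s
      using F(1)[of s "s + h"] that h by (simp add: f_def field_simps)
    define G where "G s = integral {0..s} f" for s
    have G: "F s - B * h \<le> G s" "G s \<le> B * s" if s: "0 \<le> s" "s \<le> b" for s
    proof -
      have "h * F s \<le> integral {s..s + h} F"
        using s h F_mono by (intro integral_interval_bounds continuous_on_subset[OF Fc]) auto
      moreover have "integral {0..0 + h} F \<le> h * F (0 + h)"
        using s h F_mono by (intro integral_interval_bounds continuous_on_subset[OF Fc]) auto
      moreover have "h * F h \<le> h * (B * h)" using F(2)[of 0 h] h F0 by simp
      ultimately have "h * (F s - B * h) \<le> integral {s..s + h} F - integral {0..h} F"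
        by (simp add: algebra_simps)
      moreover have "G s = (integral {s..s + h} F - integral {0..h} F) / h"
        unfolding G_def f_def[abs_def] using s h
        by (intro integral_increments continuous_on_subset[OF Fc]) auto
      ultimately have "h * (F s - B * h) \<le> h * G s" using h by simp
      then show "F s - B * h \<le> G s" using h by (simp only: mult_le_cancel_left_pos)
      have "G s \<le> integral {0..s} (\<lambda>_. B)"
        unfolding G_def
      proof (rule integral_le)
        show "f integrable_on {0..s}"
          using s by (intro integrable_continuous_real continuous_on_subset[OF fc]) auto
        show "f u \<le> B" if "u \<in> {0..s}" for u
          using F(2)[of u "u + h"] that h by (simp add: f_def field_simps)
      qed auto
      then show "G s \<le> B * s" using s by (simp add: mult.commute)
    qed
    have G_nonneg: "0 \<le> G s" if "0 \<le> s" "s \<le> b" for s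
      unfolding G_def using d fd by (intro integral_nonneg integrable_continuous_real continuous_on_subset[OF fc])
        (use that in \<open>auto intro: order_trans[OF less_imp_le]\<close>)
    have Gc: "continuous_on {0..b} G" unfolding G_def by (rule indefinite_integral_cont[OF fc b])
    have "(\<integral>\<^sup>+s. ennreal (max 0 (F s - B * h) powr q * s powr (r - q)) * indicator {0..b} s \<partial>lborel)
      \<le> (\<integral>\<^sup>+s. ennreal (G s powr q * s powr (r - q)) * indicator {0..b} s \<partial>lborel)"
    proof (rule nn_integral_mono)
      fix s
      show "ennreal (max 0 (F s - B * h) powr q * s powr (r - q)) * indicator {0..b} s
        \<le> ennreal (G s powr q * s powr (r - q)) * indicator {0..b} s"
        using G(1)[of s] G_nonneg[of s] q_gt_1
        by (cases "s \<in> {0..b}") (auto intro!: ennreal_leI mult_right_mono powr_mono2)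
    qed
    also have "\<dots> = ennreal (integral {0..b} (\<lambda>s. G s powr q * s powr (r - q)))"
    proof (rule nn_integral_has_integral_lebesgue')
      have "continuous_on {0..b} (\<lambda>s. G s powr q * s powr (r - q))"
        by (rule continuous_on_weighted_power[OF Gc b]) (use G G_nonneg in auto)
      then show "((\<lambda>s. G s powr q * s powr (r - q)) has_integral
          integral {0..b} (\<lambda>s. G s powr q * s powr (r - q))) {0..b}"
        by (intro integrable_integral integrable_continuous_real)
    qed auto
    also have "\<dots> \<le> ennreal (bliss_const * integral {0..b} (\<lambda>s. f s powr p) powr (q / p))"
      unfolding G_def using d fd by (intro ennreal_leI bliss_continuous b fc) auto
    also have "\<dots> \<le> ennreal (bliss_const * (E b + D * h) powr (q / p))"
    proof (intro ennreal_leI mult_left_mono powr_mono2)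
      have "integral {0..b} (\<lambda>s. f s powr p) \<le> integral {0..b} (\<lambda>s. (E (s + h) - E s) / h)"
      proof (rule integral_le)
        have "continuous_on {0..b} (\<lambda>s. f s powr p)"
          using d fd p_gt_1 by (intro continuous_on_powr' fc continuous_on_const) (auto intro: order_trans[OF less_imp_le])
        then show "(\<lambda>s. f s powr p) integrable_on {0..b}" by (rule integrable_continuous_real)
        show "(\<lambda>s. (E (s + h) - E s) / h) integrable_on {0..b}"
          using h by (intro integrable_continuous_real continuous_intros continuous_on_subset[OF Ec] continuous_on_compose2[OF Ec]) auto
        \<comment> \<open>The increment inequality \<open>FE\<close> over a step of length
          \<open>h\<close> bounds the energy density of the average by the difference quotient of
          \<open>E\<close>, whose integral telescopes.\<close>
        show "f s powr p \<le> (E (s + h) - E s) / h" if "s \<in> {0..b}" for s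
        proof -
          have "f s powr p = (F (s + h) - F s) powr p / h powr p"
            by (simp add: f_def powr_divide)
          also have "\<dots> \<le> ((E (s + h) - E s) * h powr (p - 1)) / h powr p"
            using FE[of s "s + h"] that h by (intro divide_right_mono) auto
          also have "\<dots> = (E (s + h) - E s) / h"
            using h by (simp add: powr_diff)
          finally show ?thesis .
        qed
      qed
      also have "\<dots> = (integral {b..b + h} E - integral {0..h} E) / h"
        using b h by (intro integral_increments continuous_on_subset[OF Ec]) auto
      also have "\<dots> \<le> (h * E (b + h) - 0) / h"
        using b h E E_nonneg
        by (intro divide_right_mono diff_mono integral_interval_bounds integral_nonneg continuous_on_subset[OF Ec] integrable_continuous_real) auto
      also have "\<dots> \<le> E b + D * h" using E(2)[of b "b + h"] b h by simp
      finally show "integral {0..b} (\<lambda>s. f s powr p) \<le> E b + D * h" .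
      show "0 \<le> integral {0..b} (\<lambda>s. f s powr p)"
        using d fd p_gt_1 by (intro integral_nonneg integrable_continuous_real continuous_on_powr' fc continuous_on_const) (auto intro: order_trans[OF less_imp_le])
    qed (use bliss_const_pos p_gt_1 q_gt_1 in auto)
    finally show ?thesis .
  qed
  let ?h = "\<lambda>n. 1 / real (Suc n)"
  let ?g = "\<lambda>n s. ennreal (max 0 (F s - B * ?h n) powr q * s powr (r - q)) * indicator {0..b} s"
  \<comment> \<open>\<open>F\<close> is continuous only on the half-line, so measurability is
    available for its product with an indicator; Fatou's lemma then lets \<open>h\<close> tend to
    \<open>0\<close>.\<close>
  have [measurable]: "(\<lambda>s. F s * indicator {0..b} s) \<in> borel_measurable borel"
    using borel_measurable_continuous_on_indicator[OF _ continuous_on_subset[OF Fc], of "{0..b}"]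
    by (simp add: mult.commute)
  have h0: "?h \<longlonglongrightarrow> 0"
    using LIMSEQ_inverse_real_of_nat by (simp add: inverse_eq_divide)
  have lim: "(\<lambda>n. ?g n s) \<longlonglongrightarrow> ennreal (F s powr q * s powr (r - q)) * indicator {0..b} s" for s
  proof (cases "s \<in> {0..b}")
    case True
    have "(\<lambda>n. max 0 (F s - B * ?h n)) \<longlonglongrightarrow> max 0 (F s - B * 0)"
      by (intro tendsto_max tendsto_intros h0)
    then have "(\<lambda>n. max 0 (F s - B * ?h n)) \<longlonglongrightarrow> F s" using True F_nonneg[of s] by simp
    then have "(\<lambda>n. max 0 (F s - B * ?h n) powr q) \<longlonglongrightarrow> F s powr q"
      using q_gt_1 by (intro tendsto_powr' tendsto_const) auto
    from tendsto_ennrealI[OF tendsto_mult[OF this tendsto_const]] show ?thesis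
      using True by simp
  qed simp
  have "(\<integral>\<^sup>+s. ennreal (F s powr q * s powr (r - q)) * indicator {0..b} s \<partial>lborel)
    = (\<integral>\<^sup>+s. liminf (\<lambda>n. ?g n s) \<partial>lborel)"
    by (intro nn_integral_cong) (simp only: lim_imp_Liminf[OF sequentially_bot lim])
  also have "\<dots> \<le> liminf (\<lambda>n. \<integral>\<^sup>+s. ?g n s \<partial>lborel)"
  proof (rule nn_integral_liminf)
    fix n
    have "(\<lambda>s. ennreal (max 0 (F s * indicator {0..b} s - B * ?h n) powr q * s powr (r - q)) * indicator {0..b} s) \<in> borel_measurable lborel"
      by measurable
    also have "(\<lambda>s. ennreal (max 0 (F s * indicator {0..b} s - B * ?h n) powr q * s powr (r - q)) * indicator {0..b} s) = ?g n"
      by (auto simp: indicator_def fun_eq_iff)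
    finally show "?g n \<in> borel_measurable lborel" .
  qed
  also have "\<dots> \<le> liminf (\<lambda>n. ennreal (bliss_const * (E b + D * ?h n) powr (q / p)))"
    by (intro Liminf_mono always_eventually allI step) simp
  also have "\<dots> = ennreal (bliss_const * (E b + D * 0) powr (q / p))"
    using p_gt_1 q_gt_1 E_nonneg[of b] b D
    by (intro lim_imp_Liminf tendsto_ennrealI tendsto_mult tendsto_powr' tendsto_add tendsto_const h0) auto
  finally show ?thesis by simp
qed

end

section \<open>Integral inequalities for nonnegative functions\<close>

text \<open>Extends \<open>powr\<close> to infinite integrals with the convention of
  \<open>Lp_norm\<close>, so that norms and their powers can be handled without finiteness
  conditions. The value at \<open>0\<close> is \<open>0\<close> for every exponent.\<close>

definition epowr :: "ennreal \<Rightarrow> real \<Rightarrow> ennreal" where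
  "epowr x a = (if x = \<infinity> then \<infinity> else ennreal (enn2real x powr a))"

lemma epowr_ennreal [simp]: "0 \<le> x \<Longrightarrow> epowr (ennreal x) a = ennreal (x powr a)"
  by (simp add: epowr_def)

lemma epowr_top [simp]: "epowr top a = top"
  by (simp add: epowr_def)

lemma epowr_0 [simp]: "epowr 0 a = 0"
  by (simp add: epowr_def)

lemma epowr_1 [simp]: "epowr x 1 = x"
  by (cases x) (simp_all)

lemma epowr_mono: "x \<le> y \<Longrightarrow> 0 \<le> a \<Longrightarrow> epowr x a \<le> epowr y a"
  by (cases x; cases y) (auto intro!: ennreal_leI powr_mono2 simp: top_unique)

lemma epowr_epowr: "epowr (epowr x a) b = epowr x (a * b)"
  by (cases x) (simp_all add: powr_powr)

lemma epowr_mult: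
  assumes "a > 0" shows "epowr (x * y) a = epowr x a * epowr y a"
proof (cases x)
  case (real u)
  show ?thesis
  proof (cases y)
    case (real v)
    with \<open>x = ennreal u\<close> \<open>0 \<le> u\<close> show ?thesis by (simp add: powr_mult flip: ennreal_mult)
  next
    case top
    with real assms show ?thesis
      by (cases "u = 0") (simp_all add: ennreal_mult_top)
  qed
next
  case top
  show ?thesis
  proof (cases y)
    case (real v)
    with top assms show ?thesis by (cases "v = 0") (simp_all add: ennreal_top_mult)
  qed (simp add: top)
qed

lemma epowr_add: "epowr x (a + b) = epowr x a * epowr x b"
  by (cases x) (simp_all add: powr_add flip: ennreal_mult)

lemma epowr_eq_0_iff [simp]: "epowr x a = 0 \<longleftrightarrow> x = 0"
  by (cases x) (auto simp: ennreal_eq_0_iff)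

lemma epowr_le_iff:
  assumes "a > 0" shows "epowr x a \<le> y \<longleftrightarrow> x \<le> epowr y (1 / a)"
proof
  assume "epowr x a \<le> y"
  then have "epowr (epowr x a) (1 / a) \<le> epowr y (1 / a)"
    using assms by (intro epowr_mono) auto
  then show "x \<le> epowr y (1 / a)" using assms by (simp add: epowr_epowr)
next
  assume "x \<le> epowr y (1 / a)"
  then have "epowr x a \<le> epowr (epowr y (1 / a)) a"
    using assms by (intro epowr_mono) auto
  then show "epowr x a \<le> y" using assms by (simp add: epowr_epowr)
qed

text \<open>For \<open>a > 0\<close> the power map has the monotone inverse
  \<open>epowr _ (1 / a)\<close>, and such maps preserve suprema.\<close>

lemma epowr_SUP:
  assumes "a > 0" shows "epowr (SUP i\<in>I. f i) a = (SUP i\<in>I. epowr (f i) a)"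
proof (rule antisym)
  have "f i \<le> epowr (SUP i\<in>I. epowr (f i) a) (1 / a)" if "i \<in> I" for i
    using assms that by (subst epowr_le_iff[symmetric]) (auto intro: SUP_upper)
  then show "epowr (SUP i\<in>I. f i) a \<le> (SUP i\<in>I. epowr (f i) a)"
    using assms by (subst epowr_le_iff) (auto intro: SUP_least)
  show "(SUP i\<in>I. epowr (f i) a) \<le> epowr (SUP i\<in>I. f i) a"
    using assms by (intro SUP_least epowr_mono SUP_upper) auto
qed

lemma epowr_measurable [measurable]:
  assumes [measurable]: "f \<in> borel_measurable M"
  shows "(\<lambda>x. epowr (f x) a) \<in> borel_measurable M"
  unfolding epowr_def by measurable

section \<open>Hoelder's and Minkowski's inequalities\<close>

lemma nn_integral_Holder:
  fixes p q :: real
  assumes [measurable]: "f \<in> borel_measurable M" "g \<in> borel_measurable M"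
    and pq: "1 < p" "1 / p + 1 / q = 1"
  shows "(\<integral>\<^sup>+x. f x * g x \<partial>M)
    \<le> epowr (\<integral>\<^sup>+x. epowr (f x) p \<partial>M) (1 / p) * epowr (\<integral>\<^sup>+x. epowr (g x) q \<partial>M) (1 / q)"
proof -
  have q: "1 < q"
  proof -
    have "1 / q = 1 - 1 / p" using pq by simp
    then have "0 < 1 / q" "1 / q < 1" using pq(1) by simp_all
    then show ?thesis by (simp add: divide_less_eq split: if_splits)
  qed
  define A where "A = (\<integral>\<^sup>+x. epowr (f x) p \<partial>M)"
  define B where "B = (\<integral>\<^sup>+x. epowr (g x) q \<partial>M)"
  consider "A = 0" | "B = 0" | "A = top" "B \<noteq> 0" | "B = top" "A \<noteq> 0"
    | x y where "A = ennreal x" "B = ennreal y" "x > 0" "y > 0"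
    by (cases A; cases B) (auto simp: le_less ennreal_0)
  then have "(\<integral>\<^sup>+x. f x * g x \<partial>M) \<le> epowr A (1 / p) * epowr B (1 / q)"
  proof cases
    case 1
    then have "AE x in M. f x = 0" by (simp add: A_def nn_integral_0_iff_AE)
    then have "(\<integral>\<^sup>+x. f x * g x \<partial>M) = 0" by (subst nn_integral_0_iff_AE) auto
    then show ?thesis by simp
  next
    case 2
    then have "AE x in M. g x = 0" by (simp add: B_def nn_integral_0_iff_AE)
    then have "(\<integral>\<^sup>+x. f x * g x \<partial>M) = 0" by (subst nn_integral_0_iff_AE) auto
    then show ?thesis by simp
  next
    case 3 then show ?thesis by (simp add: ennreal_top_mult)
  next
    case 4 then show ?thesis by (simp add: ennreal_mult_top)
  next
    case (5 x y)
    define u v where "u = x powr (1 / p)" and "v = y powr (1 / q)"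
    have uv: "u > 0" "v > 0" "u powr p = x" "v powr q = y"
      using 5 pq q by (auto simp: u_def v_def powr_powr)
    \<comment> \<open>Young's inequality for the normalized values \<open>a / u\<close> and
      \<open>b / v\<close>, multiplied back by \<open>u * v\<close>; after integration the right
      side is \<open>u * v * (1 / p + 1 / q)\<close>.\<close>
    have young: "f t * g t \<le> ennreal (u * v / (p * x)) * epowr (f t) p + ennreal (u * v / (q * y)) * epowr (g t) q" for t
    proof (cases "f t = top \<or> g t = top")
      case True
      then show ?thesis using 5 uv pq q by (auto simp: ennreal_mult_top)
    next
      case False
      then obtain a b where ab: "f t = ennreal a" "g t = ennreal b" "a \<ge> 0" "b \<ge> 0"
        by (cases "f t"; cases "g t") auto
      have "(a / u) * (b / v) \<le> (a / u) powr p / p + (b / v) powr q / q"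
        using ab uv pq q by (intro Youngs_inequality) auto
      then have "(u * v) * ((a / u) * (b / v)) \<le> (u * v) * ((a / u) powr p / p + (b / v) powr q / q)"
        using uv by (intro mult_left_mono) auto
      then have "a * b \<le> u * v / (p * x) * a powr p + u * v / (q * y) * b powr q"
        using uv by (simp add: powr_divide ring_distribs mult_ac)
      then show ?thesis
        using ab 5 uv pq q
        by (simp flip: ennreal_mult ennreal_plus)
    qed
    have "(\<integral>\<^sup>+t. f t * g t \<partial>M) \<le> (\<integral>\<^sup>+t. ennreal (u * v / (p * x)) * epowr (f t) p + ennreal (u * v / (q * y)) * epowr (g t) q \<partial>M)"
      by (rule nn_integral_mono) (rule young)
    also have "\<dots> = ennreal (u * v / (p * x)) * A + ennreal (u * v / (q * y)) * B"
      unfolding A_def B_def by (simp add: nn_integral_add nn_integral_cmult)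
    also have "\<dots> = ennreal (u * v / (p * x) * x + u * v / (q * y) * y)"
      using 5 uv pq q by (simp flip: ennreal_mult ennreal_plus)
    also have "u * v / (p * x) * x + u * v / (q * y) * y = u * v * (1 / p + 1 / q)"
      using 5 by (simp add: ring_distribs)
    also have "\<dots> = u * v" using pq by simp
    finally show ?thesis using 5 uv by (simp add: u_def v_def ennreal_mult)
  qed
  then show ?thesis by (simp add: A_def B_def)
qed

text \<open>Sends a perturbation of size \<open>e\<close> to zero. It serves the weight in
  Minkowski's inequality and the cut-off from below in Bliss's inequality.\<close>

lemma ennreal_le_powr_epsilon:
  assumes "k > 0" "t \<ge> 0" "C \<ge> 0" "c \<ge> 0" and le: "\<And>e. e > 0 \<Longrightarrow> X \<le> ennreal (c * (t + C * e) powr k)"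
  shows "X \<le> ennreal (c * t powr k)"
proof (rule LIMSEQ_le_const)
  have h0: "(\<lambda>n. 1 / real (Suc n)) \<longlonglongrightarrow> 0"
    using LIMSEQ_inverse_real_of_nat by (simp add: inverse_eq_divide)
  have "(\<lambda>n. ennreal (c * (t + C * (1 / real (Suc n))) powr k)) \<longlonglongrightarrow> ennreal (c * (t + C * 0) powr k)"
    using assms by (intro tendsto_ennrealI tendsto_mult tendsto_powr' tendsto_add tendsto_const h0) auto
  then show "(\<lambda>n. ennreal (c * (t + C * (1 / real (Suc n))) powr k)) \<longlonglongrightarrow> ennreal (c * t powr k)" by simp
  show "\<exists>N. \<forall>n\<ge>N. X \<le> ennreal (c * (t + C * (1 / real (Suc n))) powr k)"
    by (intro exI[of _ 0] allI impI le) simp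
qed

text \<open>
  Weighting by \<open>w\<close>, a perturbation of \<open>x \<mapsto> \<parallel>G(x, \<cdot>)\<parallel>\<^sub>k\<close> that makes it positive, Hoelder's inequality in
  \<open>x\<close> for \<open>G w\<^bsup>-(k-1)/k\<^esup> \<cdot> w\<^bsup>(k-1)/k\<^esup>\<close> reduces the claim to Tonelli's theorem.
\<close>
lemma nn_integral_Minkowski:
  assumes "sigma_finite_measure M" "sigma_finite_measure N"
    and [measurable]: "(\<lambda>(x, y). G x y) \<in> borel_measurable (M \<Otimes>\<^sub>M N)"
    and k: "k > 1"
  shows "(\<integral>\<^sup>+y. epowr (\<integral>\<^sup>+x. G x y \<partial>M) k \<partial>N)
    \<le> epowr (\<integral>\<^sup>+x. epowr (\<integral>\<^sup>+y. epowr (G x y) k \<partial>N) (1 / k) \<partial>M) k"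
proof -
  interpret M: sigma_finite_measure M by fact
  interpret N: sigma_finite_measure N by fact
  interpret pair_sigma_finite N M ..
  have [measurable]: "(\<lambda>(y, x). G x y) \<in> borel_measurable (N \<Otimes>\<^sub>M M)"
    using measurable_pair_swap[OF assms(3)] by (simp add: case_prod_unfold)
  define n where "n x = epowr (\<integral>\<^sup>+y. epowr (G x y) k \<partial>N) (1 / k)" for x
  have [measurable]: "n \<in> borel_measurable M" unfolding n_def by measurable
  show ?thesis
  proof (cases "(\<integral>\<^sup>+x. n x \<partial>M) = \<infinity>")
    case True then show ?thesis by (simp add: n_def)
  next
    case False
    then obtain t where t: "(\<integral>\<^sup>+x. n x \<partial>M) = ennreal t" "t \<ge> 0"
      by (cases "\<integral>\<^sup>+x. n x \<partial>M") auto
    have n_fin: "AE x in M. n x \<noteq> \<infinity>" using False by (intro nn_integral_PInf_AE) auto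
    obtain h where h [measurable]: "h \<in> borel_measurable M" and h_fin: "integral\<^sup>N M h \<noteq> \<infinity>"
      and h_pos: "\<And>x. x \<in> space M \<Longrightarrow> 0 < h x \<and> h x < \<infinity>"
      using M.Ex_finite_integrable_function by blast
    obtain C where C: "integral\<^sup>N M h = ennreal C" "C \<ge> 0" using h_fin by (cases "integral\<^sup>N M h") auto
    have "(\<integral>\<^sup>+y. epowr (\<integral>\<^sup>+x. G x y \<partial>M) k \<partial>N) \<le> ennreal (1 * (t + C * e) powr k)" if e: "e > 0" for e
    proof -
      \<comment> \<open>The positive function \<open>h\<close> with finite integral \<open>C\<close>
        exists by sigma-finiteness. Adding \<open>e * h\<close> gives negative powers of
        \<open>w\<close> a meaning where \<open>n\<close> vanishes and costs only
        \<open>C * e\<close> in the integral.\<close>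
      define w where "w x = enn2real (n x) + e * enn2real (h x)" for x
      have [measurable]: "w \<in> borel_measurable M" unfolding w_def by measurable
      have w_pos: "w x > 0" if "x \<in> space M" for x
        using h_pos[OF that] e unfolding w_def
        by (intro add_nonneg_pos mult_pos_pos) (auto simp: enn2real_positive_iff)
      have w_eq: "AE x in M. ennreal (w x) = n x + ennreal e * h x"
        using n_fin AE_space
      proof eventually_elim
        case (elim x)
        then show ?case using h_pos[of x] e
          by (cases "n x"; cases "h x") (auto simp: w_def ennreal_plus ennreal_mult)
      qed
      have w_int: "(\<integral>\<^sup>+x. ennreal (w x) \<partial>M) = ennreal (t + C * e)"
      proof -
        have "(\<integral>\<^sup>+x. ennreal (w x) \<partial>M) = (\<integral>\<^sup>+x. n x + ennreal e * h x \<partial>M)"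
          by (rule nn_integral_cong_AE[OF w_eq])
        also have "\<dots> = ennreal t + ennreal e * ennreal C"
          by (simp add: nn_integral_add nn_integral_cmult t C)
        also have "\<dots> = ennreal (t + C * e)"
          using t C e by (simp add: mult.commute flip: ennreal_plus ennreal_mult)
        finally show ?thesis .
      qed
      define T where "T = ennreal (t + C * e)"
      have k': "1 / k + 1 / (k / (k - 1)) = 1" using k by (simp add: field_simps)
      have holder: "epowr (\<integral>\<^sup>+x. G x y \<partial>M) k
          \<le> epowr T (k - 1) * (\<integral>\<^sup>+x. epowr (G x y) k * ennreal (w x powr (- (k - 1))) \<partial>M)"
        if [simp, measurable]: "y \<in> space N" for y
      proof -
        have "(\<integral>\<^sup>+x. G x y \<partial>M) = (\<integral>\<^sup>+x. (G x y * ennreal (w x powr (- (k - 1) / k))) * ennreal (w x powr ((k - 1) / k)) \<partial>M)"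
        proof (rule nn_integral_cong)
          fix x assume "x \<in> space M"
          note w_pos[OF this]
          have "ennreal (w x powr (- (k - 1) / k)) * ennreal (w x powr ((k - 1) / k)) = 1"
            using \<open>w x > 0\<close> by (simp flip: ennreal_mult powr_add add: add_divide_distrib[symmetric])
          then show "G x y = (G x y * ennreal (w x powr (- (k - 1) / k))) * ennreal (w x powr ((k - 1) / k))"
            by (simp add: mult.assoc)
        qed
        also have "\<dots> \<le> epowr (\<integral>\<^sup>+x. epowr (G x y * ennreal (w x powr (- (k - 1) / k))) k \<partial>M) (1 / k)
           * epowr (\<integral>\<^sup>+x. epowr (ennreal (w x powr ((k - 1) / k))) (k / (k - 1)) \<partial>M) (1 / (k / (k - 1)))"
          by (rule nn_integral_Holder[OF _ _ k k']) measurable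
        also have "(\<integral>\<^sup>+x. epowr (ennreal (w x powr ((k - 1) / k))) (k / (k - 1)) \<partial>M) = T"
          unfolding T_def w_int[symmetric]
          by (rule nn_integral_cong) (use w_pos k in \<open>simp add: powr_powr less_imp_le\<close>)
        also have "(\<integral>\<^sup>+x. epowr (G x y * ennreal (w x powr (- (k - 1) / k))) k \<partial>M)
            = (\<integral>\<^sup>+x. epowr (G x y) k * ennreal (w x powr (- (k - 1))) \<partial>M)"
          by (rule nn_integral_cong) (use k in \<open>simp add: epowr_mult powr_powr\<close>)
        finally have "epowr (\<integral>\<^sup>+x. G x y \<partial>M) k \<le> epowr (epowr (\<integral>\<^sup>+x. epowr (G x y) k * ennreal (w x powr (- (k - 1))) \<partial>M) (1 / k)
           * epowr T (1 / (k / (k - 1)))) k"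
          using k by (intro epowr_mono) auto
        also have "\<dots> = (\<integral>\<^sup>+x. epowr (G x y) k * ennreal (w x powr (- (k - 1))) \<partial>M) * epowr T (k - 1)"
          using k by (simp add: epowr_mult epowr_epowr)
        finally show ?thesis by (simp add: mult.commute)
      qed
      have w_bound: "AE x in M. epowr (n x) k * ennreal (w x powr (- (k - 1))) \<le> ennreal (w x)"
        using n_fin AE_space
      proof eventually_elim
        case (elim x)
        then obtain a where a: "n x = ennreal a" "a \<ge> 0" by (cases "n x") auto
        have wx: "w x > 0" "a \<le> w x" using w_pos[OF elim(2)] a e by (auto simp: w_def)
        have "a powr k * w x powr (- (k - 1)) \<le> w x powr k * w x powr (- (k - 1))"
          using wx a k by (intro mult_right_mono powr_mono2) auto
        also have "\<dots> = w x" using wx by (simp flip: powr_add)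
        finally show ?case using a wx by (simp flip: ennreal_mult)
      qed
      have "(\<integral>\<^sup>+y. epowr (\<integral>\<^sup>+x. G x y \<partial>M) k \<partial>N)
        \<le> (\<integral>\<^sup>+y. epowr T (k - 1) * (\<integral>\<^sup>+x. epowr (G x y) k * ennreal (w x powr (- (k - 1))) \<partial>M) \<partial>N)"
        by (rule nn_integral_mono) (rule holder)
      also have "\<dots> = epowr T (k - 1) * (\<integral>\<^sup>+y. \<integral>\<^sup>+x. epowr (G x y) k * ennreal (w x powr (- (k - 1))) \<partial>M \<partial>N)"
        by (rule nn_integral_cmult) measurable
      also have "(\<integral>\<^sup>+y. \<integral>\<^sup>+x. epowr (G x y) k * ennreal (w x powr (- (k - 1))) \<partial>M \<partial>N)
         = (\<integral>\<^sup>+x. \<integral>\<^sup>+y. epowr (G x y) k * ennreal (w x powr (- (k - 1))) \<partial>N \<partial>M)"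
        by (rule Fubini'[symmetric]) measurable
      also have "\<dots> = (\<integral>\<^sup>+x. epowr (n x) k * ennreal (w x powr (- (k - 1))) \<partial>M)"
        using k by (intro nn_integral_cong) (simp add: nn_integral_multc n_def epowr_epowr)
      also have "\<dots> \<le> (\<integral>\<^sup>+x. ennreal (w x) \<partial>M)"
        by (rule nn_integral_mono_AE[OF w_bound])
      also have "\<dots> = T" by (simp add: w_int T_def)
      also have "epowr T (k - 1) * T = epowr T k"
        using epowr_add[of T "k - 1" 1] by simp
      also have "\<dots> = ennreal (1 * (t + C * e) powr k)" 
        unfolding T_def using t C e by (subst epowr_ennreal) auto
      finally show ?thesis by (simp add: mult_left_mono)
    qed
    from ennreal_le_powr_epsilon[OF _ t(2) C(2) _ this]
    have "(\<integral>\<^sup>+y. epowr (\<integral>\<^sup>+x. G x y \<partial>M) k \<partial>N) \<le> ennreal (t powr k)" using k by simp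
    also have "\<dots> = epowr (\<integral>\<^sup>+x. n x \<partial>M) k" using t by simp
    finally show ?thesis by (simp add: n_def)
  qed
qed

section \<open>Spaces with a volume coordinate\<close>

text \<open>Abstracts \<open>x \<mapsto> |B(0,|x|)|\<close>: a sublevel set has measure equal to its
  level. This is all that the one-factor inequality uses of Euclidean space, and the dimension no
  longer appears.\<close>

locale volume_coordinate = sigma_finite_measure M for M :: "'a measure" +
  fixes \<tau> :: "'a \<Rightarrow> real"
  assumes \<tau>_measurable [measurable]: "\<tau> \<in> borel_measurable M"
    and \<tau>_nonneg: "\<And>x. x \<in> space M \<Longrightarrow> 0 \<le> \<tau> x"
    and emeasure_\<tau>_less: "\<And>s. 0 \<le> s \<Longrightarrow> emeasure M {x \<in> space M. \<tau> x < s} = ennreal s"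
begin

text \<open>The two measures agree on the half-lines \<open>{..<a}\<close>, which are stable under
  intersection and generate the Borel sets.\<close>

lemma distr_\<tau>: "distr M borel \<tau> = density lborel (indicator {0..})"
proof (rule measure_eqI_generator_eq)
  let ?E = "range (\<lambda>a::real. {..<a})"
  show "Int_stable ?E"
  proof (rule Int_stableI_image)
    fix a b :: real
    show "\<exists>k\<in>UNIV. {..<a} \<inter> {..<b} = {..<k}" by (intro bexI[of _ "min a b"]) auto
  qed
  show "?E \<subseteq> Pow UNIV" by simp
  show "sets (distr M borel \<tau>) = sigma_sets UNIV ?E"
    by (simp add: borel_Iio)
  show "sets (density lborel (indicator {0..})) = sigma_sets UNIV ?E"
    by (simp add: borel_Iio)
  show "range (\<lambda>n::nat. {..<real n}) \<subseteq> ?E" by auto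
  show "(\<Union>n::nat. {..<real n}) = UNIV" using reals_Archimedean2 by auto
  have *: "emeasure (distr M borel \<tau>) {..<a} = ennreal (max 0 a)" for a
  proof -
    have "\<tau> -` {..<a} \<inter> space M = {x \<in> space M. \<tau> x < max 0 a}"
      using \<tau>_nonneg by (force simp: max_def not_le)
    then show ?thesis using emeasure_\<tau>_less[of "max 0 a"] by (simp add: emeasure_distr)
  qed
  show "emeasure (distr M borel \<tau>) {..<real n} \<noteq> \<infinity>" for n by (simp only: *) simp
  fix X assume "X \<in> ?E"
  then obtain a where X: "X = {..<a}" by auto
  have "emeasure (density lborel (indicator {0..})) {..<a} = emeasure lborel ({0..} \<inter> {..<a})"
    by (simp add: emeasure_density flip: indicator_inter_arith)
  also have "{0..} \<inter> {..<a} = {0..<max 0 a}" by (auto simp: max_def)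
  also have "emeasure lborel \<dots> = ennreal (max 0 a)" by simp
  finally show "emeasure (distr M borel \<tau>) X = emeasure (density lborel (indicator {0..})) X"
    by (simp add: X *)
qed

lemma nn_integral_\<tau>:
  assumes [measurable]: "h \<in> borel_measurable borel"
  shows "(\<integral>\<^sup>+x. h (\<tau> x) \<partial>M) = (\<integral>\<^sup>+s. h s * indicator {0..} s \<partial>lborel)"
proof -
  have "(\<integral>\<^sup>+x. h (\<tau> x) \<partial>M) = (\<integral>\<^sup>+s. h s \<partial>distr M borel \<tau>)"
    by (rule nn_integral_distr[symmetric]) measurable
  also have "\<dots> = (\<integral>\<^sup>+s. indicator {0..} s * h s \<partial>lborel)"
    unfolding distr_\<tau> by (rule nn_integral_density) measurable
  finally show ?thesis by (simp add: mult.commute)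
qed

text \<open>Plays the part of \<open>F\<close> for \<open>u = f\<close> and of the energy
  \<open>E\<close> for \<open>u = f powr p\<close>. For bounded \<open>u\<close> the integral is
  finite, so \<open>enn2real\<close> loses nothing.\<close>

definition cumulative :: "('a \<Rightarrow> real) \<Rightarrow> real \<Rightarrow> real" where
  "cumulative u s = enn2real (\<integral>\<^sup>+y. (if \<tau> y < s then ennreal (u y) else 0) \<partial>M)"

text \<open>The slab \<open>s \<le> \<tau> < t\<close> has measure \<open>t - s\<close>, so
  pointwise bounds on \<open>u\<close> become Lipschitz bounds on the increments. These are the
  facts that \<open>bliss_increments\<close> asks for.\<close>

lemma cumulative:
  assumes [measurable]: "u \<in> borel_measurable M"
    and u: "\<And>x. x \<in> space M \<Longrightarrow> 0 \<le> u x" "\<And>x. x \<in> space M \<Longrightarrow> u x \<le> B"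
    and d: "\<And>x. x \<in> space M \<Longrightarrow> \<delta> \<le> u x" and s: "0 \<le> s"
  shows "(\<integral>\<^sup>+y. (if \<tau> y < s then ennreal (u y) else 0) \<partial>M) = ennreal (cumulative u s)"
    and "cumulative u 0 = 0"
    and "s \<le> t \<Longrightarrow> (\<integral>\<^sup>+y. (if s \<le> \<tau> y \<and> \<tau> y < t then ennreal (u y) else 0) \<partial>M) = ennreal (cumulative u t - cumulative u s)"
    and "s \<le> t \<Longrightarrow> cumulative u s \<le> cumulative u t"
    and "s \<le> t \<Longrightarrow> cumulative u t - cumulative u s \<le> B * (t - s)"
    and "s \<le> t \<Longrightarrow> \<delta> * (t - s) \<le> cumulative u t - cumulative u s"
proof -
  let ?I = "\<lambda>s. \<integral>\<^sup>+y. (if \<tau> y < s then ennreal (u y) else 0) \<partial>M"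
  let ?D = "\<lambda>s t. \<integral>\<^sup>+y. (if s \<le> \<tau> y \<and> \<tau> y < t then ennreal (u y) else 0) \<partial>M"
  show "cumulative u 0 = 0"
  proof -
    have "?I 0 = (\<integral>\<^sup>+y. 0 \<partial>M)"
      by (intro nn_integral_cong) (simp add: leD[OF \<tau>_nonneg])
    then show ?thesis by (simp add: cumulative_def)
  qed
  have slab: "emeasure M {x \<in> space M. s \<le> \<tau> x \<and> \<tau> x < t} = ennreal (t - s)" if "0 \<le> s" "s \<le> t" for s t
  proof -
    have "{x \<in> space M. s \<le> \<tau> x \<and> \<tau> x < t} = {x \<in> space M. \<tau> x < t} - {x \<in> space M. \<tau> x < s}" by auto
    then have "emeasure M {x \<in> space M. s \<le> \<tau> x \<and> \<tau> x < t} = ennreal t - ennreal s"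
      using that by (simp add: emeasure_Diff emeasure_\<tau>_less subset_eq)
    then show ?thesis using that by (simp add: ennreal_minus)
  qed
  have const: "(\<integral>\<^sup>+y. (if s \<le> \<tau> y \<and> \<tau> y < t then ennreal c else 0) \<partial>M) = ennreal (c * (t - s))"
    if "0 \<le> s" "s \<le> t" "0 \<le> c" for s t c
  proof -
    have "(\<integral>\<^sup>+y. (if s \<le> \<tau> y \<and> \<tau> y < t then ennreal c else 0) \<partial>M)
      = (\<integral>\<^sup>+y. ennreal c * indicator {x \<in> space M. s \<le> \<tau> x \<and> \<tau> x < t} y \<partial>M)"
      by (intro nn_integral_cong) auto
    also have "\<dots> = ennreal c * ennreal (t - s)"
      by (subst nn_integral_cmult_indicator) (auto simp: slab that)
    finally show ?thesis using that by (simp add: ennreal_mult)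
  qed
  have D_le: "?D s t \<le> ennreal (\<bar>B\<bar> * (t - s))" if "0 \<le> s" "s \<le> t" for s t
    unfolding const[OF that abs_ge_zero, symmetric]
    by (intro nn_integral_mono) (auto intro!: ennreal_leI order_trans[OF u(2)])
  have D_fin: "?D s t \<noteq> top" if "0 \<le> s" "s \<le> t" for s t
    using D_le[OF that] by (auto simp: top_unique)
  have I_D: "?I t = ?D 0 t" for t
    using \<tau>_nonneg by (intro nn_integral_cong) auto
  have I_eq: "?I s = ennreal (cumulative u s)" if "0 \<le> s" for s
    using D_fin[of 0 s] that by (simp add: cumulative_def I_D less_top)
  then show "?I s = ennreal (cumulative u s)" using s by simp
  have c_nonneg: "0 \<le> cumulative u s" for s by (simp add: cumulative_def)
  {
    assume t: "s \<le> t"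
    have "?I t = ?I s + ?D s t"
      by (subst nn_integral_add[symmetric]) (use t in \<open>auto intro!: nn_integral_cong\<close>)
    moreover obtain z where z: "?D s t = ennreal z" "z \<ge> 0"
      using D_fin[OF s t] by (cases "?D s t") auto
    ultimately have "ennreal (cumulative u t) = ennreal (cumulative u s + z)"
      using I_eq[of s] I_eq[of t] s t c_nonneg by simp
    then have z': "z = cumulative u t - cumulative u s"
      using z c_nonneg by (subst (asm) ennreal_inj) auto
    show D: "?D s t = ennreal (cumulative u t - cumulative u s)" using z z' by simp
    show mono: "cumulative u s \<le> cumulative u t" using z z' by simp
    have z_le: "z \<le> c * (t - s)" if "\<And>x. x \<in> space M \<Longrightarrow> u x \<le> c" "0 \<le> c" for c
    proof -
      have "?D s t \<le> ennreal (c * (t - s))"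
        unfolding const[OF s t that(2), symmetric]
        by (intro nn_integral_mono) (auto intro!: ennreal_leI that)
      then show ?thesis using z t that by simp
    qed
    show "cumulative u t - cumulative u s \<le> B * (t - s)"
    \<comment> \<open>The sign of \<open>B\<close> is known only if \<open>M\<close> has a point; on
      an empty space the slab has measure \<open>0\<close>, which forces
      \<open>t = s\<close>.\<close>
    proof (cases "space M = {}")
      case True
      have "?D s t = 0" "ennreal (t - s) = 0"
        using True slab[OF s t] by (simp_all add: nn_integral_empty)
      then show ?thesis using z z' t by (simp add: ennreal_eq_0_iff)
    next
      case False
      then have "0 \<le> B" using u by (meson all_not_in_conv order_trans)
      then show ?thesis using z_le[of B] u(2) z' by simp
    qed
    show "\<delta> * (t - s) \<le> cumulative u t - cumulative u s"
    proof (cases "0 \<le> \<delta>")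
      case True
      have "ennreal (\<delta> * (t - s)) \<le> ?D s t"
        unfolding const[OF s t True, symmetric]
        by (intro nn_integral_mono) (auto intro!: ennreal_leI d)
      then show ?thesis using z z' by simp
    next
      case False
      then show ?thesis using z z' t mult_nonpos_nonneg[of \<delta> "t - s"] by linarith
    qed
  }
qed

end

lemma SUP_min_of_nat: "(SUP n. min x (of_nat n)) = (x :: ennreal)"
proof (rule antisym)
  show "x \<le> (SUP n. min x (of_nat n))"
  proof (cases x)
    case (real a)
    obtain n where "a \<le> real n" using real_arch_simple by blast
    then have "x \<le> of_nat n" using real by (simp add: ennreal_of_nat_eq_real_of_nat ennreal_leI)
    then show ?thesis by (intro SUP_upper2[of n]) auto
  next
    case top
    then show ?thesis by (simp add: ennreal_SUP_of_nat_eq_top)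
  qed
qed (auto intro: SUP_least)

section \<open>Bliss's inequality on a space with a volume coordinate\<close>

locale hardy_volume = hardy_exponents p q + volume_coordinate M \<tau>
  for p q :: real and M :: "'a measure" and \<tau> :: "'a \<Rightarrow> real"
begin

text \<open>The bounds on \<open>g\<close> give the Lipschitz conditions on the two cumulative
  functions, and the inequality linking their increments is Hoelder's inequality for
  \<open>g\<close> and the constant \<open>1\<close> on a slab of measure
  \<open>t - s\<close>.\<close>

lemma bliss_bounded_below:
  assumes [measurable]: "g \<in> borel_measurable M"
    and g: "\<And>x. x \<in> space M \<Longrightarrow> \<delta> \<le> g x" "\<And>x. x \<in> space M \<Longrightarrow> g x \<le> B"
    and d: "\<delta> > 0" and b: "b > 0"
  shows "(\<integral>\<^sup>+s. epowr (\<integral>\<^sup>+y. (if \<tau> y < s then ennreal (g y) else 0) \<partial>M) q * ennreal (s powr (r - q)) * indicator {0..b} s \<partial>lborel)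
    \<le> ennreal (bliss_const * cumulative (\<lambda>y. g y powr p) b powr (q / p))"
proof -
  have g0: "\<And>x. x \<in> space M \<Longrightarrow> 0 \<le> g x" using g d by force
  have gp: "\<And>x. x \<in> space M \<Longrightarrow> g x powr p \<le> B powr p"
    using g g0 p_gt_1 by (intro powr_mono2) auto
  note F = cumulative[of g, OF _ g0 g(2) g(1)]
  note E = cumulative[of "\<lambda>y. g y powr p", OF _ powr_ge_zero gp powr_ge_zero]
  have "(\<integral>\<^sup>+s. ennreal (cumulative g s powr q * s powr (r - q)) * indicator {0..b} s \<partial>lborel)
     \<le> ennreal (bliss_const * cumulative (\<lambda>y. g y powr p) b powr (q / p))"
  proof (rule bliss_increments[OF b d])
    fix s t :: real assume st: "0 \<le> s" "s \<le> t"
    show "\<delta> * (t - s) \<le> cumulative g t - cumulative g s" using F(6) st by simp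
    show "cumulative g t - cumulative g s \<le> B * (t - s)" using F(5) st by simp
    show "cumulative (\<lambda>y. g y powr p) s \<le> cumulative (\<lambda>y. g y powr p) t" using E(4) st by simp
    show "cumulative (\<lambda>y. g y powr p) t - cumulative (\<lambda>y. g y powr p) s \<le> B powr p * (t - s)"
      using E(5) st by simp
    let ?S = "\<lambda>y. s \<le> \<tau> y \<and> \<tau> y < t"
    have k: "1 / p + 1 / (p / (p - 1)) = 1" using p_gt_1 by (simp add: field_simps)
    have mF: "cumulative g s \<le> cumulative g t" using F(4) st by simp
    have mE: "cumulative (\<lambda>y. g y powr p) s \<le> cumulative (\<lambda>y. g y powr p) t" using E(4) st by simp
    have one: "(\<integral>\<^sup>+y. (if ?S y then ennreal 1 else 0) \<partial>M) = ennreal (t - s)"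
    proof -
      have "cumulative (\<lambda>_. 1) t - cumulative (\<lambda>_. 1) s = t - s"
        using cumulative(5,6)[of "\<lambda>_. 1" 1 1 s t] st by simp
      then show ?thesis using cumulative(3)[of "\<lambda>_. 1" 1 1 s t] st by simp
    qed
    have "ennreal (cumulative g t - cumulative g s) = (\<integral>\<^sup>+y. (if ?S y then ennreal (g y) else 0) \<partial>M)"
      using F(3) st by simp
    also have "\<dots> = (\<integral>\<^sup>+y. (if ?S y then ennreal (g y) else 0) * (if ?S y then 1 else 0) \<partial>M)"
      by (intro nn_integral_cong) auto
    also have "\<dots> \<le> epowr (\<integral>\<^sup>+y. epowr (if ?S y then ennreal (g y) else 0) p \<partial>M) (1 / p) *
        epowr (\<integral>\<^sup>+y. epowr (if ?S y then 1 else 0) (p / (p - 1)) \<partial>M) (1 / (p / (p - 1)))"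
      by (rule nn_integral_Holder[OF _ _ p_gt_1 k]) measurable
    also have "(\<integral>\<^sup>+y. epowr (if ?S y then ennreal (g y) else 0) p \<partial>M)
       = (\<integral>\<^sup>+y. (if ?S y then ennreal (g y powr p) else 0) \<partial>M)"
      using g0 by (intro nn_integral_cong) auto
    also have "\<dots> = ennreal (cumulative (\<lambda>y. g y powr p) t - cumulative (\<lambda>y. g y powr p) s)"
      using E(3) st by simp
    also have "(\<integral>\<^sup>+y. epowr (if ?S y then 1 else 0) (p / (p - 1)) \<partial>M) = ennreal (t - s)"
      unfolding one[symmetric] by (intro nn_integral_cong) (auto simp flip: ennreal_1)
    finally have le: "cumulative g t - cumulative g s \<le>
       (cumulative (\<lambda>y. g y powr p) t - cumulative (\<lambda>y. g y powr p) s) powr (1 / p) * (t - s) powr ((p - 1) / p)"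
      using st mE by (simp flip: ennreal_mult)
    have "(cumulative g t - cumulative g s) powr p \<le>
       ((cumulative (\<lambda>y. g y powr p) t - cumulative (\<lambda>y. g y powr p) s) powr (1 / p) * (t - s) powr ((p - 1) / p)) powr p"
      using le mF p_gt_1 by (intro powr_mono2) auto
    also have "\<dots> = (cumulative (\<lambda>y. g y powr p) t - cumulative (\<lambda>y. g y powr p) s) * (t - s) powr (p - 1)"
      using p_gt_1 mE by (simp add: powr_mult powr_powr)
    finally show "(cumulative g t - cumulative g s) powr p \<le>
       (cumulative (\<lambda>y. g y powr p) t - cumulative (\<lambda>y. g y powr p) s) * (t - s) powr (p - 1)" .
  qed (use F(2) E(2) in auto)
  also have "(\<integral>\<^sup>+s. ennreal (cumulative g s powr q * s powr (r - q)) * indicator {0..b} s \<partial>lborel)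
    = (\<integral>\<^sup>+s. epowr (\<integral>\<^sup>+y. (if \<tau> y < s then ennreal (g y) else 0) \<partial>M) q * ennreal (s powr (r - q)) * indicator {0..b} s \<partial>lborel)"
  proof (intro nn_integral_cong)
    fix s :: real
    show "ennreal (cumulative g s powr q * s powr (r - q)) * indicator {0..b} s
       = epowr (\<integral>\<^sup>+y. (if \<tau> y < s then ennreal (g y) else 0) \<partial>M) q * ennreal (s powr (r - q)) * indicator {0..b} s"
    proof (cases "s \<in> {0..b}")
      case True
      then have "epowr (\<integral>\<^sup>+y. (if \<tau> y < s then ennreal (g y) else 0) \<partial>M) q = ennreal (cumulative g s powr q)"
        by (subst F(1)) (auto simp: cumulative_def)
      then show ?thesis by (simp add: ennreal_mult)
    qed simp
  qed
  finally show ?thesis .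
qed

text \<open>Replacing \<open>g\<close> by \<open>max \<delta> g\<close> only increases the left
  side. As the set \<open>\<tau> < b\<close> has measure \<open>b\<close>, the energy there grows by
  at most \<open>b * \<delta> powr p = b * \<epsilon>\<close>, which then tends to
  \<open>0\<close>.\<close>

lemma bliss_bounded:
  assumes [measurable]: "g \<in> borel_measurable M"
    and g: "\<And>x. x \<in> space M \<Longrightarrow> 0 \<le> g x" "\<And>x. x \<in> space M \<Longrightarrow> g x \<le> B"
    and b: "b > 0"
  shows "(\<integral>\<^sup>+s. epowr (\<integral>\<^sup>+y. (if \<tau> y < s then ennreal (g y) else 0) \<partial>M) q * ennreal (s powr (r - q)) * indicator {0..b} s \<partial>lborel)
    \<le> ennreal bliss_const * epowr (\<integral>\<^sup>+y. ennreal (g y powr p) \<partial>M) (q / p)" (is "?L \<le> _")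
proof (cases "(\<integral>\<^sup>+y. ennreal (g y powr p) \<partial>M)")
  case top
  then show ?thesis using bliss_const_pos by (simp add: ennreal_mult_top)
next
  case (real e)
  have "?L \<le> ennreal (bliss_const * (e + b * \<epsilon>) powr (q / p))" if eps: "\<epsilon> > 0" for \<epsilon>
  proof -
    define \<delta> where "\<delta> = \<epsilon> powr (1 / p)"
    have d: "\<delta> > 0" "\<delta> powr p = \<epsilon>" using eps p_gt_1 by (auto simp: \<delta>_def powr_powr)
    define u where "u x = max \<delta> (g x)" for x
    have [measurable]: "u \<in> borel_measurable M" unfolding u_def by measurable
    have u_le: "u x \<le> max \<delta> B" "u x powr p \<le> max \<delta> B powr p" if "x \<in> space M" for x
      using g(2)[OF that] d p_gt_1 by (auto simp: u_def intro!: powr_mono2)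
    have "?L \<le> (\<integral>\<^sup>+s. epowr (\<integral>\<^sup>+y. (if \<tau> y < s then ennreal (u y) else 0) \<partial>M) q * ennreal (s powr (r - q)) * indicator {0..b} s \<partial>lborel)"
      using q_gt_1 by (intro nn_integral_mono mult_right_mono epowr_mono) (auto simp: u_def intro!: ennreal_leI)
    also have "\<dots> \<le> ennreal (bliss_const * cumulative (\<lambda>y. u y powr p) b powr (q / p))"
      by (rule bliss_bounded_below[where \<delta>=\<delta> and B="max \<delta> B"]) (use u_le d b in \<open>auto simp: u_def\<close>)
    also have "\<dots> \<le> ennreal (bliss_const * (e + b * \<epsilon>) powr (q / p))"
    proof (intro ennreal_leI mult_left_mono powr_mono2)
      have up: "u y powr p \<le> g y powr p + \<epsilon>" if "y \<in> space M" for y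
        using d eps g(1)[OF that] by (auto simp: u_def max_def)
      have "ennreal (cumulative (\<lambda>y. u y powr p) b) = (\<integral>\<^sup>+y. (if \<tau> y < b then ennreal (u y powr p) else 0) \<partial>M)"
        by (rule cumulative(1)[symmetric, where B="max \<delta> B powr p" and \<delta>=0])
          (use u_le b in auto)
      also have "\<dots> \<le> (\<integral>\<^sup>+y. ennreal (g y powr p) + ennreal \<epsilon> * indicator {x \<in> space M. \<tau> x < b} y \<partial>M)"
        using up eps by (intro nn_integral_mono) (auto simp flip: ennreal_plus intro!: ennreal_leI)
      also have "\<dots> = ennreal e + ennreal \<epsilon> * ennreal b"
        using b by (subst nn_integral_add) (auto simp: real nn_integral_cmult_indicator emeasure_\<tau>_less)
      also have "\<dots> = ennreal (e + b * \<epsilon>)"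
        using real eps b by (simp add: mult.commute flip: ennreal_mult ennreal_plus)
      finally show "cumulative (\<lambda>y. u y powr p) b \<le> e + b * \<epsilon>"
        using real eps b by (subst (asm) ennreal_le_iff) auto
    qed (use bliss_const_pos p_gt_1 q_gt_1 in \<open>auto simp: cumulative_def\<close>)
    finally show ?thesis .
  qed
  from ennreal_le_powr_epsilon[OF _ _ _ _ this]
  have "?L \<le> ennreal (bliss_const * e powr (q / p))"
    using p_gt_1 q_gt_1 real b bliss_const_pos by auto
  then show ?thesis using real bliss_const_pos by (simp add: ennreal_mult)
qed

text \<open>Monotone convergence removes the truncation of \<open>f\<close> at height
  \<open>n\<close> and then the bound \<open>b\<close> on the range of \<open>\<tau>\<close>. Since
  \<open>q * (1 / p - 1 / q - 1) = r - q\<close>, the weight of the operator becomes the weight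
  \<open>s powr (r - q)\<close> of the half-line inequality.\<close>

theorem bliss_inequality:
  assumes [measurable]: "f \<in> borel_measurable M"
  shows "(\<integral>\<^sup>+x. epowr (ennreal (\<tau> x powr (1 / p - 1 / q - 1)) * (\<integral>\<^sup>+y. (if \<tau> y < \<tau> x then f y else 0) \<partial>M)) q \<partial>M)
    \<le> ennreal bliss_const * epowr (\<integral>\<^sup>+y. epowr (f y) p \<partial>M) (q / p)" (is "_ \<le> ?R")
proof -
  let ?I = "\<lambda>f s. epowr (\<integral>\<^sup>+y. (if \<tau> y < s then f y else 0) \<partial>M) q * ennreal (s powr (r - q))"
  have I_meas [measurable]: "(\<lambda>s. ?I f s) \<in> borel_measurable borel" if [measurable]: "f \<in> borel_measurable M" for f
    by measurable
  have fin: "(\<integral>\<^sup>+s. ?I (\<lambda>y. min (f y) (of_nat n)) s * indicator {0..b} s \<partial>lborel) \<le> ?R" if b: "b > 0" for n b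
  proof -
    define g where "g y = enn2real (min (f y) (of_nat n))" for y
    have g: "min (f y) (of_nat n) = ennreal (g y)" for y
      using of_nat_less_top[of n] by (simp add: g_def min_less_iff_disj)
    have [measurable]: "g \<in> borel_measurable M" unfolding g_def by measurable
    have g_le: "g y \<le> real n" for y
    proof -
      have "ennreal (g y) \<le> ennreal (real n)" by (simp flip: g add: ennreal_of_nat_eq_real_of_nat[symmetric])
      then show ?thesis by simp
    qed
    have "(\<integral>\<^sup>+s. ?I (\<lambda>y. min (f y) (of_nat n)) s * indicator {0..b} s \<partial>lborel)
      \<le> ennreal bliss_const * epowr (\<integral>\<^sup>+y. ennreal (g y powr p) \<partial>M) (q / p)"
      unfolding g by (rule bliss_bounded[where B="real n"]) (use g_le b in \<open>auto simp: g_def\<close>)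
    also have "\<dots> \<le> ?R"
    proof (intro mult_left_mono epowr_mono nn_integral_mono)
      fix y
      have "ennreal (g y powr p) = epowr (min (f y) (of_nat n)) p" unfolding g by (simp add: g_def)
      also have "\<dots> \<le> epowr (f y) p" using p_gt_1 by (intro epowr_mono) auto
      finally show "ennreal (g y powr p) \<le> epowr (f y) p" .
    qed (use p_gt_1 q_gt_1 in auto)
    finally show ?thesis .
  qed
  have I_SUP: "?I f s = (SUP n. ?I (\<lambda>y. min (f y) (of_nat n)) s)" for s
  proof -
    have "(\<integral>\<^sup>+y. (if \<tau> y < s then f y else 0) \<partial>M)
       = (\<integral>\<^sup>+y. (SUP n. if \<tau> y < s then min (f y) (of_nat n) else 0) \<partial>M)"
      by (intro nn_integral_cong) (auto simp: SUP_min_of_nat)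
    also have "\<dots> = (SUP n. \<integral>\<^sup>+y. (if \<tau> y < s then min (f y) (of_nat n) else 0) \<partial>M)"
      by (rule nn_integral_monotone_convergence_SUP)
        (auto simp: incseq_def le_fun_def min.coboundedI2 intro!: min.mono)
    finally show ?thesis
      using q_gt_1 by (simp add: epowr_SUP SUP_mult_right_ennreal)
  qed
  have fin2: "(\<integral>\<^sup>+s. ?I f s * indicator {0..b} s \<partial>lborel) \<le> ?R" if b: "b > 0" for b
  proof -
    have "(\<integral>\<^sup>+s. ?I f s * indicator {0..b} s \<partial>lborel)
      = (\<integral>\<^sup>+s. (SUP n. ?I (\<lambda>y. min (f y) (of_nat n)) s * indicator {0..b} s) \<partial>lborel)"
      by (simp only: I_SUP SUP_mult_right_ennreal)
    also have "\<dots> = (SUP n. \<integral>\<^sup>+s. ?I (\<lambda>y. min (f y) (of_nat n)) s * indicator {0..b} s \<partial>lborel)"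
    proof (rule nn_integral_monotone_convergence_SUP)
      show "incseq (\<lambda>n s. ?I (\<lambda>y. min (f y) (of_nat n)) s * indicator {0..b} s)"
        using q_gt_1 by (auto simp: incseq_def le_fun_def simp del: min.bounded_iff
            intro!: mult_right_mono epowr_mono nn_integral_mono min.mono)
    qed measurable
    also have "\<dots> \<le> ?R" by (intro SUP_least fin b)
    finally show ?thesis .
  qed
  have exp: "q * (1 / p - 1 / q - 1) = r - q" using p_gt_1 q_gt_1 by (simp add: r_def field_simps)
  have "(\<integral>\<^sup>+x. epowr (ennreal (\<tau> x powr (1 / p - 1 / q - 1)) * (\<integral>\<^sup>+y. (if \<tau> y < \<tau> x then f y else 0) \<partial>M)) q \<partial>M)
     = (\<integral>\<^sup>+x. ?I f (\<tau> x) \<partial>M)"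
    using q_gt_1 by (intro nn_integral_cong) (simp add: epowr_mult powr_powr exp mult.commute)
  also have "\<dots> = (\<integral>\<^sup>+s. ?I f s * indicator {0..} s \<partial>lborel)"
    by (rule nn_integral_\<tau>) measurable
  also have "\<dots> = (\<integral>\<^sup>+s. (SUP n. ?I f s * indicator {0..real (Suc n)} s) \<partial>lborel)"
  proof (rule nn_integral_cong)
    fix s :: real
    have "indicator {0..} s = (SUP n. indicator {0..real (Suc n)} s :: ennreal)"
    proof (rule antisym)
      obtain n where "s \<le> real n" using real_arch_simple by blast
      then show "indicator {0..} s \<le> (SUP n. indicator {0..real (Suc n)} s :: ennreal)"
        by (intro SUP_upper2[of n]) (auto simp: indicator_def)
    qed (auto intro!: SUP_least simp: indicator_def)
    then show "?I f s * indicator {0..} s = (SUP n. ?I f s * indicator {0..real (Suc n)} s)"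
      by (simp only: SUP_mult_left_ennreal)
  qed
  also have "\<dots> = (SUP n. \<integral>\<^sup>+s. ?I f s * indicator {0..real (Suc n)} s \<partial>lborel)"
  proof (rule nn_integral_monotone_convergence_SUP)
    show "incseq (\<lambda>n s. ?I f s * indicator {0..real (Suc n)} s)"
      by (auto simp: incseq_def le_fun_def intro!: mult_left_mono simp: indicator_def)
  qed measurable
  also have "\<dots> \<le> ?R" by (intro SUP_least fin2) simp
  finally show ?thesis .
qed

end

section \<open>Products\<close>

lemma nn_integral_FTC_Ioo:
  fixes G g :: "real \<Rightarrow> real" and b :: ereal
  assumes b: "0 < b"
    and G: "\<And>x. 0 < x \<Longrightarrow> ereal x < b \<Longrightarrow> DERIV G x :> g x"
    and g: "\<And>x. 0 < x \<Longrightarrow> ereal x < b \<Longrightarrow> isCont g x" "\<And>x. 0 < x \<Longrightarrow> ereal x < b \<Longrightarrow> 0 \<le> g x"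
    and lims: "(G \<longlongrightarrow> 0) (at_right 0)" "((G \<circ> real_of_ereal) \<longlongrightarrow> L) (at_left b)"
  shows "(\<integral>\<^sup>+x. ennreal (g x) * indicator {x. 0 < x \<and> ereal x < b} x \<partial>lborel) = ennreal L"
proof -
  have l0: "((G \<circ> real_of_ereal) \<longlongrightarrow> 0) (at_right 0)"
    using lims(1) by (simp add: zero_ereal_def ereal_tendsto_simps)
  have ae: "AE x in lborel. 0 < ereal x \<longrightarrow> ereal x < b \<longrightarrow> 0 \<le> g x" using g by simp
  note * = interval_integral_FTC_nonneg[of 0 b G g, OF b _ _ ae l0 lims(2)]
  have int: "set_integrable lborel (einterval 0 b) g" and eq: "(LBINT x=0..b. g x) = L - 0"
    using * G g by auto
  have ei: "einterval 0 b = {x. 0 < x \<and> ereal x < b}" by (auto simp: einterval_def)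
  have "(\<integral>\<^sup>+x. ennreal (g x) * indicator {x. 0 < x \<and> ereal x < b} x \<partial>lborel)
      = (\<integral>\<^sup>+x. ennreal (indicator (einterval 0 b) x *\<^sub>R g x) \<partial>lborel)"
    by (intro nn_integral_cong) (simp add: ei indicator_def)
  also have "\<dots> = ennreal (\<integral>x. indicator (einterval 0 b) x *\<^sub>R g x \<partial>lborel)"
    using int g by (intro nn_integral_eq_integral) (auto simp: set_integrable_def ei indicator_def)
  also have "(\<integral>x. indicator (einterval 0 b) x *\<^sub>R g x \<partial>lborel) = L"
    using eq less_imp_le[OF b] by (simp add: interval_lebesgue_integral_def set_lebesgue_integral_def)
  finally show ?thesis .
qed

context hardy_exponents
begin

definition extremal :: "real \<Rightarrow> real" where
  "extremal s = (1 + s powr r) powr (- (1 / r) - 1)"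

definition extremal_prim :: "real \<Rightarrow> real" where
  "extremal_prim s = s * (1 + s powr r) powr (- (1 / r))"

lemma one_plus_powr_pos: "1 + s powr r > 0"
  by (intro add_pos_nonneg) auto

lemma extremal_pos: "extremal s > 0"
  using one_plus_powr_pos[of s] by (simp add: extremal_def)

lemma extremal_powr: "extremal s powr p = profile s"
proof -
  have "(- (1 / r) - 1) * p = - (q / r)"
    using r_pos p_gt_1 by (simp add: field_simps r_def)
  then show ?thesis by (simp add: extremal_def profile_def powr_powr)
qed

lemma extremal_prim_powr:
  assumes "s \<ge> 0" shows "extremal_prim s powr q * s powr (r - q) = s powr r * profile s"
proof -
  have "extremal_prim s powr q = s powr q * profile s"
    by (simp add: extremal_prim_def profile_def powr_mult powr_powr)
  moreover have "s powr q * s powr (r - q) = s powr r" by (simp flip: powr_add)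
  ultimately show ?thesis by (simp add: mult_ac)
qed

lemma isCont_profile: "x > 0 \<Longrightarrow> isCont profile x"
  unfolding profile_def[abs_def] using one_plus_powr_pos[of x] by (intro continuous_intros) auto

lemma DERIV_extremal_prim:
  assumes x: "x > 0" shows "DERIV extremal_prim x :> extremal x"
proof -
  define e where "e = - (1 / r)"
  have e: "e * r = - 1" using r_pos by (simp add: e_def)
  let ?c = "1 + x powr r"
  have c: "?c > 0" by (rule one_plus_powr_pos)
  have 1: "?c powr e = ?c powr (e - 1) * ?c" using c by (simp add: powr_diff)
  have 2: "x * x powr (r - 1) = x powr r" using x by (simp add: powr_mult_base)
  have "DERIV (\<lambda>x. x * (1 + x powr r) powr e) x :> ?c powr e + x * (e * ?c powr (e - 1) * (r * x powr (r - 1)))"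
    using x c by (auto intro!: derivative_eq_intros)
  also have "?c powr e + x * (e * ?c powr (e - 1) * (r * x powr (r - 1)))
    = ?c powr (e - 1) * (?c + (e * r) * (x * x powr (r - 1)))"
    unfolding 1 by (simp add: algebra_simps)
  also have "?c + (e * r) * (x * x powr (r - 1)) = 1" unfolding 2 e by simp
  finally show ?thesis by (simp add: extremal_def extremal_prim_def[abs_def] e_def)
qed

lemma nn_integral_profile:
  "(\<integral>\<^sup>+x. ennreal (profile x) * indicator {0<..} x \<partial>lborel) = ennreal mass_lim"
  using nn_integral_FTC_Ioo[of \<infinity> mass profile mass_lim] DERIV_mass isCont_profile mass_0 mass_top profile_pos
  by (simp add: ereal_tendsto_simps less_imp_le greaterThan_def)

lemma nn_integral_powr_profile:
  "(\<integral>\<^sup>+x. ennreal (x powr r * profile x) * indicator {0<..} x \<partial>lborel) = ennreal moment_lim"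
proof -
  have "isCont (\<lambda>x. x powr r * profile x) x" if "x > 0" for x
    using that by (intro continuous_intros isCont_profile) auto
  then show ?thesis
    using nn_integral_FTC_Ioo[of \<infinity> moment "\<lambda>x. x powr r * profile x" moment_lim] DERIV_moment moment_0 moment_top profile_pos
    by (simp add: ereal_tendsto_simps less_imp_le greaterThan_def)
qed

lemma nn_integral_extremal:
  assumes b: "b > 0"
  shows "(\<integral>\<^sup>+x. ennreal (extremal x) * indicator {x. 0 < x \<and> x < b} x \<partial>lborel) = ennreal (extremal_prim b)"
proof -
  have cont: "isCont extremal x" if "x > 0" for x
    unfolding extremal_def[abs_def] using that one_plus_powr_pos[of x] by (intro continuous_intros) auto
  have "(extremal_prim \<longlongrightarrow> 0 * (1 + 0 powr r) powr (- (1 / r))) (at_right 0)"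
    unfolding extremal_prim_def[abs_def] using r_pos
    by (intro tendsto_intros) (auto simp: eventually_nonneg_at_right_0)
  moreover have "(extremal_prim \<longlongrightarrow> extremal_prim b) (at_left b)"
    using DERIV_isCont[OF DERIV_extremal_prim[OF b]] by (simp add: isCont_def tendsto_within_subset[where T="{..<b}"])
  ultimately show ?thesis
    using nn_integral_FTC_Ioo[of "ereal b" extremal_prim extremal "extremal_prim b"] b
      DERIV_extremal_prim cont extremal_pos
    by (simp add: ereal_tendsto_simps less_imp_le)
qed

end

context hardy_volume
begin

lemma nn_integral_extremal_less:
  assumes s: "s \<ge> 0"
  shows "(\<integral>\<^sup>+y. (if \<tau> y < s then ennreal (extremal (\<tau> y)) else 0) \<partial>M) = ennreal (extremal_prim s)"
proof -
  have [measurable]: "extremal \<in> borel_measurable borel" unfolding extremal_def by measurable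
  have "(\<integral>\<^sup>+y. (if \<tau> y < s then ennreal (extremal (\<tau> y)) else 0) \<partial>M)
    = (\<integral>\<^sup>+t. (if t < s then ennreal (extremal t) else 0) * indicator {0..} t \<partial>lborel)"
    by (rule nn_integral_\<tau>[of "\<lambda>t. if t < s then ennreal (extremal t) else 0"]) measurable
  also have "\<dots> = (\<integral>\<^sup>+t. ennreal (extremal t) * indicator {x. 0 < x \<and> x < s} t \<partial>lborel)"
    by (intro nn_integral_cong_AE eventually_mono[OF AE_lborel_singleton[of 0]]) (auto simp: indicator_def)
  also have "\<dots> = ennreal (extremal_prim s)"
    using nn_integral_extremal[of s] s by (cases "s = 0") (auto simp: extremal_prim_def)
  finally show ?thesis .
qed

lemma nn_integral_extremal_powr:
  "(\<integral>\<^sup>+y. ennreal (extremal (\<tau> y) powr p) \<partial>M) = ennreal mass_lim"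
proof -
  have [measurable]: "profile \<in> borel_measurable borel" unfolding profile_def by measurable
  have "(\<integral>\<^sup>+y. ennreal (extremal (\<tau> y) powr p) \<partial>M) = (\<integral>\<^sup>+t. ennreal (profile t) * indicator {0..} t \<partial>lborel)"
    unfolding extremal_powr by (rule nn_integral_\<tau>) measurable
  also have "\<dots> = (\<integral>\<^sup>+t. ennreal (profile t) * indicator {0<..} t \<partial>lborel)"
    by (intro nn_integral_cong_AE eventually_mono[OF AE_lborel_singleton[of 0]]) (auto simp: indicator_def)
  finally show ?thesis by (simp add: nn_integral_profile)
qed

lemma nn_integral_extremal_prim_powr:
  "(\<integral>\<^sup>+y. ennreal ((\<tau> y powr (1 / p - 1 / q - 1) * extremal_prim (\<tau> y)) powr q) \<partial>M) = ennreal moment_lim"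
proof -
  have [measurable]: "profile \<in> borel_measurable borel" unfolding profile_def by measurable
  have exp: "q * (1 / p - 1 / q - 1) = r - q" using p_gt_1 q_gt_1 by (simp add: r_def field_simps)
  have "(\<integral>\<^sup>+y. ennreal ((\<tau> y powr (1 / p - 1 / q - 1) * extremal_prim (\<tau> y)) powr q) \<partial>M)
     = (\<integral>\<^sup>+y. ennreal (\<tau> y powr r * profile (\<tau> y)) \<partial>M)"
  proof (intro nn_integral_cong)
    fix y assume y: "y \<in> space M"
    have "(\<tau> y powr (1 / p - 1 / q - 1) * extremal_prim (\<tau> y)) powr q = extremal_prim (\<tau> y) powr q * \<tau> y powr (r - q)"
      by (simp add: powr_mult powr_powr exp mult.commute)
    also have "\<dots> = \<tau> y powr r * profile (\<tau> y)" by (rule extremal_prim_powr[OF \<tau>_nonneg[OF y]])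
    finally show "ennreal ((\<tau> y powr (1 / p - 1 / q - 1) * extremal_prim (\<tau> y)) powr q)
       = ennreal (\<tau> y powr r * profile (\<tau> y))" by simp
  qed
  also have "\<dots> = (\<integral>\<^sup>+t. ennreal (t powr r * profile t) * indicator {0..} t \<partial>lborel)"
    by (rule nn_integral_\<tau>) measurable
  also have "\<dots> = (\<integral>\<^sup>+t. ennreal (t powr r * profile t) * indicator {0<..} t \<partial>lborel)"
    by (intro nn_integral_cong_AE eventually_mono[OF AE_lborel_singleton[of 0]]) (auto simp: indicator_def)
  finally show ?thesis by (simp add: nn_integral_powr_profile)
qed

end

section \<open>The operator on a finite product and its bound\<close>

locale hardy_product = hardy_exponents p q + product_sigma_finite M
  for p q :: real and M :: "'i \<Rightarrow> 'a measure" +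
  fixes \<tau> :: "'i \<Rightarrow> 'a \<Rightarrow> real"
begin

definition weight :: "'i set \<Rightarrow> ('i \<Rightarrow> 'a) \<Rightarrow> real" where
  "weight I x = (\<Prod>i\<in>I. \<tau> i (x i) powr (1 / p - 1 / q - 1))"

text \<open>The operator on nonnegative functions. With values in \<open>ennreal\<close>, iterated
  integrals can be split and exchanged without integrability conditions; \<open>hardy_frac\<close>
  is later dominated by it pointwise.\<close>

definition nn_hardy :: "'i set \<Rightarrow> (('i \<Rightarrow> 'a) \<Rightarrow> ennreal) \<Rightarrow> ('i \<Rightarrow> 'a) \<Rightarrow> ennreal" where
  "nn_hardy I f x = ennreal (weight I x) *
     (\<integral>\<^sup>+y. (if \<forall>i\<in>I. \<tau> i (y i) < \<tau> i (x i) then f y else 0) \<partial>Pi\<^sub>M I M)"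

lemma weight_nonneg: "0 \<le> weight I x"
  by (simp add: weight_def prod_nonneg)

text \<open>The parameter \<open>v\<close> is needed for the induction on the variables: there the
  variable split off is the parameter of a family of functions of the others.\<close>

lemma nn_hardy_measurable:
  assumes I: "finite I" and \<tau>: "\<And>i. i \<in> I \<Longrightarrow> \<tau> i \<in> borel_measurable (M i)"
    and f: "(\<lambda>(v, y). f v y) \<in> borel_measurable (N \<Otimes>\<^sub>M Pi\<^sub>M I M)"
  shows "(\<lambda>(v, x). nn_hardy I (f v) x) \<in> borel_measurable (N \<Otimes>\<^sub>M Pi\<^sub>M I M)"
proof -
  interpret I: sigma_finite_measure "Pi\<^sub>M I M" by (rule sigma_finite[OF I])
  note I [simp]
  have [measurable]: "(\<lambda>x. \<tau> i (x i)) \<in> borel_measurable (Pi\<^sub>M I M)" if "i \<in> I" for i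
    using that \<tau>[OF that] by (intro measurable_compose[OF measurable_component_singleton]) auto
  have [measurable]: "weight I \<in> borel_measurable (Pi\<^sub>M I M)"
    unfolding weight_def by (intro borel_measurable_prod) measurable
  have [measurable]: "(\<lambda>z. f (fst (fst z)) (snd z)) \<in> borel_measurable ((N \<Otimes>\<^sub>M Pi\<^sub>M I M) \<Otimes>\<^sub>M Pi\<^sub>M I M)"
  proof -
    have "(\<lambda>z. (fst (fst z), snd z)) \<in> (N \<Otimes>\<^sub>M Pi\<^sub>M I M) \<Otimes>\<^sub>M Pi\<^sub>M I M \<rightarrow>\<^sub>M N \<Otimes>\<^sub>M Pi\<^sub>M I M"
      by measurable
    from measurable_compose[OF this f] show ?thesis by simp
  qed
  have [measurable]: "Measurable.pred ((N \<Otimes>\<^sub>M Pi\<^sub>M I M) \<Otimes>\<^sub>M Pi\<^sub>M I M) (\<lambda>z. \<forall>i\<in>I. \<tau> i (snd z i) < \<tau> i (snd (fst z) i))"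
  proof (rule pred_intros_finite)
    fix i assume i: "i \<in> I"
    have [measurable]: "(\<lambda>z. \<tau> i (snd z i)) \<in> borel_measurable ((N \<Otimes>\<^sub>M Pi\<^sub>M I M) \<Otimes>\<^sub>M Pi\<^sub>M I M)"
      "(\<lambda>z. \<tau> i (snd (fst z) i)) \<in> borel_measurable ((N \<Otimes>\<^sub>M Pi\<^sub>M I M) \<Otimes>\<^sub>M Pi\<^sub>M I M)"
      using i by (auto intro!: measurable_compose[OF _ \<tau>] measurable_compose[OF _ measurable_component_singleton])
    show "Measurable.pred ((N \<Otimes>\<^sub>M Pi\<^sub>M I M) \<Otimes>\<^sub>M Pi\<^sub>M I M) (\<lambda>z. \<tau> i (snd z i) < \<tau> i (snd (fst z) i))"
      by measurable
  qed simp
  have "(\<lambda>z. \<integral>\<^sup>+y. (if \<forall>i\<in>I. \<tau> i (y i) < \<tau> i (snd z i) then f (fst z) y else 0) \<partial>Pi\<^sub>M I M)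
     \<in> borel_measurable (N \<Otimes>\<^sub>M Pi\<^sub>M I M)"
    by (rule I.borel_measurable_nn_integral) (simp add: case_prod_beta, measurable)
  then have "(\<lambda>z. nn_hardy I (f (fst z)) (snd z)) \<in> borel_measurable (N \<Otimes>\<^sub>M Pi\<^sub>M I M)"
    unfolding nn_hardy_def by measurable
  then show ?thesis by (simp add: case_prod_beta)
qed

text \<open>Induction on the variables. For fixed remaining variables \<open>x\<close>, the
  one-factor inequality acts in the new variable on \<open>v \<mapsto> T v x\<close>; for fixed
  \<open>v\<close>, the induction hypothesis bounds \<open>T v\<close>. Minkowski's inequality,
  available since \<open>p < q\<close>, passes from one order of the norms to the other, and the
  powers \<open>p / q\<close> and \<open>q / p\<close> of the constants cancel.\<close>

theorem nn_hardy_bound: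
  assumes "finite I" and "\<And>i. i \<in> I \<Longrightarrow> volume_coordinate (M i) (\<tau> i)"
    and "f \<in> borel_measurable (Pi\<^sub>M I M)"
  shows "(\<integral>\<^sup>+x. epowr (nn_hardy I f x) q \<partial>Pi\<^sub>M I M)
    \<le> ennreal (bliss_const ^ card I) * epowr (\<integral>\<^sup>+y. epowr (f y) p \<partial>Pi\<^sub>M I M) (q / p)"
  using assms
proof (induction I arbitrary: f rule: finite_induct)
  case empty
  then show ?case
    using p_gt_1 by (simp add: PiM_empty nn_integral_count_space_finite nn_hardy_def weight_def epowr_epowr)
next
  case (insert j I)
  note [measurable] = insert.prems(2)
  note [simp] = insert.hyps
  interpret j: volume_coordinate "M j" "\<tau> j" by (rule insert.prems(1)) simp
  interpret hj: hardy_volume p q "M j" "\<tau> j" ..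
  interpret I: sigma_finite_measure "Pi\<^sub>M I M" by (rule sigma_finite) simp
  define T where "T v x = nn_hardy I (\<lambda>y. f (y(j := v))) x" for v x
  have upd: "(\<lambda>(v, y). y(j := v)) \<in> M j \<Otimes>\<^sub>M Pi\<^sub>M I M \<rightarrow>\<^sub>M Pi\<^sub>M (insert j I) M"
    using measurable_compose[OF measurable_pair_swap' measurable_add_dim[of j I M]]
    by (simp add: case_prod_beta')
  have T_meas [measurable]: "(\<lambda>(v, x). T v x) \<in> borel_measurable (M j \<Otimes>\<^sub>M Pi\<^sub>M I M)"
    unfolding T_def
  proof (rule nn_hardy_measurable)
    show "\<tau> i \<in> borel_measurable (M i)" if "i \<in> I" for i
      using insert.prems(1)[of i] that by (simp add: volume_coordinate_def volume_coordinate_axioms_def)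
    show "(\<lambda>(v, y). f (y(j := v))) \<in> borel_measurable (M j \<Otimes>\<^sub>M Pi\<^sub>M I M)"
      using measurable_compose[OF upd insert.prems(2)] by (simp add: case_prod_beta')
  qed simp
  \<comment> \<open>Domain and weight are both products over the variables, so Tonelli's theorem
    writes the operator as the one-factor operator in variable \<open>j\<close> applied to
    \<open>T\<close>.\<close>
  have T_eq: "nn_hardy (insert j I) f (x(j := u))
      = ennreal (\<tau> j u powr (1 / p - 1 / q - 1)) * (\<integral>\<^sup>+v. (if \<tau> j v < \<tau> j u then T v x else 0) \<partial>M j)"
    if x: "x \<in> space (Pi\<^sub>M I M)" and u: "u \<in> space (M j)" for x u
  proof -
    let ?x = "x(j := u)"
    have xu: "?x \<in> space (Pi\<^sub>M (insert j I) M)"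
      using measurable_space[OF upd, of "(u, x)"] x u by (simp add: space_pair_measure)
    have \<tau>m: "(\<lambda>y. \<tau> i (y i)) \<in> borel_measurable (Pi\<^sub>M (insert j I) M)" if "i \<in> insert j I" for i
      using insert.prems(1)[of i] that
      by (intro measurable_compose[OF measurable_component_singleton]) (auto simp: volume_coordinate_def volume_coordinate_axioms_def)
    have wt: "weight (insert j I) ?x = \<tau> j u powr (1 / p - 1 / q - 1) * weight I x"
      unfolding weight_def by (subst prod.insert) (auto intro!: arg_cong2[where f="(*)"] prod.cong)
    have meas: "(\<lambda>y. if \<forall>i\<in>insert j I. \<tau> i (y i) < \<tau> i (?x i) then f y else 0) \<in> borel_measurable (Pi\<^sub>M (insert j I) M)"
    proof -
      have [measurable]: "Measurable.pred (Pi\<^sub>M (insert j I) M) (\<lambda>y. \<forall>i\<in>insert j I. \<tau> i (y i) < \<tau> i (?x i))"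
      proof (rule pred_intros_finite)
        fix i assume "i \<in> insert j I"
        from \<tau>m[OF this] show "Measurable.pred (Pi\<^sub>M (insert j I) M) (\<lambda>y. \<tau> i (y i) < \<tau> i (?x i))"
          by (rule borel_measurable_pred_less) simp
      qed simp
      show ?thesis by measurable
    qed
    have inner: "(\<integral>\<^sup>+y. (if \<forall>i\<in>insert j I. \<tau> i ((y(j := v)) i) < \<tau> i (?x i) then f (y(j := v)) else 0) \<partial>Pi\<^sub>M I M)
        = (if \<tau> j v < \<tau> j u then \<integral>\<^sup>+y. (if \<forall>i\<in>I. \<tau> i (y i) < \<tau> i (x i) then f (y(j := v)) else 0) \<partial>Pi\<^sub>M I M else 0)" for v
    proof -
      have iff: "(\<forall>i\<in>insert j I. \<tau> i ((y(j := v)) i) < \<tau> i (?x i)) = (\<tau> j v < \<tau> j u \<and> (\<forall>i\<in>I. \<tau> i (y i) < \<tau> i (x i)))" for y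
      proof -
        have "(\<forall>i\<in>I. \<tau> i ((y(j := v)) i) < \<tau> i (?x i)) = (\<forall>i\<in>I. \<tau> i (y i) < \<tau> i (x i))"
        proof (rule ball_cong[OF refl])
          fix i assume "i \<in> I"
          with insert.hyps(2) have "i \<noteq> j" by blast
          then show "(\<tau> i ((y(j := v)) i) < \<tau> i (?x i)) = (\<tau> i (y i) < \<tau> i (x i))" by simp
        qed
        then show ?thesis by (simp only: ball_insert fun_upd_same)
      qed
      show ?thesis
      proof (cases "\<tau> j v < \<tau> j u")
        case True
        then show ?thesis unfolding iff by (simp only: if_True simp_thms)
      next
        case False
        then show ?thesis unfolding iff by simp
      qed
    qed
    have "nn_hardy (insert j I) f ?x = ennreal (\<tau> j u powr (1 / p - 1 / q - 1)) * (ennreal (weight I x) *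
       (\<integral>\<^sup>+v. (if \<tau> j v < \<tau> j u then \<integral>\<^sup>+y. (if \<forall>i\<in>I. \<tau> i (y i) < \<tau> i (x i) then f (y(j := v)) else 0) \<partial>Pi\<^sub>M I M else 0) \<partial>M j))"
      unfolding nn_hardy_def product_nn_integral_insert_rev[OF insert.hyps meas] inner wt
      by (simp add: ennreal_mult weight_nonneg mult.assoc)
    also have "ennreal (weight I x) *
       (\<integral>\<^sup>+v. (if \<tau> j v < \<tau> j u then \<integral>\<^sup>+y. (if \<forall>i\<in>I. \<tau> i (y i) < \<tau> i (x i) then f (y(j := v)) else 0) \<partial>Pi\<^sub>M I M else 0) \<partial>M j)
      = (\<integral>\<^sup>+v. ennreal (weight I x) * (if \<tau> j v < \<tau> j u then \<integral>\<^sup>+y. (if \<forall>i\<in>I. \<tau> i (y i) < \<tau> i (x i) then f (y(j := v)) else 0) \<partial>Pi\<^sub>M I M else 0) \<partial>M j)"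
    proof (rule nn_integral_cmult[symmetric])
      have "(\<lambda>v. \<integral>\<^sup>+y. (if \<forall>i\<in>insert j I. \<tau> i ((y(j := v)) i) < \<tau> i (?x i) then f (y(j := v)) else 0) \<partial>Pi\<^sub>M I M) \<in> borel_measurable (M j)"
        by (rule I.borel_measurable_nn_integral, unfold case_prod_beta')
          (rule measurable_compose[OF upd meas, unfolded case_prod_beta'])
      then show "(\<lambda>v. if \<tau> j v < \<tau> j u then \<integral>\<^sup>+y. (if \<forall>i\<in>I. \<tau> i (y i) < \<tau> i (x i) then f (y(j := v)) else 0) \<partial>Pi\<^sub>M I M else 0) \<in> borel_measurable (M j)"
        unfolding inner .
    qed
    also have "\<dots> = (\<integral>\<^sup>+v. (if \<tau> j v < \<tau> j u then T v x else 0) \<partial>M j)"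
      by (intro nn_integral_cong) (simp add: T_def nn_hardy_def)
    finally show ?thesis .
  qed
  have H_meas: "nn_hardy (insert j I) f \<in> borel_measurable (Pi\<^sub>M (insert j I) M)"
  proof -
    \<comment> \<open>A one-point parameter space specializes the measurability of families to a
      single function.\<close>
    have "(\<lambda>(v, x). nn_hardy (insert j I) f x) \<in> borel_measurable (count_space {()} \<Otimes>\<^sub>M Pi\<^sub>M (insert j I) M)"
    proof (rule nn_hardy_measurable)
      show "\<tau> i \<in> borel_measurable (M i)" if "i \<in> insert j I" for i
        using insert.prems(1)[of i] that by (simp add: volume_coordinate_def volume_coordinate_axioms_def)
    qed (use insert in auto)
    from measurable_compose[OF measurable_Pair1' this, of "()"] show ?thesis by simp
  qed
  have T_x [measurable]: "(\<lambda>v. T v x) \<in> borel_measurable (M j)" if "x \<in> space (Pi\<^sub>M I M)" for x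
    using measurable_compose[OF measurable_Pair2'[OF that] T_meas] by simp
  let ?K = "ennreal bliss_const"
  have kn: "ennreal (bliss_const ^ n) = ?K ^ n" for n
    using bliss_const_pos by (simp add: ennreal_power)
  have T_swap: "(\<lambda>(x, v). T v x) \<in> borel_measurable (Pi\<^sub>M I M \<Otimes>\<^sub>M M j)"
    using measurable_pair_swap[OF T_meas] by (simp add: case_prod_beta')
  note [measurable] = T_swap
  have "(\<integral>\<^sup>+x. epowr (nn_hardy (insert j I) f x) q \<partial>Pi\<^sub>M (insert j I) M)
     = (\<integral>\<^sup>+x. \<integral>\<^sup>+u. epowr (nn_hardy (insert j I) f (x(j := u))) q \<partial>M j \<partial>Pi\<^sub>M I M)"
    by (rule product_nn_integral_insert) (auto intro: epowr_measurable H_meas)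
  also have "\<dots> = (\<integral>\<^sup>+x. \<integral>\<^sup>+u. epowr (ennreal (\<tau> j u powr (1 / p - 1 / q - 1)) * (\<integral>\<^sup>+v. (if \<tau> j v < \<tau> j u then T v x else 0) \<partial>M j)) q \<partial>M j \<partial>Pi\<^sub>M I M)"
    by (intro nn_integral_cong) (simp add: T_eq)
  also have "\<dots> \<le> (\<integral>\<^sup>+x. ?K * epowr (\<integral>\<^sup>+v. epowr (T v x) p \<partial>M j) (q / p) \<partial>Pi\<^sub>M I M)"
    by (intro nn_integral_mono hj.bliss_inequality T_x)
  also have "\<dots> = ?K * (\<integral>\<^sup>+x. epowr (\<integral>\<^sup>+v. epowr (T v x) p \<partial>M j) (q / p) \<partial>Pi\<^sub>M I M)"
    by (rule nn_integral_cmult) measurable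
  \<comment> \<open>Minkowski's inequality for \<open>epowr (T v x) p\<close> with exponent
    \<open>q / p > 1\<close> moves the integration over the remaining variables inside the one over
    \<open>v\<close>, where the induction hypothesis applies slice by slice.\<close>
  also have "(\<integral>\<^sup>+x. epowr (\<integral>\<^sup>+v. epowr (T v x) p \<partial>M j) (q / p) \<partial>Pi\<^sub>M I M)
    \<le> epowr (\<integral>\<^sup>+v. epowr (\<integral>\<^sup>+x. epowr (epowr (T v x) p) (q / p) \<partial>Pi\<^sub>M I M) (1 / (q / p)) \<partial>M j) (q / p)"
    using p_gt_1 p_less_q
    by (intro nn_integral_Minkowski sigma_finite_measures sigma_finite) (auto, measurable)
  also have "\<dots> = epowr (\<integral>\<^sup>+v. epowr (\<integral>\<^sup>+x. epowr (T v x) q \<partial>Pi\<^sub>M I M) (p / q) \<partial>M j) (q / p)"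
    using p_gt_1 by (simp add: epowr_epowr)
  also have "\<dots> \<le> epowr (\<integral>\<^sup>+v. epowr (?K ^ card I) (p / q) * (\<integral>\<^sup>+y. epowr (f (y(j := v))) p \<partial>Pi\<^sub>M I M) \<partial>M j) (q / p)"
  proof (intro epowr_mono nn_integral_mono)
    fix v assume v: "v \<in> space (M j)"
    have fv: "(\<lambda>y. f (y(j := v))) \<in> borel_measurable (Pi\<^sub>M I M)"
      using measurable_compose[OF measurable_compose[OF measurable_Pair1'[OF v] upd] insert.prems(2)]
      by (simp only: prod.case)
    have "epowr (\<integral>\<^sup>+x. epowr (T v x) q \<partial>Pi\<^sub>M I M) (p / q)
       \<le> epowr (?K ^ card I * epowr (\<integral>\<^sup>+y. epowr (f (y(j := v))) p \<partial>Pi\<^sub>M I M) (q / p)) (p / q)"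
      unfolding T_def kn[symmetric] using p_gt_1 q_gt_1
      by (intro epowr_mono insert.IH insert.prems(1) fv) auto
    also have "\<dots> = epowr (?K ^ card I) (p / q) * (\<integral>\<^sup>+y. epowr (f (y(j := v))) p \<partial>Pi\<^sub>M I M)"
      using p_gt_1 q_gt_1 by (simp add: epowr_mult epowr_epowr)
    finally show "epowr (\<integral>\<^sup>+x. epowr (T v x) q \<partial>Pi\<^sub>M I M) (p / q)
       \<le> epowr (?K ^ card I) (p / q) * (\<integral>\<^sup>+y. epowr (f (y(j := v))) p \<partial>Pi\<^sub>M I M)" .
  qed (use p_gt_1 q_gt_1 in auto)
  also have "(\<integral>\<^sup>+v. epowr (?K ^ card I) (p / q) * (\<integral>\<^sup>+y. epowr (f (y(j := v))) p \<partial>Pi\<^sub>M I M) \<partial>M j)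
    = epowr (?K ^ card I) (p / q) * (\<integral>\<^sup>+v. \<integral>\<^sup>+y. epowr (f (y(j := v))) p \<partial>Pi\<^sub>M I M \<partial>M j)"
  proof (rule nn_integral_cmult)
    show "(\<lambda>v. \<integral>\<^sup>+y. epowr (f (y(j := v))) p \<partial>Pi\<^sub>M I M) \<in> borel_measurable (M j)"
      by (rule I.borel_measurable_nn_integral, unfold case_prod_beta')
        (rule measurable_compose[OF upd epowr_measurable[OF insert.prems(2)], unfolded case_prod_beta'])
  qed
  also have "(\<integral>\<^sup>+v. \<integral>\<^sup>+y. epowr (f (y(j := v))) p \<partial>Pi\<^sub>M I M \<partial>M j) = (\<integral>\<^sup>+y. epowr (f y) p \<partial>Pi\<^sub>M (insert j I) M)"
    by (rule product_nn_integral_insert_rev[symmetric]) auto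
  also have "?K * epowr (epowr (?K ^ card I) (p / q) * (\<integral>\<^sup>+y. epowr (f y) p \<partial>Pi\<^sub>M (insert j I) M)) (q / p)
    = ennreal (bliss_const ^ card (insert j I)) * epowr (\<integral>\<^sup>+y. epowr (f y) p \<partial>Pi\<^sub>M (insert j I) M) (q / p)"
    using p_gt_1 q_gt_1 by (simp add: epowr_mult epowr_epowr kn mult.assoc del: power_Suc add: power_Suc[where a="?K"])
  finally show ?case by (simp add: mult_left_mono)
qed

section \<open>The product of the one-factor extremals\<close>

definition extremal_fun :: "'i set \<Rightarrow> ('i \<Rightarrow> 'a) \<Rightarrow> real" where
  "extremal_fun I y = (\<Prod>i\<in>I. extremal (\<tau> i (y i)))"

lemma extremal_fun_pos: "extremal_fun I y > 0"
  by (simp add: extremal_fun_def extremal_pos prod_pos)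

context
  fixes I :: "'i set"
  assumes I: "finite I" and vol: "\<And>i. i \<in> I \<Longrightarrow> volume_coordinate (M i) (\<tau> i)"
begin

lemma hardy_volume_component: "i \<in> I \<Longrightarrow> hardy_volume p q (M i) (\<tau> i)"
  using vol by (simp add: hardy_volume_def hardy_exponents_axioms)

lemma \<tau>_component_measurable: "i \<in> I \<Longrightarrow> (\<lambda>y. \<tau> i (y i)) \<in> borel_measurable (Pi\<^sub>M I M)"
  using vol by (intro measurable_compose[OF measurable_component_singleton])
    (auto simp: volume_coordinate_def volume_coordinate_axioms_def)

lemma extremal_fun_measurable: "extremal_fun I \<in> borel_measurable (Pi\<^sub>M I M)"
proof -
  have "extremal \<in> borel_measurable borel" unfolding extremal_def by measurable
  then show ?thesis unfolding extremal_fun_def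
    by (intro borel_measurable_prod measurable_compose[OF \<tau>_component_measurable])
qed

text \<open>The domain is a product, so its indicator can be distributed over the factors and the
  integral splits into one-factor integrals.\<close>

lemma nn_integral_extremal_fun_less:
  assumes x: "x \<in> space (Pi\<^sub>M I M)"
  shows "(\<integral>\<^sup>+y. (if \<forall>i\<in>I. \<tau> i (y i) < \<tau> i (x i) then ennreal (extremal_fun I y) else 0) \<partial>Pi\<^sub>M I M)
    = ennreal (\<Prod>i\<in>I. extremal_prim (\<tau> i (x i)))"
proof -
  have [measurable]: "extremal \<in> borel_measurable borel" unfolding extremal_def by measurable
  have xi: "0 \<le> \<tau> i (x i)" if "i \<in> I" for i
    using vol[OF that] x that by (intro volume_coordinate.\<tau>_nonneg) (auto simp: space_PiM PiE_iff)
  have "(\<integral>\<^sup>+y. (if \<forall>i\<in>I. \<tau> i (y i) < \<tau> i (x i) then ennreal (extremal_fun I y) else 0) \<partial>Pi\<^sub>M I M)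
    = (\<integral>\<^sup>+y. (\<Prod>i\<in>I. (if \<tau> i (y i) < \<tau> i (x i) then ennreal (extremal (\<tau> i (y i))) else 0)) \<partial>Pi\<^sub>M I M)"
  proof (intro nn_integral_cong)
    fix y
    show "(if \<forall>i\<in>I. \<tau> i (y i) < \<tau> i (x i) then ennreal (extremal_fun I y) else 0)
      = (\<Prod>i\<in>I. (if \<tau> i (y i) < \<tau> i (x i) then ennreal (extremal (\<tau> i (y i))) else 0))"
      using I by (auto simp: extremal_fun_def prod_ennreal extremal_pos less_imp_le prod_zero_iff)
  qed
  also have "\<dots> = (\<Prod>i\<in>I. \<integral>\<^sup>+v. (if \<tau> i v < \<tau> i (x i) then ennreal (extremal (\<tau> i v)) else 0) \<partial>M i)"
  proof (rule product_nn_integral_prod[OF I])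
    fix i assume "i \<in> I"
    then interpret hardy_volume p q "M i" "\<tau> i" by (rule hardy_volume_component)
    show "(\<lambda>v. if \<tau> i v < \<tau> i (x i) then ennreal (extremal (\<tau> i v)) else 0) \<in> borel_measurable (M i)"
      by measurable
  qed
  also have "\<dots> = (\<Prod>i\<in>I. ennreal (extremal_prim (\<tau> i (x i))))"
    using xi by (intro prod.cong refl hardy_volume.nn_integral_extremal_less hardy_volume_component)
  also have "\<dots> = ennreal (\<Prod>i\<in>I. extremal_prim (\<tau> i (x i)))"
    using xi by (intro prod_ennreal) (auto simp: extremal_prim_def)
  finally show ?thesis .
qed

lemma nn_integral_extremal_fun_powr:
  "(\<integral>\<^sup>+y. ennreal (extremal_fun I y powr p) \<partial>Pi\<^sub>M I M) = ennreal (mass_lim ^ card I)"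
proof -
  have [measurable]: "extremal \<in> borel_measurable borel" unfolding extremal_def by measurable
  have "(\<integral>\<^sup>+y. ennreal (extremal_fun I y powr p) \<partial>Pi\<^sub>M I M)
     = (\<integral>\<^sup>+y. (\<Prod>i\<in>I. ennreal (extremal (\<tau> i (y i)) powr p)) \<partial>Pi\<^sub>M I M)"
    by (simp add: extremal_fun_def prod_ennreal prod_powr_distrib extremal_pos less_imp_le)
  also have "\<dots> = (\<Prod>i\<in>I. \<integral>\<^sup>+v. ennreal (extremal (\<tau> i v) powr p) \<partial>M i)"
  proof (rule product_nn_integral_prod[OF I])
    fix i assume "i \<in> I"
    then interpret hardy_volume p q "M i" "\<tau> i" by (rule hardy_volume_component)
    show "(\<lambda>v. ennreal (extremal (\<tau> i v) powr p)) \<in> borel_measurable (M i)" by measurable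
  qed
  also have "\<dots> = (\<Prod>i\<in>I. ennreal mass_lim)"
    by (intro prod.cong refl hardy_volume.nn_integral_extremal_powr hardy_volume_component)
  finally show ?thesis using mass_lim_pos by (simp add: ennreal_power)
qed

lemma nn_integral_extremal_fun_hardy:
  "(\<integral>\<^sup>+x. ennreal ((weight I x * (\<Prod>i\<in>I. extremal_prim (\<tau> i (x i)))) powr q) \<partial>Pi\<^sub>M I M) = ennreal (moment_lim ^ card I)"
proof -
  have [measurable]: "extremal_prim \<in> borel_measurable borel" unfolding extremal_prim_def by measurable
  have "(\<integral>\<^sup>+x. ennreal ((weight I x * (\<Prod>i\<in>I. extremal_prim (\<tau> i (x i)))) powr q) \<partial>Pi\<^sub>M I M)
     = (\<integral>\<^sup>+x. (\<Prod>i\<in>I. ennreal ((\<tau> i (x i) powr (1 / p - 1 / q - 1) * extremal_prim (\<tau> i (x i))) powr q)) \<partial>Pi\<^sub>M I M)"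
  proof (intro nn_integral_cong)
    fix x assume x: "x \<in> space (Pi\<^sub>M I M)"
    have xi: "0 \<le> \<tau> i (x i)" if "i \<in> I" for i
      using vol[OF that] x that by (intro volume_coordinate.\<tau>_nonneg) (auto simp: space_PiM PiE_iff)
    have "(weight I x * (\<Prod>i\<in>I. extremal_prim (\<tau> i (x i)))) powr q
      = (\<Prod>i\<in>I. (\<tau> i (x i) powr (1 / p - 1 / q - 1) * extremal_prim (\<tau> i (x i))) powr q)"
      unfolding weight_def prod.distrib[symmetric]
      by (rule prod_powr_distrib)
    then show "ennreal ((weight I x * (\<Prod>i\<in>I. extremal_prim (\<tau> i (x i)))) powr q)
      = (\<Prod>i\<in>I. ennreal ((\<tau> i (x i) powr (1 / p - 1 / q - 1) * extremal_prim (\<tau> i (x i))) powr q))"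
      by (simp add: prod_ennreal)
  qed
  also have "\<dots> = (\<Prod>i\<in>I. \<integral>\<^sup>+v. ennreal ((\<tau> i v powr (1 / p - 1 / q - 1) * extremal_prim (\<tau> i v)) powr q) \<partial>M i)"
  proof (rule product_nn_integral_prod[OF I])
    fix i assume "i \<in> I"
    then interpret hardy_volume p q "M i" "\<tau> i" by (rule hardy_volume_component)
    show "(\<lambda>v. ennreal ((\<tau> i v powr (1 / p - 1 / q - 1) * extremal_prim (\<tau> i v)) powr q)) \<in> borel_measurable (M i)"
      by measurable
  qed
  also have "\<dots> = (\<Prod>i\<in>I. ennreal moment_lim)"
    by (intro prod.cong refl hardy_volume.nn_integral_extremal_prim_powr hardy_volume_component)
  finally show ?thesis using moment_lim_pos by (simp add: ennreal_power)
qed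

end

end

section \<open>Euclidean balls and the main theorem\<close>

text \<open>Each simple function of an approximating sequence agrees almost everywhere with one
  measurable for \<open>M\<close>. Countably many exceptional sets fit into one null set
  \<open>N\<close>, and resetting all values to \<open>0\<close> on \<open>N\<close> makes the
  sequence converge everywhere.\<close>

lemma completion_ex_borel_measurable_metric:
  fixes f :: "'a \<Rightarrow> 'b::{metric_space, second_countable_topology, zero}"
  assumes f: "f \<in> borel_measurable (completion M)"
  shows "\<exists>g\<in>borel_measurable M. AE x in M. f x = g x"
proof -
  obtain s where s: "\<And>i. simple_function (completion M) (s i)"
      "\<And>x. x \<in> space M \<Longrightarrow> (\<lambda>i. s i x) \<longlonglongrightarrow> f x"
    using borel_measurable_implies_sequence_metric[OF f, of 0] by auto
  from s(1)[THEN completion_ex_simple_function]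
  obtain t where t: "\<And>i. simple_function M (t i)" "\<And>i. AE x in M. s i x = t i x" by metis
  have "AE x in M. \<forall>i. s i x = t i x" using t(2) by (simp add: AE_all_countable)
  then obtain N where N: "N \<in> null_sets M" "{x \<in> space M. \<not> (\<forall>i. s i x = t i x)} \<subseteq> N"
    by (auto elim!: AE_E simp: null_sets_def)
  define g where "g x = (if x \<in> N then 0 else f x)" for x
  have "g \<in> borel_measurable M"
  proof (rule borel_measurable_LIMSEQ_metric)
    have [measurable]: "N \<in> sets M" using N by auto
    show "(\<lambda>x. if x \<in> N then 0 else t i x) \<in> borel_measurable M" for i
      using borel_measurable_simple_function[OF t(1)] by measurable
    fix x assume x: "x \<in> space M"
    show "(\<lambda>i. if x \<in> N then 0 else t i x) \<longlonglongrightarrow> g x"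
    proof (cases "x \<in> N")
      case False
      then have "\<forall>i. s i x = t i x" using N(2) x by blast
      then show ?thesis using False s(2)[OF x] by (simp add: g_def)
    qed (simp add: g_def)
  qed
  moreover have "AE x in M. f x = g x"
    using AE_not_in[OF N(1)] by eventually_elim (simp add: g_def)
  ultimately show ?thesis by blast
qed

lemma Lp_norm_eq_epowr:
  "Lp_norm M p f = epowr (\<integral>\<^sup>+x. ennreal (norm (f x) powr p) \<partial>M) (1 / p)"
  by (simp add: Lp_norm_def epowr_def Let_def)

interpretation lborel: product_sigma_finite "\<lambda>_::nat. lborel :: real measure" ..

lemma sigma_finite_Rn_measure: "sigma_finite_measure (Rn_measure d)"
  unfolding Rn_measure_def by (rule lborel.sigma_finite) simp

lemma Rn_norm_nonneg: "0 \<le> Rn_norm d v"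
  by (simp add: Rn_norm_def)

lemma Rn_norm_measurable [measurable]: "Rn_norm d \<in> borel_measurable (Rn_measure d)"
  unfolding Rn_norm_def[abs_def] Rn_measure_def L2_set_def by measurable

text \<open>The volume of closed balls is known. The open ball lies inside the closed one of radius
  \<open>R\<close> and contains those of radius \<open>r < R\<close>, and the volume is continuous
  in the radius.\<close>

lemma emeasure_Rn_ball:
  assumes d: "d \<ge> 1" and R: "R \<ge> 0"
  shows "emeasure (Rn_measure d) (Rn_ball d R) = ennreal (unit_ball_vol (real d) * R ^ d)"
proof (cases "R = 0")
  case True
  then have "Rn_ball d R = {}" using Rn_norm_nonneg by (auto simp: Rn_ball_def not_less)
  then show ?thesis using True d by (simp add: power_0_left)
next
  case False
  with R have R: "R > 0" by simp
  have ball [measurable]: "Rn_ball d r \<in> sets (Rn_measure d)" for r unfolding Rn_ball_def by measurable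
  have cball: "emeasure (Rn_measure d) {v \<in> space (Rn_measure d). Rn_norm d v \<le> r} = ennreal (unit_ball_vol (real d) * r ^ d)"
    if "r > 0" for r
  proof -
    have "{v \<in> space (Rn_measure d). Rn_norm d v \<le> r}
      = {f. sqrt (\<Sum>i\<in>{1..d}. (f i)\<^sup>2) \<le> r} \<inter> space (Pi\<^sub>M {1..d} (\<lambda>_. lborel))"
      by (auto simp: Rn_norm_def L2_set_def Rn_measure_def)
    then show ?thesis
      using emeasure_cball_aux[OF _ that, of "{1..d}"] by (simp add: Rn_measure_def)
  qed
  have upper: "emeasure (Rn_measure d) (Rn_ball d R) \<le> ennreal (unit_ball_vol (real d) * R ^ d)"
    unfolding cball[OF R, symmetric] by (rule emeasure_mono) (auto simp: Rn_ball_def)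
  then obtain m where m: "emeasure (Rn_measure d) (Rn_ball d R) = ennreal m" "m \<ge> 0"
    by (cases "emeasure (Rn_measure d) (Rn_ball d R)") (auto simp: top_unique)
  have lower: "unit_ball_vol (real d) * r ^ d \<le> m" if "0 < r" "r < R" for r
  proof -
    have "emeasure (Rn_measure d) {v \<in> space (Rn_measure d). Rn_norm d v \<le> r} \<le> emeasure (Rn_measure d) (Rn_ball d R)"
      by (rule emeasure_mono[OF _ ball]) (use that in \<open>auto simp: Rn_ball_def\<close>)
    then show ?thesis using m by (simp add: cball[OF that(1)])
  qed
  have "unit_ball_vol (real d) * R ^ d \<le> m"
  proof (rule tendsto_upperbound)
    show "((\<lambda>r. unit_ball_vol (real d) * r ^ d) \<longlongrightarrow> unit_ball_vol (real d) * R ^ d) (at_left R)"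
      by (intro tendsto_intros)
    show "\<forall>\<^sub>F r in at_left R. unit_ball_vol (real d) * r ^ d \<le> m"
      using eventually_at_left_real[OF R] by eventually_elim (use lower in auto)
  qed simp
  moreover have "m \<le> unit_ball_vol (real d) * R ^ d"
    using upper m R by simp
  ultimately show ?thesis using m by simp
qed

definition ball_volume :: "nat \<Rightarrow> (nat \<Rightarrow> real) \<Rightarrow> real" where
  "ball_volume d v = measure (Rn_measure d) (Rn_ball d (Rn_norm d v))"

lemma ball_volume_eq: "d \<ge> 1 \<Longrightarrow> ball_volume d v = unit_ball_vol (real d) * Rn_norm d v ^ d"
  by (simp add: ball_volume_def measure_def emeasure_Rn_ball Rn_norm_nonneg)

text \<open>Lets the domain of integration, given by norms, be described by the volume
  coordinates.\<close>

lemma ball_volume_less_iff: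
  assumes "d \<ge> 1" shows "ball_volume d v < ball_volume d w \<longleftrightarrow> Rn_norm d v < Rn_norm d w"
proof -
  have V: "unit_ball_vol (real d) > 0" by simp
  have "ball_volume d v < ball_volume d w \<longleftrightarrow> Rn_norm d v ^ d < Rn_norm d w ^ d"
    using assms by (simp only: ball_volume_eq mult_less_cancel_left_pos[OF V])
  also have "\<dots> \<longleftrightarrow> Rn_norm d v < Rn_norm d w"
    using assms power_mono_iff[of "Rn_norm d w" "Rn_norm d v" d] Rn_norm_nonneg by (simp add: not_le[symmetric] del: not_le)
  finally show ?thesis .
qed

lemma volume_coordinate_ball_volume:
  assumes d: "d \<ge> 1"
  shows "volume_coordinate (Rn_measure d) (ball_volume d)"
proof -
  interpret sigma_finite_measure "Rn_measure d" by (rule sigma_finite_Rn_measure)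
  show ?thesis
  proof
    show "ball_volume d \<in> borel_measurable (Rn_measure d)"
    proof -
      have "ball_volume d = (\<lambda>v. unit_ball_vol (real d) * Rn_norm d v ^ d)"
        by (rule ext) (rule ball_volume_eq[OF d])
      then show ?thesis by simp
    qed
    show "0 \<le> ball_volume d x" for x by (simp add: ball_volume_def)
    fix s :: real assume s: "0 \<le> s"
    let ?V = "unit_ball_vol (real d)"
    have V: "?V > 0" by simp
    then have V0: "?V \<noteq> 0" by (rule less_imp_neq[THEN not_sym])
    \<comment> \<open>The sublevel set is the ball whose radius \<open>root d (s / ?V)\<close> is
      chosen to give it volume \<open>s\<close>.\<close>
    have "(ball_volume d x < s) = (Rn_norm d x < root d (s / ?V))" for x
    proof -
      have "(ball_volume d x < s) = (Rn_norm d x ^ d < s / ?V)"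
        using V d by (simp add: ball_volume_eq field_simps)
      also have "\<dots> = (root d (Rn_norm d x ^ d) < root d (s / ?V))" using d by simp
      also have "root d (Rn_norm d x ^ d) = Rn_norm d x"
        using d Rn_norm_nonneg by (simp add: real_root_power_cancel)
      finally show ?thesis .
    qed
    then have "{x \<in> space (Rn_measure d). ball_volume d x < s} = Rn_ball d (root d (s / ?V))"
      by (simp add: Rn_ball_def)
    then show "emeasure (Rn_measure d) {x \<in> space (Rn_measure d). ball_volume d x < s} = ennreal s"
      using d s V V0 by (simp add: emeasure_Rn_ball real_root_pow_pos2)
  qed
qed

context hardy_exponents
begin

text \<open>The shape of one factor of \<open>C\<close>: the first power is
  \<open>(p' / q) powr (1 / q)\<close>, the second carries the Beta function, and
  \<open>r / q\<close> is the common value of \<open>\<beta> i / n i\<close>.\<close>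

lemma bliss_const_powr: "bliss_const powr (1 / q) = (1 / (q - r - 1)) powr (1 / q) * mass_lim powr (- (r / q))"
proof -
  have "bliss_const powr (1 / q) = (1 / (q - r - 1)) powr (1 / q) * (mass_lim powr (1 / q) * mass_lim powr (- (q / p) * (1 / q)))"
    by (simp add: bliss_const_def moment_lim_def powr_mult powr_powr powr_divide)
  also have "mass_lim powr (1 / q) * mass_lim powr (- (q / p) * (1 / q)) = mass_lim powr (1 / q + - (q / p) * (1 / q))"
    by (simp only: powr_add)
  also have "1 / q + - (q / p) * (1 / q) = - (r / q)"
    using q_gt_1 p_gt_1 by (simp add: r_def field_simps)
  finally show ?thesis .
qed

text \<open>Equality for the product extremal: \<open>moment_lim ^ k\<close> and
  \<open>mass_lim ^ k\<close> are the integrals behind its two norms.\<close>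

lemma extremal_ratio:
  "(moment_lim ^ k) powr (1 / q) = (bliss_const powr (1 / q)) ^ k * (mass_lim ^ k) powr (1 / p)"
proof -
  have "moment_lim powr (1 / q) = bliss_const powr (1 / q) * mass_lim powr (1 / p)"
    using mass_lim_pos p_gt_1 q_gt_1
    by (simp add: bliss_const_def powr_mult powr_powr flip: powr_add)
  then have "(moment_lim powr (1 / q)) ^ k = (bliss_const powr (1 / q)) ^ k * (mass_lim powr (1 / p)) ^ k"
    by (simp add: power_mult_distrib)
  moreover have "(x ^ k) powr a = (x powr a) ^ k" if "x > 0" for x a :: real
    using that by (simp add: powr_powr mult.commute flip: powr_realpow)
  ultimately show ?thesis using mass_lim_pos moment_lim_pos by simp
qed

end

text \<open>The scalar type \<open>'k\<close> covers real and complex functions at once. Membership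
  in the target space is part of the conclusion because \<open>Lp_norm\<close> alone does not
  express measurability.\<close>

theorem theorem1p1:
  fixes m :: nat and n :: "nat \<Rightarrow> nat" and \<beta> :: "nat \<Rightarrow> real"
    and p q p' q' C :: real
  assumes "m \<ge> 1"
    and "\<And>i. i \<in> {1..m} \<Longrightarrow> n i \<ge> 1"
    and "1 < p" and "p < q"
    and "1 / p + 1 / p' = 1" and "1 / q + 1 / q' = 1"
    and "\<And>i. i \<in> {1..m} \<Longrightarrow> 0 < \<beta> i \<and> \<beta> i < real (n i)"
    and "\<And>i. i \<in> {1..m} \<Longrightarrow> 1 / q = 1 / p - \<beta> i / real (n i)"
    and "C = (\<Prod>i=1..m. (p' / q) powr (1 / q) *
               (real (n i) / (q * \<beta> i) *
                Beta (real (n i) / (q * \<beta> i)) (real (n i) / (q' * \<beta> i)))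
               powr (- (\<beta> i / real (n i))))"
  shows "(\<forall>f :: (nat \<Rightarrow> nat \<Rightarrow> real) \<Rightarrow> 'k::{real_normed_field, banach, second_countable_topology}.
            f \<in> Lp_space (Rprod_measure m n) p \<longrightarrow>
              hardy_frac m n \<beta> f \<in> Lp_space (Rprod_measure m n) q \<and>
              Lp_norm (Rprod_measure m n) q (hardy_frac m n \<beta> f)
                \<le> ennreal C * Lp_norm (Rprod_measure m n) p f)
       \<and> Lp_Lq_opnorm (Rprod_measure m n) p q
           (hardy_frac m n \<beta> :: ((nat \<Rightarrow> nat \<Rightarrow> real) \<Rightarrow> 'k) \<Rightarrow> (nat \<Rightarrow> nat \<Rightarrow> real) \<Rightarrow> 'k)
         = ennreal C"
proof -
  interpret hardy_exponents p q by unfold_locales (use assms in auto)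
  define M where "M i = Rn_measure (n i)" for i
  define \<tau> where "\<tau> i = ball_volume (n i)" for i
  define I where "I = {1..m}"
  have I [simp]: "finite I" and card_I: "card I = m" by (auto simp: I_def)
  interpret product_sigma_finite M
    by (intro product_sigma_finite.intro) (simp add: M_def sigma_finite_Rn_measure)
  interpret hardy_product p q M \<tau> ..
  have vol: "volume_coordinate (M i) (\<tau> i)" if "i \<in> I" for i
    unfolding M_def \<tau>_def using that assms(2) by (intro volume_coordinate_ball_volume) (simp add: I_def)
  define P where "P = Pi\<^sub>M I M"
  have Rprod: "Rprod_measure m n = completion P"
    by (simp add: Rprod_measure_def P_def I_def M_def[abs_def])
  interpret P: sigma_finite_measure P unfolding P_def by (rule sigma_finite) simp

  have beta: "\<beta> i / real (n i) = r / q" if "i \<in> I" for i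
  proof -
    have "\<beta> i / real (n i) = 1 / p - 1 / q" using assms(8)[of i] that by (simp add: I_def)
    then show ?thesis using p_gt_1 q_gt_1 by (simp add: r_def field_simps)
  qed
  \<comment> \<open>Every factor has the same value, since
    \<open>\<beta> i / n i = 1 / p - 1 / q\<close> does not depend on \<open>i\<close>; the
    dimensions enter only through this quotient.\<close>
  have C_eq: "C = (bliss_const powr (1 / q)) ^ m"
  proof -
    have "(p' / q) powr (1 / q) * (real (n i) / (q * \<beta> i) * Beta (real (n i) / (q * \<beta> i)) (real (n i) / (q' * \<beta> i)))
               powr (- (\<beta> i / real (n i))) = bliss_const powr (1 / q)" if i: "i \<in> {1..m}" for i
    proof -
      have pos: "\<beta> i > 0" "real (n i) > 0" using assms(7)[OF i] by auto
      have nb: "real (n i) / \<beta> i = q / r"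
        using beta[of i] pos r_pos q_gt_1 i by (simp add: I_def field_simps)
      have 1: "real (n i) / (q * \<beta> i) = 1 / r"
      proof -
        have "real (n i) / (q * \<beta> i) = (real (n i) / \<beta> i) / q" by simp
        then show ?thesis using nb q_gt_1 by simp
      qed
      have 2: "real (n i) / (q' * \<beta> i) = (q - 1) / r"
      proof -
        have "real (n i) / (q' * \<beta> i) = (real (n i) / \<beta> i) * (1 / q')" by simp
        also have "1 / q' = 1 - 1 / q" using assms(6) by simp
        also have "real (n i) / \<beta> i * (1 - 1 / q) = (q - 1) / r"
          unfolding nb using q_gt_1 r_pos by (simp add: field_simps)
        finally show ?thesis .
      qed
      have 3: "p' / q = 1 / (q - r - 1)"
      proof -
        have "1 / p' = 1 - 1 / p" using assms(5) by simp
        then have "p' = 1 / (1 - 1 / p)" by (metis divide_divide_eq_right div_by_1 mult_1)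
        moreover have "q - r - 1 = q * (1 - 1 / p)" by (simp add: r_def algebra_simps)
        ultimately show ?thesis by simp
      qed
      show ?thesis
        unfolding 1 2 3 beta[OF i[folded I_def]] bliss_const_powr by (simp add: mass_lim_def)
    qed
    then show ?thesis unfolding assms(9) by simp
  qed
  have C_pos: "C > 0" using bliss_const_pos by (simp add: C_eq)

  have dom: "(\<forall>i\<in>{1..m}. Rn_norm (n i) (y i) < Rn_norm (n i) (x i)) \<longleftrightarrow> (\<forall>i\<in>I. \<tau> i (y i) < \<tau> i (x i))" for x y
    using assms(2) by (simp add: I_def \<tau>_def ball_volume_less_iff)
  define A where "A x = {y \<in> space P. \<forall>i\<in>I. \<tau> i (y i) < \<tau> i (x i)}" for x
  have hardy: "hardy_frac m n \<beta> f x = weight I x *\<^sub>R (\<integral>y. indicator (A x) y *\<^sub>R f y \<partial>completion P)"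
    for f :: "(nat \<Rightarrow> nat \<Rightarrow> real) \<Rightarrow> 'k" and x
  proof -
    have "1 / measure (Rn_measure (n i)) (Rn_ball (n i) (Rn_norm (n i) (x i))) powr (1 - \<beta> i / real (n i))
       = \<tau> i (x i) powr (1 / p - 1 / q - 1)" if i: "i \<in> {1..m}" for i
    proof -
      have "1 / p - 1 / q - 1 = - (1 - \<beta> i / real (n i))" using assms(8)[OF i] by simp
      then show ?thesis by (simp only: powr_minus_divide \<tau>_def ball_volume_def)
    qed
    then have "(\<Prod>i=1..m. 1 / measure (Rn_measure (n i)) (Rn_ball (n i) (Rn_norm (n i) (x i))) powr (1 - \<beta> i / real (n i)))
       = weight I x"
      unfolding weight_def I_def by (intro prod.cong refl) auto
    then show ?thesis
      unfolding hardy_frac_def by (simp only: Rprod dom set_lebesgue_integral_def A_def space_completion)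
  qed

  have \<tau>m [measurable]: "(\<lambda>y. \<tau> i (y i)) \<in> borel_measurable P" if "i \<in> I" for i
    unfolding P_def using \<tau>_component_measurable[OF I vol that] by simp
  have weight_meas [measurable]: "weight I \<in> borel_measurable P"
    unfolding weight_def[abs_def] by (intro borel_measurable_prod) measurable
  have A_pred: "Measurable.pred (P \<Otimes>\<^sub>M P) (\<lambda>z. \<forall>i\<in>I. \<tau> i (snd z i) < \<tau> i (fst z i))"
  proof (rule pred_intros_finite)
    fix i assume i: "i \<in> I"
    have [measurable]: "(\<lambda>z. \<tau> i (snd z i)) \<in> borel_measurable (P \<Otimes>\<^sub>M P)" "(\<lambda>z. \<tau> i (fst z i)) \<in> borel_measurable (P \<Otimes>\<^sub>M P)"
      using measurable_compose[OF measurable_snd \<tau>m[OF i]] measurable_compose[OF measurable_fst \<tau>m[OF i]] by auto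
    show "Measurable.pred (P \<Otimes>\<^sub>M P) (\<lambda>z. \<tau> i (snd z i) < \<tau> i (fst z i))" by measurable
  qed simp
  have A_sets [measurable]: "A x \<in> sets P" for x
  proof -
    have "Measurable.pred P (\<lambda>y. \<forall>i\<in>I. \<tau> i (y i) < \<tau> i (x i))"
    proof (rule pred_intros_finite)
      fix i assume "i \<in> I"
      from \<tau>m[OF this] show "Measurable.pred P (\<lambda>y. \<tau> i (y i) < \<tau> i (x i))"
        by (rule borel_measurable_pred_less) simp
    qed simp
    then show ?thesis unfolding A_def by measurable
  qed

  have bound: "hardy_frac m n \<beta> f \<in> borel_measurable (completion P) \<and>
      Lp_norm (completion P) q (hardy_frac m n \<beta> f) \<le> ennreal C * Lp_norm (completion P) p f"
    if f: "f \<in> borel_measurable (completion P)" for f :: "(nat \<Rightarrow> nat \<Rightarrow> real) \<Rightarrow> 'k"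
  proof -
    \<comment> \<open>A Borel representative of \<open>f\<close>: the product measurability used
      below holds for \<open>P\<close>, not for its completion, and the operator does not see the
      change on a null set.\<close>
    obtain g where g [measurable]: "g \<in> borel_measurable P" and fg: "AE y in P. f y = g y"
      using completion_ex_borel_measurable_metric[OF f] by blast
    have int_eq: "(\<integral>y. indicator (A x) y *\<^sub>R f y \<partial>completion P) = (\<integral>y. indicator (A x) y *\<^sub>R g y \<partial>P)" for x
    proof -
      have "(\<integral>y. indicator (A x) y *\<^sub>R f y \<partial>completion P) = (\<integral>y. indicator (A x) y *\<^sub>R g y \<partial>completion P)"
      proof (rule integral_cong_AE)
        show "(\<lambda>y. indicator (A x) y *\<^sub>R f y) \<in> borel_measurable (completion P)"
          using f by (intro borel_measurable_scaleR borel_measurable_indicator) auto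
        show "(\<lambda>y. indicator (A x) y *\<^sub>R g y) \<in> borel_measurable (completion P)"
          by (intro measurable_completion) measurable
        show "AE y in completion P. indicator (A x) y *\<^sub>R f y = indicator (A x) y *\<^sub>R g y"
          by (intro AE_completion) (use fg in auto)
      qed
      also have "\<dots> = (\<integral>y. indicator (A x) y *\<^sub>R g y \<partial>P)" by (rule integral_completion) measurable
      finally show ?thesis .
    qed
    have Hg: "hardy_frac m n \<beta> f x = weight I x *\<^sub>R (\<integral>y. indicator (A x) y *\<^sub>R g y \<partial>P)" for x
      by (simp add: hardy int_eq)
    have H_meas: "hardy_frac m n \<beta> f \<in> borel_measurable P"
    proof -
      note [measurable] = A_pred
      have "(\<lambda>(x, y). if \<forall>i\<in>I. \<tau> i (y i) < \<tau> i (x i) then g y else 0) \<in> borel_measurable (P \<Otimes>\<^sub>M P)"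
        unfolding case_prod_beta' by measurable
      then have "(\<lambda>x. \<integral>y. (if \<forall>i\<in>I. \<tau> i (y i) < \<tau> i (x i) then g y else 0) \<partial>P) \<in> borel_measurable P"
        by (rule P.borel_measurable_lebesgue_integral)
      moreover have "(\<integral>y. (if \<forall>i\<in>I. \<tau> i (y i) < \<tau> i (x i) then g y else 0) \<partial>P)
          = (\<integral>y. indicator (A x) y *\<^sub>R g y \<partial>P)" for x
        by (intro Bochner_Integration.integral_cong refl) (simp add: A_def indicator_def)
      ultimately have "(\<lambda>x. \<integral>y. indicator (A x) y *\<^sub>R g y \<partial>P) \<in> borel_measurable P" by simp
      then show ?thesis unfolding Hg[abs_def] by measurable
    qed
    define h where "h y = ennreal (norm (g y))" for y
    have h [measurable]: "h \<in> borel_measurable P" unfolding h_def by measurable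
    \<comment> \<open>Where the integrand is not integrable, the Bochner integral is
      \<open>0\<close> by default and the bound is trivial.\<close>
    have pointwise: "ennreal (norm (hardy_frac m n \<beta> f x)) \<le> nn_hardy I h x" for x
    proof -
      have "ennreal (norm (\<integral>y. indicator (A x) y *\<^sub>R g y \<partial>P)) \<le> (\<integral>\<^sup>+y. ennreal (norm (indicator (A x) y *\<^sub>R g y)) \<partial>P)"
        by (cases "integrable P (\<lambda>y. indicator (A x) y *\<^sub>R g y)")
          (rule integral_norm_bound_ennreal, simp_all add: not_integrable_integral_eq)
      also have "\<dots> = (\<integral>\<^sup>+y. (if \<forall>i\<in>I. \<tau> i (y i) < \<tau> i (x i) then h y else 0) \<partial>P)"
        by (intro nn_integral_cong) (simp add: A_def h_def indicator_def)
      finally have "ennreal (weight I x) * ennreal (norm (\<integral>y. indicator (A x) y *\<^sub>R g y \<partial>P)) \<le> nn_hardy I h x"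
        unfolding nn_hardy_def P_def by (rule mult_left_mono) simp
      then show ?thesis by (simp add: Hg weight_nonneg ennreal_mult)
    qed
    have "(\<integral>\<^sup>+x. ennreal (norm (hardy_frac m n \<beta> f x) powr q) \<partial>completion P)
       = (\<integral>\<^sup>+x. epowr (ennreal (norm (hardy_frac m n \<beta> f x))) q \<partial>P)"
      by (simp add: nn_integral_completion)
    also have "\<dots> \<le> (\<integral>\<^sup>+x. epowr (nn_hardy I h x) q \<partial>P)"
      using q_gt_1 by (intro nn_integral_mono epowr_mono pointwise) auto
    also have "\<dots> \<le> ennreal (bliss_const ^ m) * epowr (\<integral>\<^sup>+y. epowr (h y) p \<partial>P) (q / p)"
      using nn_hardy_bound[OF I vol h[unfolded P_def]] by (simp add: P_def card_I)
    also have "(\<integral>\<^sup>+y. epowr (h y) p \<partial>P) = (\<integral>\<^sup>+y. ennreal (norm (f y) powr p) \<partial>completion P)"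
      unfolding nn_integral_completion
      by (intro nn_integral_cong_AE eventually_mono[OF fg]) (simp add: h_def)
    finally have "Lp_norm (completion P) q (hardy_frac m n \<beta> f)
       \<le> epowr (ennreal (bliss_const ^ m) * epowr (\<integral>\<^sup>+y. ennreal (norm (f y) powr p) \<partial>completion P) (q / p)) (1 / q)"
      unfolding Lp_norm_eq_epowr using q_gt_1 by (intro epowr_mono) auto
    also have "\<dots> = ennreal ((bliss_const ^ m) powr (1 / q)) * Lp_norm (completion P) p f"
      using q_gt_1 bliss_const_pos by (simp add: epowr_mult epowr_epowr Lp_norm_eq_epowr)
    also have "(bliss_const ^ m) powr (1 / q) = C"
      using bliss_const_pos by (simp add: C_eq powr_powr mult.commute flip: powr_realpow)
    finally show ?thesis using measurable_completion[OF H_meas] by blast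
  qed

  define e where "e y = (of_real (extremal_fun I y) :: 'k)" for y
  have ext [measurable]: "extremal_fun I \<in> borel_measurable P"
    unfolding P_def by (intro extremal_fun_measurable I vol)
  have [measurable]: "(of_real :: real \<Rightarrow> 'k) \<in> borel_measurable borel"
    by (intro borel_measurable_continuous_onI continuous_intros)
  have e_P [measurable]: "e \<in> borel_measurable P"
    unfolding e_def[abs_def] by measurable
  then have e_meas: "e \<in> borel_measurable (completion P)" by (rule measurable_completion)
  have e_norm: "Lp_norm (completion P) p e = ennreal ((mass_lim ^ m) powr (1 / p))"
    using nn_integral_extremal_fun_powr[OF I vol] extremal_fun_pos[of I] mass_lim_pos
    by (simp add: Lp_norm_eq_epowr nn_integral_completion e_def P_def card_I abs_of_pos)
  have e_hardy: "Lp_norm (completion P) q (hardy_frac m n \<beta> e) = ennreal ((moment_lim ^ m) powr (1 / q))"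
  proof -
    have "hardy_frac m n \<beta> e x = of_real (weight I x * (\<Prod>i\<in>I. extremal_prim (\<tau> i (x i))))"
      if x: "x \<in> space P" for x
    proof -
      let ?v = "\<Prod>i\<in>I. extremal_prim (\<tau> i (x i))"
      have v: "?v \<ge> 0"
      proof (rule prod_nonneg)
        fix i assume i: "i \<in> I"
        show "0 \<le> extremal_prim (\<tau> i (x i))" by (simp add: extremal_prim_def \<tau>_def ball_volume_def)
      qed
      have "has_bochner_integral P (\<lambda>y. indicator (A x) y * extremal_fun I y) ?v"
      proof (rule has_bochner_integral_nn_integral[OF _ _ v])
        have "(\<integral>\<^sup>+y. ennreal (indicator (A x) y * extremal_fun I y) \<partial>P)
          = (\<integral>\<^sup>+y. (if \<forall>i\<in>I. \<tau> i (y i) < \<tau> i (x i) then ennreal (extremal_fun I y) else 0) \<partial>P)"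
          by (intro nn_integral_cong) (simp add: A_def indicator_def)
        also have "\<dots> = ennreal ?v"
          using nn_integral_extremal_fun_less[OF I vol x[unfolded P_def]] by (simp add: P_def)
        finally show "(\<integral>\<^sup>+y. ennreal (indicator (A x) y * extremal_fun I y) \<partial>P) = ennreal ?v" .
      qed (auto intro!: AE_I2 mult_nonneg_nonneg less_imp_le[OF extremal_fun_pos])
      then have "has_bochner_integral P (\<lambda>y. of_real (indicator (A x) y * extremal_fun I y) :: 'k) (of_real ?v)"
        by (rule has_bochner_integral_of_real)
      then have "(\<integral>y. indicator (A x) y *\<^sub>R e y \<partial>P) = of_real ?v"
        by (simp add: has_bochner_integral_iff e_def scaleR_conv_of_real)
      moreover have "(\<integral>y. indicator (A x) y *\<^sub>R e y \<partial>completion P) = (\<integral>y. indicator (A x) y *\<^sub>R e y \<partial>P)"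
        by (rule integral_completion) measurable
      ultimately show ?thesis by (simp add: hardy scaleR_conv_of_real)
    qed
    then have "(\<integral>\<^sup>+x. ennreal (norm (hardy_frac m n \<beta> e x) powr q) \<partial>P)
       = (\<integral>\<^sup>+x. ennreal ((weight I x * (\<Prod>i\<in>I. extremal_prim (\<tau> i (x i)))) powr q) \<partial>P)"
    proof (intro nn_integral_cong)
      fix x assume x: "x \<in> space P"
      have "0 \<le> weight I x * (\<Prod>i\<in>I. extremal_prim (\<tau> i (x i)))"
        by (intro mult_nonneg_nonneg weight_nonneg prod_nonneg) (simp add: extremal_prim_def \<tau>_def ball_volume_def)
      then show "ennreal (norm (hardy_frac m n \<beta> e x) powr q)
         = ennreal ((weight I x * (\<Prod>i\<in>I. extremal_prim (\<tau> i (x i)))) powr q)"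
        using \<open>\<And>x. x \<in> space P \<Longrightarrow> _\<close>[OF x] by (simp only: norm_of_real abs_of_nonneg)
    qed
    also have "\<dots> = ennreal (moment_lim ^ m)"
      using nn_integral_extremal_fun_hardy[OF I vol] by (simp add: P_def card_I)
    finally show ?thesis using moment_lim_pos by (simp add: Lp_norm_eq_epowr nn_integral_completion)
  qed

  have opnorm: "Lp_Lq_opnorm (completion P) p q
     (hardy_frac m n \<beta> :: ((nat \<Rightarrow> nat \<Rightarrow> real) \<Rightarrow> 'k) \<Rightarrow> (nat \<Rightarrow> nat \<Rightarrow> real) \<Rightarrow> 'k) = ennreal C"
    unfolding Lp_Lq_opnorm_def
  proof (rule antisym)
    let ?S = "{f \<in> Lp_space (completion P) p. \<not> (AE x in completion P. f x = 0)} :: ((nat \<Rightarrow> nat \<Rightarrow> real) \<Rightarrow> 'k) set"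
    show "(SUP f\<in>?S.
        Lp_norm (completion P) q (hardy_frac m n \<beta> f) / Lp_norm (completion P) p f) \<le> ennreal C"
    proof (rule SUP_least)
      fix f :: "(nat \<Rightarrow> nat \<Rightarrow> real) \<Rightarrow> 'k"
      assume "f \<in> ?S"
      then have f [measurable]: "f \<in> borel_measurable (completion P)" and nz: "\<not> (AE x in completion P. f x = 0)"
        by (auto simp: Lp_space_def)
      have "Lp_norm (completion P) p f \<noteq> 0"
      proof
        assume "Lp_norm (completion P) p f = 0"
        then have "(\<integral>\<^sup>+x. ennreal (norm (f x) powr p) \<partial>completion P) = 0"
          by (simp add: Lp_norm_eq_epowr)
        then have "AE x in completion P. ennreal (norm (f x) powr p) = 0"
          by (subst (asm) nn_integral_0_iff_AE) auto
        then have "AE x in completion P. f x = 0"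
          by eventually_elim (simp add: ennreal_eq_0_iff)
        with nz show False by blast
      qed
      then show "Lp_norm (completion P) q (hardy_frac m n \<beta> f) / Lp_norm (completion P) p f \<le> ennreal C"
        using bound[OF f] by (intro divide_le_posI_ennreal) (auto simp: zero_less_iff_neq_zero mult.commute)
    qed
    show "ennreal C \<le> (SUP f\<in>?S.
        Lp_norm (completion P) q (hardy_frac m n \<beta> f) / Lp_norm (completion P) p f)"
    \<comment> \<open>The supremum is attained: by \<open>extremal_ratio\<close> the quotient for
      \<open>e\<close> is exactly \<open>C\<close>.\<close>
    proof (rule SUP_upper2[of e])
      have "\<not> (AE x in completion P. e x = 0)"
      proof
        assume "AE x in completion P. e x = 0"
        then have "AE x in completion P. ennreal (norm (e x) powr p) = 0" by eventually_elim simp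
        then have "(\<integral>\<^sup>+x. ennreal (norm (e x) powr p) \<partial>completion P) = 0"
          using e_meas by (subst nn_integral_0_iff_AE) auto
        then have "Lp_norm (completion P) p e = 0" by (simp add: Lp_norm_eq_epowr)
        then show False using e_norm mass_lim_pos by (simp add: ennreal_eq_0_iff)
      qed
      then show "e \<in> ?S"
        using e_meas e_norm by (simp add: Lp_space_def)
      have "(moment_lim ^ m) powr (1 / q) = C * (mass_lim ^ m) powr (1 / p)"
        by (simp add: C_eq extremal_ratio)
      then show "ennreal C \<le> Lp_norm (completion P) q (hardy_frac m n \<beta> e) / Lp_norm (completion P) p e"
        using mass_lim_pos C_pos by (simp add: e_norm e_hardy divide_ennreal)
    qed
  qed
  show ?thesis
    unfolding Rprod
  proof (intro conjI allI impI opnorm)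
    fix f :: "(nat \<Rightarrow> nat \<Rightarrow> real) \<Rightarrow> 'k"
    assume "f \<in> Lp_space (completion P) p"
    then have f: "f \<in> borel_measurable (completion P)" "Lp_norm (completion P) p f < \<infinity>"
      by (auto simp: Lp_space_def)
    show le: "Lp_norm (completion P) q (hardy_frac m n \<beta> f) \<le> ennreal C * Lp_norm (completion P) p f"
      using bound[OF f(1)] by blast
    also have "\<dots> < \<infinity>" using f(2) by (simp add: ennreal_mult_less_top)
    finally show "hardy_frac m n \<beta> f \<in> Lp_space (completion P) q"
      using bound[OF f(1)] by (simp add: Lp_space_def)
  qed
qed

end
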